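(* Let $k$ be an algebraically closed field of characteristic zero. Every Nodal projective plane curve and every Cuspidal projective plane curve in $\mathbb{P}_k^2$ is of gradient linear type; that is, if $f\in k[x,y,z]$ is a reduced homogeneous polynomial of degree $d\ge2$ such that $X=V(f)\subset\mathbb{P}_k^2$ is Nodal or Cuspidal, then the gradient ideal $J(f)=(\partial f/\partial x,\partial f/\partial y,\partial f/\partial z)\subset k[x,y,z]$ is of linear type.
   Context: Let $X=V(f)\subset\mathbb{P}_k^2$ be defined by a reduced homogeneous polynomial $f\in k[x,y,z]$ of degree $d\ge2$, and let $P$ be a singular point of $X$. After a projective transformation assume $P=[0:0:1]$ and write $F(x,y)=f(x,y,1)=F_2+\cdots+F_d$ with $F_i\in k[x,y]$ homogeneous of degree $i$. Suppose that $X$ has multiplicity $2$ at $P$, i.e. $F_2\ne0$, and write $F_2=ax^2+bxy+cy^2$. The point $P$ is called a node if $b^2\ne4ac$ (that is, $X$ has two distinct tangents at $P$), and a cusp if $b^2=4ac$ (that is, $X$ has only one tangent at $P$). The curve $X$ is called Nodal if its singular points are nodes, and Cuspidal if its singular points are cusps. An ideal $I$ of a commutative ring $S$ is of linear type if its symmetric algebra and its Rees algebra are isomorphic, i.e. the canonical surjection $\mathrm{Sym}_S(I)\to\mathcal{R}_S(I)=\bigoplus_{t\ge0}I^t$ is an isomorphism. *)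

theory Defs
  imports
    "HOL-Analysis.Cartesian_Space"
    "HOL-Library.Poly_Mapping"
    "HOL-Algebra.Algebraic_Closure_Type"
    "HOL-Algebra.Ideal_Product"
    "HOL-Algebra.QuotRing"
    "HOL-Computational_Algebra.Computational_Algebra"
begin

section \<open>Polynomials in several variables\<close>

text \<open>
  A polynomial with variables indexed by \<^typ>\<open>'v\<close> is a finitely supported map from exponent vectors
  \<^typ>\<open>'v \<Rightarrow>\<^sub>0 nat\<close> to coefficients; the ring structure is that of \<^theory>\<open>HOL-Library.Poly_Mapping\<close>.
\<close>

type_synonym ('v, 'a) mpoly = "('v \<Rightarrow>\<^sub>0 nat) \<Rightarrow>\<^sub>0 'a"

definition Const :: "'a::zero \<Rightarrow> ('v, 'a) mpoly" where
  "Const c = Poly_Mapping.single 0 c"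

definition Var :: "'v \<Rightarrow> ('v, 'a::zero_neq_one) mpoly" where
  "Var v = Poly_Mapping.single (Poly_Mapping.single v 1) 1"

definition mdeg :: "('v \<Rightarrow>\<^sub>0 nat) \<Rightarrow> nat" where
  "mdeg m = (\<Sum>v\<in>Poly_Mapping.keys m. Poly_Mapping.lookup m v)"

text \<open>
  When \<open>h\<close> is a homomorphism of commutative rings, \<^term>\<open>eval_hom h x\<close> is the unique ring homomorphism
  that extends \<open>h\<close> and sends the variable \<open>v\<close> to \<^term>\<open>x v\<close>.
\<close>

definition eval_hom :: "('a::zero \<Rightarrow> 'b::comm_semiring_1) \<Rightarrow> ('v \<Rightarrow> 'b) \<Rightarrow> ('v, 'a) mpoly \<Rightarrow> 'b" where
  "eval_hom h x p =
     (\<Sum>m\<in>Poly_Mapping.keys p.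
        h (Poly_Mapping.lookup p m) * (\<Prod>v\<in>Poly_Mapping.keys m. x v ^ Poly_Mapping.lookup m v))"

definition homogeneous :: "nat \<Rightarrow> ('v, 'a::zero) mpoly \<Rightarrow> bool" where
  "homogeneous d p \<longleftrightarrow> (\<forall>m\<in>Poly_Mapping.keys p. mdeg m = d)"

definition hom_component :: "nat \<Rightarrow> ('v, 'a::comm_monoid_add) mpoly \<Rightarrow> ('v, 'a) mpoly" where
  "hom_component i p =
     (\<Sum>m\<in>{m\<in>Poly_Mapping.keys p. mdeg m = i}. Poly_Mapping.single m (Poly_Mapping.lookup p m))"

text \<open>
  The exponent subtraction is truncated, but where it truncates the coefficient is zero.
\<close>

definition partial_deriv :: "'v \<Rightarrow> ('v, 'a::comm_semiring_1) mpoly \<Rightarrow> ('v, 'a) mpoly" where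
  "partial_deriv v p =
     (\<Sum>m\<in>Poly_Mapping.keys p.
        Poly_Mapping.single (m - Poly_Mapping.single v 1)
          (of_nat (Poly_Mapping.lookup m v) * Poly_Mapping.lookup p m))"


section \<open>Ideals of linear type\<close>

text \<open>
  The symmetric algebra of an ideal \<open>I\<close>, by generators and relations: one variable \<open>T\<^sub>a\<close> for every
  \<open>a \<in> I\<close>, modulo the relations that make \<open>a \<mapsto> T\<^sub>a\<close> linear over the base ring.
\<close>

definition sym_free_ring :: "'a::comm_ring_1 set \<Rightarrow> ('a, 'a) mpoly ring" where
  "sym_free_ring I =
     ring_of_type_algebra\<lparr>carrier := {p. \<forall>m\<in>Poly_Mapping.keys p. Poly_Mapping.keys m \<subseteq> I}\<rparr>"

definition sym_relations :: "'a::comm_ring_1 set \<Rightarrow> ('a, 'a) mpoly set" where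
  "sym_relations I =
     {Var (a + b) - (Var a + Var b) | a b. a \<in> I \<and> b \<in> I} \<union>
     {Var (s * a) - Const s * Var a | s a. a \<in> I}"

definition sym_algebra :: "'a::comm_ring_1 set \<Rightarrow> ('a, 'a) mpoly set ring" where
  "sym_algebra I = sym_free_ring I Quot (genideal (sym_free_ring I) (sym_relations I))"

text \<open>
  The Rees algebra \<open>\<Oplus>\<^sub>t I\<^sup>t\<close>, realised as the subring of the univariate polynomials whose
  coefficient in degree \<open>t\<close> lies in \<open>I\<^sup>t\<close>.
\<close>

definition rees_algebra :: "'a::comm_ring_1 set \<Rightarrow> 'a poly ring" where
  "rees_algebra I =
     ring_of_type_algebra\<lparr>carrier :=
       {p. \<forall>t. Polynomial.coeff p t \<in> I [^]\<^bsub>ideals_set ring_of_type_algebra\<^esub> t}\<rparr>"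

text \<open>
  The canonical surjection is induced by \<open>T\<^sub>a \<mapsto> a t\<close>; its value at a coset is the common value of
  \<^term>\<open>sym_to_rees_lift\<close> on the members of the coset.
\<close>

definition sym_to_rees_lift :: "('a::comm_ring_1, 'a) mpoly \<Rightarrow> 'a poly" where
  "sym_to_rees_lift = eval_hom (\<lambda>s. [:s:]) (\<lambda>a. Polynomial.monom a 1)"

definition sym_to_rees :: "('a::comm_ring_1, 'a) mpoly set \<Rightarrow> 'a poly" where
  "sym_to_rees C = the_elem (sym_to_rees_lift ` C)"

definition linear_type :: "'a::comm_ring_1 set \<Rightarrow> bool" where
  "linear_type I \<longleftrightarrow> sym_to_rees \<in> ring_iso (sym_algebra I) (rees_algebra I)"


section \<open>Plane projective curves\<close>

text \<open>
  The polynomial ring \<open>k[x,y,z]\<close> has variables indexed by the three-element type \<^typ>\<open>3\<close>, with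
  \<open>x, y, z\<close> numbered 1, 2, 3 (where \<open>3 = 0\<close> in that type).  Points of the projective plane are given
  by nonzero vectors of homogeneous coordinates.
\<close>

definition gradient_ideal :: "(3, 'k::field) mpoly \<Rightarrow> (3, 'k) mpoly set" where
  "gradient_ideal f =
     genideal ring_of_type_algebra {partial_deriv 1 f, partial_deriv 2 f, partial_deriv 3 f}"

definition eval_at :: "(3, 'k::field) mpoly \<Rightarrow> 'k ^ 3 \<Rightarrow> 'k" where
  "eval_at f p = eval_hom (\<lambda>c. c) (\<lambda>i. p $ i) f"

definition singular_point :: "(3, 'k::field) mpoly \<Rightarrow> 'k ^ 3 \<Rightarrow> bool" where
  "singular_point f p \<longleftrightarrow>
     p \<noteq> 0 \<and> eval_at f p = 0 \<and> (\<forall>i. eval_at (partial_deriv i f) p = 0)"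

definition lin_subst :: "'k ^ 3 ^ 3 \<Rightarrow> (3, 'k::field) mpoly \<Rightarrow> (3, 'k) mpoly" where
  "lin_subst A = eval_hom Const (\<lambda>i. \<Sum>j\<in>UNIV. Const (A $ i $ j) * Var j)"

definition dehomogenize :: "(3, 'k::field) mpoly \<Rightarrow> (2, 'k) mpoly" where
  "dehomogenize = eval_hom Const (\<lambda>i. if i = 1 then Var 1 else if i = 2 then Var 2 else 1)"

text \<open>
  \<open>F(x,y) = f(x,y,1)\<close> after a projective transformation that takes the point \<open>[p]\<close> to \<open>[0:0:1]\<close>;
  the matrix \<open>A\<close> is that of the inverse transformation.
\<close>

definition local_equation :: "(3, 'k::field) mpoly \<Rightarrow> 'k ^ 3 \<Rightarrow> (2, 'k) mpoly \<Rightarrow> bool" where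
  "local_equation f p F \<longleftrightarrow>
     (\<exists>A. invertible A \<and> A *v axis 3 1 = p \<and> F = dehomogenize (lin_subst A f))"

text \<open>The discriminant \<open>b\<^sup>2 - 4ac\<close> of \<open>F\<^sub>2 = ax\<^sup>2 + bxy + cy\<^sup>2\<close>.\<close>

definition quad_disc :: "(2, 'k::field) mpoly \<Rightarrow> 'k" where
  "quad_disc F =
     (let a = Poly_Mapping.lookup F (Poly_Mapping.single 1 2);
          b = Poly_Mapping.lookup F (Poly_Mapping.single 1 1 + Poly_Mapping.single 2 1);
          c = Poly_Mapping.lookup F (Poly_Mapping.single 2 2)
      in b ^ 2 - 4 * a * c)"

text \<open>
  Neither condition depends on the projective transformation chosen.  At a singular point the
  components \<open>F\<^sub>0\<close> and \<open>F\<^sub>1\<close> vanish, so \<open>F\<^sub>2 \<noteq> 0\<close> says that the multiplicity is 2.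
\<close>

definition is_node :: "(3, 'k::field) mpoly \<Rightarrow> 'k ^ 3 \<Rightarrow> bool" where
  "is_node f p \<longleftrightarrow> singular_point f p \<and>
     (\<exists>F. local_equation f p F \<and> hom_component 2 F \<noteq> 0 \<and> quad_disc F \<noteq> 0)"

definition is_cusp :: "(3, 'k::field) mpoly \<Rightarrow> 'k ^ 3 \<Rightarrow> bool" where
  "is_cusp f p \<longleftrightarrow> singular_point f p \<and>
     (\<exists>F. local_equation f p F \<and> hom_component 2 F \<noteq> 0 \<and> quad_disc F = 0)"

definition nodal :: "(3, 'k::field) mpoly \<Rightarrow> bool" where
  "nodal f \<longleftrightarrow> (\<forall>p. singular_point f p \<longrightarrow> is_node f p)"

definition cuspidal :: "(3, 'k::field) mpoly \<Rightarrow> bool" where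
  "cuspidal f \<longleftrightarrow> (\<forall>p. singular_point f p \<longrightarrow> is_cusp f p)"

end

theory Submission
  imports Defs "Berlekamp_Zassenhaus.Unique_Factorization_Poly"
begin

text \<open>
  Write \<open>S = k[x,y,z]\<close>, let \<open>f\<^sub>1, f\<^sub>2, f\<^sub>3\<close> be the partial derivatives of \<open>f\<close> and
  let \<open>B = S[T\<^sub>1,T\<^sub>2,T\<^sub>3]\<close>.  The symmetric algebra of \<open>J = (f\<^sub>1,f\<^sub>2,f\<^sub>3)\<close> is \<open>B\<close> modulo the
  ideal \<open>L\<close> of the linear relations \<open>g\<^sub>1T\<^sub>1 + g\<^sub>2T\<^sub>2 + g\<^sub>3T\<^sub>3\<close>, one for each syzygy \<open>g\<close> of the \<open>f\<^sub>i\<close>, and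
  the Rees algebra is \<open>B\<close> modulo all relations.  So the claim is that each form \<open>P(T)\<close> with
  \<open>P(f\<^sub>1,f\<^sub>2,f\<^sub>3) = 0\<close> lies in \<open>L\<close> (\<open>linear_typeI\<close>).

  As \<open>f\<close> is squarefree, the \<open>f\<^sub>i\<close> have no common divisor (\<open>no_common_divisor_partial_derivs\<close>).
  Two facts follow.  The quotient \<open>B/L\<close> has no nonzero element that is killed by a power of
  \<open>(x,y,z)\<close>: an element of \<open>B\<^sup>3\<close> that is orthogonal both to \<open>(f\<^sub>1,f\<^sub>2,f\<^sub>3)\<close> and to \<open>(T\<^sub>1,T\<^sub>2,T\<^sub>3)\<close> is
  a multiple of the cross product of these two vectors, and then the exactness of the Koszul complex
  of \<open>x\<^sup>n, y\<^sup>n, z\<^sup>n\<close> does the rest (\<open>linear_relations_irrelevant_torsion_free\<close>; this is the depth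
  count along the approximation complex, made explicit).  And if \<open>s\<close> is a coordinate of a syzygy,
  then a power of \<open>s\<close> multiplies every \<open>P\<close> as above into \<open>L\<close> (\<open>syzygy_power_kills\<close>): where
  \<open>s\<close> is invertible, \<open>J\<close> is generated by two of the \<open>f\<^sub>i\<close>, and an ideal generated by a regular
  sequence is of linear type.  Together they show that \<open>J\<close> is of linear type as soon as the
  coordinates of syzygies generate an ideal that contains a power of each variable
  (\<open>relations_are_linear\<close>).

  That ideal contains \<open>J\<close>, so it has no zero outside the singular points of the curve.  At a singular point of
  multiplicity two some derivative \<open>h\<close> of the dehomogenized equation has a nonzero linear part, so
  modulo \<open>h\<close> the local ring is a discrete valuation ring: one of the two remaining generators
  divides the other, which gives a syzygy with an invertible coordinate (\<open>local_syzygy\<close>,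
  \<open>syzygy_at_e3\<close>).  Nodes and cusps alike are points of multiplicity two, so a form of the
  Nullstellensatz applies.  It has an elementary proof here, since squarefreeness also yields in
  \<open>J\<close> a nonzero form without the variable \<open>x\<close>, one without \<open>y\<close> and one without \<open>z\<close>
  (\<open>elimination\<close>), and binary forms are products of linear forms (\<open>irrelevant_power_if_no_zero\<close>).
\<close>

abbreviation lookup :: "('a \<Rightarrow>\<^sub>0 'b::zero) \<Rightarrow> 'a \<Rightarrow> 'b" where "lookup \<equiv> Poly_Mapping.lookup"
abbreviation keys :: "('a \<Rightarrow>\<^sub>0 'b::zero) \<Rightarrow> 'a set" where "keys \<equiv> Poly_Mapping.keys"
abbreviation single :: "'a \<Rightarrow> 'b \<Rightarrow> ('a \<Rightarrow>\<^sub>0 'b::zero)" where "single \<equiv> Poly_Mapping.single"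

lemma comm_ring_homI:
  fixes h :: "'a::comm_ring_1 \<Rightarrow> 'b::comm_ring_1"
  assumes "h 1 = 1" "\<And>a b. h (a + b) = h a + h b" "\<And>a b. h (a * b) = h a * h b"
  shows "comm_ring_hom h"
proof -
  have "h 0 = 0" using assms(2)[of 0 0] by simp
  then show ?thesis using assms by unfold_locales auto
qed

lemma comm_ring_hom_id: "comm_ring_hom (\<lambda>c::'a::comm_ring_1. c)"
  by (rule comm_ring_homI) auto

lemma comm_ring_hom_comp:
  assumes "comm_ring_hom g" "comm_ring_hom h" shows "comm_ring_hom (\<lambda>c. g (h c))"
proof -
  interpret g: comm_ring_hom g by fact
  interpret h: comm_ring_hom h by fact
  show ?thesis by (rule comm_ring_homI) (auto simp: g.hom_add h.hom_add g.hom_mult h.hom_mult)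
qed

section \<open>Polynomials and evaluation\<close>

lemma mpoly_eq_sum_single:
  "p = (\<Sum>m\<in>keys p. single m (lookup p m))" for p :: "'a \<Rightarrow>\<^sub>0 'b::comm_monoid_add"
proof (rule poly_mapping_eqI)
  fix k
  have "lookup (\<Sum>m\<in>keys p. single m (lookup p m)) k = (\<Sum>m\<in>keys p. if m = k then lookup p m else 0)"
    by (simp add: lookup_sum lookup_single when_def)
  also have "\<dots> = lookup p k" by (simp add: in_keys_iff)
  finally show "lookup p k = lookup (\<Sum>m\<in>keys p. single m (lookup p m)) k" ..
qed

lemma mpoly_induct [case_names single add]:
  fixes p :: "'a \<Rightarrow>\<^sub>0 'b::comm_monoid_add"
  assumes "\<And>m c. P (single m c)" and "\<And>p q. P p \<Longrightarrow> P q \<Longrightarrow> P (p + q)"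
  shows "P p"
proof -
  have "P (\<Sum>m\<in>A. single m (lookup p m))" if "finite A" for A
    using that
  proof (induction A rule: finite_induct)
    case empty
    show ?case using assms(1)[of undefined 0] by simp
  next
    case (insert x F)
    then show ?case using assms by simp
  qed
  from this[of "keys p"] show ?thesis using mpoly_eq_sum_single[of p] by simp
qed

definition mon_eval :: "('v \<Rightarrow> 'b::comm_semiring_1) \<Rightarrow> ('v \<Rightarrow>\<^sub>0 nat) \<Rightarrow> 'b" where
  "mon_eval x m = (\<Prod>v\<in>keys m. x v ^ lookup m v)"

lemma mon_eval_superset:
  assumes "finite A" "keys m \<subseteq> A"
  shows "mon_eval x m = (\<Prod>v\<in>A. x v ^ lookup m v)"
  unfolding mon_eval_def
  by (rule prod.mono_neutral_left) (use assms in \<open>auto simp: in_keys_iff\<close>)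

lemma mon_eval_0 [simp]: "mon_eval x 0 = 1"
  by (simp add: mon_eval_def)

lemma mon_eval_add: "mon_eval x (m + n) = mon_eval x m * mon_eval x n"
proof -
  let ?A = "keys m \<union> keys n"
  have "mon_eval x (m + n) = (\<Prod>v\<in>?A. x v ^ lookup (m + n) v)"
    by (rule mon_eval_superset) (auto simp: keys_add)
  also have "\<dots> = (\<Prod>v\<in>?A. x v ^ lookup m v) * (\<Prod>v\<in>?A. x v ^ lookup n v)"
    by (simp add: lookup_add power_add prod.distrib)
  also have "\<dots> = mon_eval x m * mon_eval x n"
    by (subst (1 2) mon_eval_superset[of ?A]) auto
  finally show ?thesis .
qed

lemma mon_eval_single [simp]: "mon_eval x (single v n) = x v ^ n"
  by (cases "n = 0") (auto simp: mon_eval_def)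

lemma (in comm_ring_hom) hom_mon_eval: "hom (mon_eval x m) = mon_eval (\<lambda>v. hom (x v)) m"
  by (simp add: mon_eval_def hom_prod hom_power)

lemma exponent_induct [case_names zero Suc]:
  fixes m :: "'v \<Rightarrow>\<^sub>0 nat"
  assumes "P 0" and "\<And>m v. P m \<Longrightarrow> P (m + single v 1)"
  shows "P m"
proof (induction "\<Sum>v\<in>keys m. lookup m v" arbitrary: m)
  case 0
  then have "\<forall>v. lookup m v = 0" by (auto simp: in_keys_iff)
  then have "m = 0" by (intro poly_mapping_eqI) auto
  then show ?case using assms by simp
next
  case (Suc k)
  then have "keys m \<noteq> {}" by auto
  then obtain v where v: "v \<in> keys m" by blast
  define n where "n = m - single v 1"
  have m: "m = n + single v 1"
    by (rule poly_mapping_eqI)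
      (use v in \<open>auto simp: n_def lookup_add lookup_minus lookup_single in_keys_iff when_def\<close>)
  have mw: "lookup m w = lookup n w + lookup (single v 1) w" for w
    using m by (metis lookup_add)
  have "(\<Sum>w\<in>keys m. lookup m w) = (\<Sum>w\<in>keys m. lookup n w) + (\<Sum>w\<in>keys m. lookup (single v 1) w)"
    by (simp only: mw sum.distrib)
  also have "(\<Sum>w\<in>keys m. lookup (single v (1::nat)) w) = 1"
    using v by (simp add: lookup_single when_def)
  also have "(\<Sum>w\<in>keys m. lookup n w) = (\<Sum>w\<in>keys n. lookup n w)"
    by (rule sum.mono_neutral_right) (auto simp: m lookup_add in_keys_iff)
  finally have "(\<Sum>w\<in>keys n. lookup n w) = k" using Suc by simp
  then have "P n" using Suc by blast
  then show ?case using m assms by simp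
qed

lemma eval_hom_superset:
  assumes "finite A" "keys p \<subseteq> A" "h 0 = 0"
  shows "eval_hom h x p = (\<Sum>m\<in>A. h (lookup p m) * mon_eval x m)"
  unfolding eval_hom_def mon_eval_def
  by (rule sum.mono_neutral_left) (use assms in \<open>auto simp: in_keys_iff\<close>)

lemma eval_hom_single: "h 0 = 0 \<Longrightarrow> eval_hom h x (single m c) = h c * mon_eval x m"
  by (subst eval_hom_superset[of "{m}"]) (auto simp: lookup_single)

lemma single_eq_Const_mult: "single m c = Const c * mon_eval Var m"
  for c :: "'a::comm_ring_1"
proof -
  have "mon_eval Var m = single m (1::'a)"
  proof (induction m rule: exponent_induct)
    case (Suc m v)
    then show ?case by (simp add: mon_eval_add Var_def mult_single)
  qed simp
  then show ?thesis by (simp add: Const_def mult_single)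
qed

context comm_ring_hom
begin

lemma eval_hom_0 [simp]: "eval_hom hom x 0 = 0"
  by (simp add: eval_hom_def)

lemma eval_hom_add: "eval_hom hom x (p + q) = eval_hom hom x p + eval_hom hom x q"
proof -
  let ?A = "keys p \<union> keys q"
  have "keys (p + q) \<subseteq> ?A" by (rule keys_add)
  then show ?thesis
    by (subst (1 2 3) eval_hom_superset[of ?A])
      (auto simp: lookup_add hom_add sum.distrib algebra_simps)
qed

lemma eval_hom_mult: "eval_hom hom x (p * q) = eval_hom hom x p * eval_hom hom x q"
proof (induction p rule: mpoly_induct)
  case (single m c)
  show ?case
  proof (induction q rule: mpoly_induct)
    case (single n d)
    then show ?case
      by (simp add: mult_single eval_hom_single hom_mult mon_eval_add algebra_simps)
  qed (simp add: eval_hom_add algebra_simps)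
qed (simp add: eval_hom_add algebra_simps)

lemma eval_hom_Const [simp]: "eval_hom hom x (Const c) = hom c"
  by (simp add: Const_def eval_hom_single)

lemma eval_hom_Var [simp]: "eval_hom hom x (Var v) = x v"
  by (simp add: Var_def eval_hom_single)

lemma eval_hom_comm_ring_hom: "comm_ring_hom (eval_hom hom x)"
proof (rule comm_ring_homI)
  show "eval_hom hom x 1 = 1" using eval_hom_Const[of x 1] by (simp add: Const_def)
qed (simp_all add: eval_hom_add eval_hom_mult)

end

lemma Const_hom: "comm_ring_hom (Const :: 'a::comm_ring_1 \<Rightarrow> ('v, 'a) mpoly)"
  by (rule comm_ring_homI) (simp_all add: Const_def single_add mult_single)

global_interpretation Const: comm_ring_hom Const
  by (rule Const_hom)

lemma Const_eq_0_iff [simp]: "Const c = 0 \<longleftrightarrow> c = 0"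
  by (metis Const_def lookup_single_eq single_zero)

lemma mpoly_hom_eqI:
  fixes g h :: "('v, 'a::comm_ring_1) mpoly \<Rightarrow> 'b::comm_ring_1"
  assumes "comm_ring_hom g" "comm_ring_hom h"
    and "\<And>c. g (Const c) = h (Const c)" "\<And>v. g (Var v) = h (Var v)"
  shows "g p = h p"
proof -
  interpret g: comm_ring_hom g by fact
  interpret h: comm_ring_hom h by fact
  show ?thesis
  proof (induction p rule: mpoly_induct)
    case (single m c)
    then show ?case
      by (simp add: single_eq_Const_mult g.hom_mult h.hom_mult g.hom_mon_eval h.hom_mon_eval assms)
  qed (simp add: g.hom_add h.hom_add)
qed

lemma eval_hom_Const_Var [simp]: "eval_hom Const Var p = p" for p :: "('v, 'a::comm_ring_1) mpoly"
  by (rule mpoly_hom_eqI[of "eval_hom Const Var" "\<lambda>p. p"])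
    (simp_all add: Const.eval_hom_comm_ring_hom comm_ring_hom_id)

lemma hom_eval_hom:
  assumes "comm_ring_hom g" "comm_ring_hom h"
  shows "g (eval_hom h x p) = eval_hom (\<lambda>c. g (h c)) (\<lambda>v. g (x v)) p"
proof -
  interpret g: comm_ring_hom g by fact
  interpret h: comm_ring_hom h by fact
  interpret gh: comm_ring_hom "\<lambda>c. g (h c)" by (rule comm_ring_hom_comp) fact+
  show ?thesis
    by (rule mpoly_hom_eqI)
      (auto intro: comm_ring_hom_comp[OF assms(1)] h.eval_hom_comm_ring_hom gh.eval_hom_comm_ring_hom)
qed

lemma lookup_single_mult:
  fixes p :: "('v, 'a::comm_ring_1) mpoly"
  shows "lookup (single m c * p) (m + n) = c * lookup p n"
proof (induction p rule: mpoly_induct)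
  case (single k d)
  show ?case by (simp add: mult_single lookup_single when_def)
qed (simp add: distrib_left lookup_add)

lemma lookup_single_mult_outside:
  fixes p :: "('v, 'a::comm_ring_1) mpoly"
  assumes "\<And>n. k \<noteq> m + n"
  shows "lookup (single m c * p) k = 0"
proof (induction p rule: mpoly_induct)
  case (single n d)
  show ?case using assms[of n] by (auto simp: mult_single lookup_single when_def)
qed (simp add: distrib_left lookup_add)

lemma lookup_Const_mult [simp]: "lookup (Const c * p) m = c * lookup p m"
  for p :: "('v, 'a::comm_ring_1) mpoly"
  using lookup_single_mult[of 0 c p m] by (simp add: Const_def)

lemma Var_power: "Var v ^ n = single (single v n) (1::'a::comm_ring_1)"
proof (induction n)
  case (Suc n)
  have "single v (Suc n) = single v 1 + single v n" by (metis plus_1_eq_Suc single_add)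
  then show ?case using Suc by (simp add: Var_def mult_single)
qed simp

lemma mpoly_cases_exponent:
  fixes m :: "'v \<Rightarrow>\<^sub>0 nat"
  assumes "n \<le> lookup m v" obtains k where "m = single v n + k"
proof
  show "m = single v n + (m - single v n)"
    by (rule poly_mapping_eqI) (use assms in \<open>auto simp: lookup_add lookup_minus lookup_single when_def\<close>)
qed

lemma lookup_Var_power_mult:
  "lookup (Var v ^ n * p) m = (if n \<le> lookup m v then lookup p (m - single v n) else 0)"
  for p :: "('v, 'a::comm_ring_1) mpoly"
proof (cases "n \<le> lookup m v")
  case True
  then obtain k where k: "m = single v n + k" by (rule mpoly_cases_exponent)
  then show ?thesis using True by (simp add: Var_power lookup_single_mult)
next
  case False
  then show ?thesis
    by (auto simp: Var_power lookup_add lookup_single intro!: lookup_single_mult_outside)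
qed

lemma lookup_Var_mult:
  "lookup (Var v * p) m = (if 0 < lookup m v then lookup p (m - single v 1) else 0)"
  for p :: "('v, 'a::comm_ring_1) mpoly"
  using lookup_Var_power_mult[of v 1 p m] by (simp add: Suc_le_eq)

definition restrict_keys :: "'m set \<Rightarrow> ('m \<Rightarrow>\<^sub>0 'a) \<Rightarrow> ('m \<Rightarrow>\<^sub>0 'a::comm_monoid_add)" where
  "restrict_keys A p = (\<Sum>m\<in>keys p \<inter> A. single m (lookup p m))"

lemma lookup_restrict_keys [simp]: "lookup (restrict_keys A p) m = (if m \<in> A then lookup p m else 0)"
  by (simp add: restrict_keys_def lookup_sum lookup_single when_def in_keys_iff)

lemma Var_power_dvd_iff:
  fixes p :: "('v, 'a::comm_ring_1) mpoly"
  shows "Var v ^ n dvd p \<longleftrightarrow> (\<forall>m. lookup m v < n \<longrightarrow> lookup p m = 0)"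
proof
  assume "Var v ^ n dvd p"
  then show "\<forall>m. lookup m v < n \<longrightarrow> lookup p m = 0"
    by (auto elim!: dvdE simp: lookup_Var_power_mult)
next
  assume p: "\<forall>m. lookup m v < n \<longrightarrow> lookup p m = 0"
  have "Var v ^ n dvd (\<Sum>m\<in>keys p. single m (lookup p m))"
  proof (rule dvd_sum)
    fix m assume "m \<in> keys p"
    then have "n \<le> lookup m v" using p by (meson in_keys_iff not_le)
    then obtain k where "m = single v n + k" by (rule mpoly_cases_exponent)
    then have "single m (lookup p m) = Var v ^ n * single k (lookup p m)"
      by (simp add: Var_power mult_single)
    then show "Var v ^ n dvd single m (lookup p m)" by simp
  qed
  then show "Var v ^ n dvd p" using mpoly_eq_sum_single[of p] by simp
qed

lemma mpoly_from_coeffs: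
  fixes c :: "'m \<Rightarrow> 'a::comm_monoid_add"
  assumes "finite {m. c m \<noteq> 0}" obtains p :: "'m \<Rightarrow>\<^sub>0 'a" where "\<And>m. lookup p m = c m"
  using assms by (metis Abs_poly_mapping_inverse mem_Collect_eq)

lemma Const_dvd_iff:
  fixes p :: "('v, 'a::comm_ring_1) mpoly"
  shows "Const c dvd p \<longleftrightarrow> (\<forall>m. c dvd lookup p m)"
proof
  assume "\<forall>m. c dvd lookup p m"
  then have "\<forall>m. Const c dvd single m (lookup p m)"
    by (metis dvd_def lookup_Const_mult Const_def mult_single add_0)
  then have "Const c dvd (\<Sum>m\<in>keys p. single m (lookup p m))"
    by (intro dvd_sum) blast
  then show "Const c dvd p" using mpoly_eq_sum_single[of p] by simp
qed (auto elim!: dvdE)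

lemma eval_id_hom: "comm_ring_hom (eval_hom (\<lambda>c::'a::comm_ring_1. c) x)"
  by (rule comm_ring_hom.eval_hom_comm_ring_hom[OF comm_ring_hom_id])

lemma eval_id_Const [simp]: "eval_hom (\<lambda>c::'a::comm_ring_1. c) x (Const c) = c"
  by (rule comm_ring_hom.eval_hom_Const[OF comm_ring_hom_id])

lemma eval_id_Var [simp]: "eval_hom (\<lambda>c::'a::comm_ring_1. c) x (Var v) = x v"
  by (rule comm_ring_hom.eval_hom_Var[OF comm_ring_hom_id])

lemma mdeg_superset: "finite A \<Longrightarrow> keys m \<subseteq> A \<Longrightarrow> mdeg m = (\<Sum>v\<in>A. lookup m v)"
  unfolding mdeg_def by (rule sum.mono_neutral_left) (auto simp: in_keys_iff)

lemma mdeg_add: "mdeg (m + n) = mdeg m + mdeg n"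
proof -
  let ?A = "keys m \<union> keys n"
  have "keys (m + n) \<subseteq> ?A" by (rule keys_add)
  then show ?thesis
    by (subst (1 2 3) mdeg_superset[of ?A]) (auto simp: lookup_add sum.distrib)
qed

lemma mdeg_single [simp]: "mdeg (single v k) = k"
  by (cases "k = 0") (auto simp: mdeg_def)

lemma mdeg_0 [simp]: "mdeg 0 = 0"
  by (simp add: mdeg_def)

lemma mdeg_UNIV: "mdeg m = (\<Sum>v\<in>UNIV. lookup m v)" for m :: "'v::finite \<Rightarrow>\<^sub>0 nat"
  by (rule mdeg_superset) auto

section \<open>Koszul relations of powers of the variables\<close>

lemma Var_power_mult_eq_0: "Var v ^ n * p = 0 \<Longrightarrow> p = 0"
  for p :: "('v, 'a::comm_ring_1) mpoly"
proof (rule poly_mapping_eqI)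
  fix m assume "Var v ^ n * p = 0"
  then have "lookup (Var v ^ n * p) (single v n + m) = 0" by simp
  then show "lookup p m = lookup 0 m" by (simp add: lookup_Var_power_mult lookup_add)
qed

lemma Var_power_dvd_Var_power_mult:
  fixes p :: "('v, 'a::comm_ring_1) mpoly"
  assumes "u \<noteq> v" "Var v ^ n dvd Var u ^ k * p" shows "Var v ^ n dvd p"
  unfolding Var_power_dvd_iff
proof (intro allI impI)
  fix m assume m: "lookup m v < n"
  have "lookup (Var u ^ k * p) (single u k + m) = 0"
    using assms m by (auto simp: Var_power_dvd_iff lookup_add lookup_single)
  then show "lookup p m = 0" by (simp add: lookup_Var_power_mult lookup_add)
qed

text \<open>
  Each monomial of such a polynomial is divisible by the power of \<open>u\<close> or by that of \<open>v\<close>.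
\<close>

lemma in_ideal_two_Var_powers:
  fixes p :: "('v, 'a::comm_ring_1) mpoly"
  assumes "\<And>m. lookup m u < n \<Longrightarrow> lookup m v < n \<Longrightarrow> lookup p m = 0"
  obtains a b where "p = Var u ^ n * a + Var v ^ n * b"
proof -
  define A where "A = {m. n \<le> lookup m u}"
  have "Var u ^ n dvd restrict_keys A p" "Var v ^ n dvd restrict_keys (- A) p"
    using assms by (auto simp: Var_power_dvd_iff A_def)
  moreover have "p = restrict_keys A p + restrict_keys (- A) p"
    by (rule poly_mapping_eqI) (simp add: lookup_add)
  ultimately show thesis using that by (metis dvdE)
qed

text \<open>
  The powers \<open>x\<^sub>1\<^sup>n, x\<^sub>2\<^sup>n, x\<^sub>3\<^sup>n\<close> form a regular sequence over any ring of coefficients, so their Koszul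
  complex is exact: a syzygy is a cross product.  It is used with \<open>n = 1\<close> for the variables \<open>T\<^sub>i\<close>
  and with large \<open>n\<close> for \<open>x, y, z\<close>.
\<close>

lemma Koszul_Var_powers:
  fixes p1 p2 p3 :: "(3, 'a::comm_ring_1) mpoly"
  assumes eq: "p1 * Var 1 ^ n + p2 * Var 2 ^ n + p3 * Var 3 ^ n = 0"
  obtains h1 h2 h3 where "p1 = h2 * Var 3 ^ n - h3 * Var 2 ^ n"
    "p2 = h3 * Var 1 ^ n - h1 * Var 3 ^ n" "p3 = h1 * Var 2 ^ n - h2 * Var 1 ^ n"
proof -
  (* Compare coefficients at the monomial x_3^n m: the other two terms contribute nothing there. *)
  have "lookup p3 m = 0" if m: "lookup m 1 < n" "lookup m 2 < n" for m
  proof -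
    have "lookup (Var 1 ^ n * p1 + Var 2 ^ n * p2 + Var 3 ^ n * p3) (single 3 n + m) = 0"
      using eq by (simp add: mult.commute)
    then show ?thesis using m
      by (simp add: lookup_add lookup_Var_power_mult lookup_single)
  qed
  then obtain a c where p3: "p3 = Var 1 ^ n * a + Var 2 ^ n * c"
    by (rule in_ideal_two_Var_powers)
  have eq2: "Var 1 ^ n * (p1 + a * Var 3 ^ n) = Var 2 ^ n * - (p2 + c * Var 3 ^ n)"
    using eq unfolding p3 by (simp add: algebra_simps eq_neg_iff_add_eq_0)
  have "Var 2 ^ n dvd Var 1 ^ n * (p1 + a * Var 3 ^ n)"
    unfolding eq2 by (rule dvd_triv_left)
  then have "Var 2 ^ n dvd p1 + a * Var 3 ^ n"
    by (rule Var_power_dvd_Var_power_mult[rotated]) simp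
  then obtain e where e: "p1 + a * Var 3 ^ n = Var 2 ^ n * e" by (elim dvdE)
  have "Var 2 ^ n * (p2 + c * Var 3 ^ n + Var 1 ^ n * e) = 0"
    using eq2 unfolding e by (simp add: algebra_simps)
  then have e2: "p2 + c * Var 3 ^ n + Var 1 ^ n * e = 0" by (rule Var_power_mult_eq_0)
  show thesis
  proof (rule that[of "- a" "- e" c])
    show "p1 = - a * Var 3 ^ n - - e * Var 2 ^ n" using e by (simp add: algebra_simps)
    show "p2 = - e * Var 1 ^ n - c * Var 3 ^ n"
      using e2 by (simp add: algebra_simps eq_neg_iff_add_eq_0)
    show "p3 = c * Var 2 ^ n - - a * Var 1 ^ n" using p3 by (simp add: algebra_simps)
  qed
qed

section \<open>Linear relations of a triple without common divisor\<close>

text \<open>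
  These are the elements of the ideal generated by the linear forms of the syzygies of \<open>f\<close>: the
  condition on \<open>G\<close> may be read coefficientwise in the variables of the polynomial ring.
\<close>

definition linear_relations :: "('v::finite \<Rightarrow> 's::comm_ring_1) \<Rightarrow> ('v, 's) mpoly set" where
  "linear_relations f = {\<Sum>i\<in>UNIV. G i * Var i | G. (\<Sum>i\<in>UNIV. G i * Const (f i)) = 0}"

text \<open>
  In a factorial ring this says that the greatest common divisor is 1; in general it is the form in
  which the condition of grade at least two is applied below.  The case \<open>e = 0\<close> says that \<open>f\<close> does
  not vanish identically.
\<close>

definition no_common_divisor :: "('v \<Rightarrow> 's::comm_ring_1) \<Rightarrow> bool" where
  "no_common_divisor f \<longleftrightarrow> (\<forall>e s. (\<forall>i. e dvd s * f i) \<longrightarrow> e dvd s)"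

definition ring_ideal :: "'a::comm_ring_1 set \<Rightarrow> bool" where
  "ring_ideal I \<longleftrightarrow> 0 \<in> I \<and> (\<forall>a\<in>I. \<forall>b\<in>I. a + b \<in> I) \<and> (\<forall>a\<in>I. \<forall>r. r * a \<in> I)"

lemma ring_idealD:
  assumes "ring_ideal I"
  shows "0 \<in> I" "a \<in> I \<Longrightarrow> b \<in> I \<Longrightarrow> a + b \<in> I" "a \<in> I \<Longrightarrow> r * a \<in> I" "a \<in> I \<Longrightarrow> a * r \<in> I"
    "a \<in> I \<Longrightarrow> b \<in> I \<Longrightarrow> a - b \<in> I" "a \<in> I \<Longrightarrow> - a \<in> I"
proof -
  show 1: "0 \<in> I" "a \<in> I \<Longrightarrow> b \<in> I \<Longrightarrow> a + b \<in> I" "a \<in> I \<Longrightarrow> r * a \<in> I" for a b r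
    using assms by (auto simp: ring_ideal_def)
  show "a \<in> I \<Longrightarrow> a * r \<in> I" using 1(3)[of a r] by (simp add: mult.commute)
  show m: "a \<in> I \<Longrightarrow> - a \<in> I" for a using 1(3)[of a "-1"] by simp
  show "a \<in> I \<Longrightarrow> b \<in> I \<Longrightarrow> a - b \<in> I" using 1(2)[of a "-b"] m[of b] by simp
qed

lemma ring_ideal_sum:
  assumes "ring_ideal I" "\<And>i. i \<in> A \<Longrightarrow> g i \<in> I" shows "sum g A \<in> I"
  using assms(2) by (induction A rule: infinite_finite_induct) (auto intro: ring_idealD[OF assms(1)])

lemma ring_ideal_mod_trans:
  assumes "ring_ideal I" "a - b \<in> I" "b - c \<in> I" shows "a - c \<in> I"
  using ring_idealD(2)[OF assms] by simp

lemma ring_ideal_linear_relations: "ring_ideal (linear_relations f)"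
  unfolding ring_ideal_def
proof (intro conjI ballI allI)
  show "0 \<in> linear_relations f"
    unfolding linear_relations_def by (auto intro!: exI[of _ "\<lambda>_. 0"])
next
  fix a b assume "a \<in> linear_relations f" "b \<in> linear_relations f"
  then obtain G H where "a = (\<Sum>i\<in>UNIV. G i * Var i)" "b = (\<Sum>i\<in>UNIV. H i * Var i)"
    "(\<Sum>i\<in>UNIV. G i * Const (f i)) = 0" "(\<Sum>i\<in>UNIV. H i * Const (f i)) = 0"
    unfolding linear_relations_def by blast
  then show "a + b \<in> linear_relations f"
    unfolding linear_relations_def
    by (auto intro!: exI[of _ "\<lambda>i. G i + H i"] simp: algebra_simps sum.distrib)
next
  fix a r assume "a \<in> linear_relations f"
  then obtain G where "a = (\<Sum>i\<in>UNIV. G i * Var i)" "(\<Sum>i\<in>UNIV. G i * Const (f i)) = 0"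
    unfolding linear_relations_def by blast
  then show "r * a \<in> linear_relations f"
    unfolding linear_relations_def
    by (auto intro!: exI[of _ "\<lambda>i. r * G i"] simp: mult.assoc simp flip: sum_distrib_left)
qed

lemmas linear_relations_closed = ring_idealD[OF ring_ideal_linear_relations]

lemma syzygy_linear_relation:
  assumes "(\<Sum>i\<in>UNIV. g i * f i) = 0"
  shows "(\<Sum>i\<in>UNIV. Const (g i) * Var i) \<in> linear_relations f"
proof -
  have "(\<Sum>i\<in>UNIV. Const (g i) * Const (f i)) = Const (\<Sum>i\<in>UNIV. g i * f i)"
    by (simp add: Const.hom_sum Const.hom_mult)
  then show ?thesis using assms unfolding linear_relations_def
    by (auto intro!: exI[of _ "\<lambda>i. Const (g i)"])
qed

lemma Koszul_linear_relation:
  "Const (f j) * Var k - Const (f k) * Var j \<in> linear_relations f"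
proof (cases "j = k")
  case False
  let ?g = "\<lambda>i. if i = k then f j else if i = j then - f k else 0"
  have "(\<Sum>i\<in>UNIV. ?g i * f i) = (\<Sum>i\<in>{j, k}. ?g i * f i)"
    by (rule sum.mono_neutral_right) auto
  also have "\<dots> = 0" using False by simp
  finally have "(\<Sum>i\<in>UNIV. Const (?g i) * Var i) \<in> linear_relations f"
    by (rule syzygy_linear_relation)
  also have "(\<Sum>i\<in>UNIV. Const (?g i) * Var i) = (\<Sum>i\<in>{j, k}. Const (?g i) * Var i)"
    by (rule sum.mono_neutral_right) auto
  also have "\<dots> = Const (f j) * Var k - Const (f k) * Var j"
    using False by (simp add: Const.hom_uminus)
  finally show ?thesis .
qed (simp add: linear_relations_closed)

lemma eval_linear_relation:
  assumes "P \<in> linear_relations f" shows "eval_hom (\<lambda>c. c) f P = 0"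
proof -
  obtain G where G: "P = (\<Sum>i\<in>UNIV. G i * Var i)" "(\<Sum>i\<in>UNIV. G i * Const (f i)) = 0"
    using assms unfolding linear_relations_def by blast
  interpret ev: comm_ring_hom "eval_hom (\<lambda>c. c) f" by (rule eval_id_hom)
  have "eval_hom (\<lambda>c. c) f P = eval_hom (\<lambda>c. c) f (\<Sum>i\<in>UNIV. G i * Const (f i))"
    by (simp add: G(1) ev.hom_sum ev.hom_mult)
  then show ?thesis using G(2) by simp
qed

text \<open>
  The hypothesis makes each coefficient of \<open>h\<^sub>i\<close> a multiple of \<open>f\<^sub>i\<close> after multiplication by any
  \<open>f\<^sub>j\<close>, hence a multiple of \<open>f\<^sub>i\<close>.
\<close>

lemma parallel_to_coprime_vector:
  fixes f :: "3 \<Rightarrow> 's::idom" and h :: "3 \<Rightarrow> (3, 's) mpoly"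
  assumes "no_common_divisor f" and "\<And>i j. h i * Const (f j) = h j * Const (f i)"
  obtains q where "\<And>i. h i = q * Const (f i)"
proof -
  obtain i where i: "f i \<noteq> 0"
    using assms(1) unfolding no_common_divisor_def by (metis dvd_0_left_iff mult_zero_right one_neq_zero)
  have "f i dvd lookup (h i) m" for m
  proof -
    have "lookup (h i) m * f j = lookup (h j) m * f i" for j
    proof -
      have "lookup (Const (f j) * h i) m = lookup (Const (f i) * h j) m"
        using assms(2)[of i j] by (metis mult.commute)
      then show ?thesis by (metis lookup_Const_mult mult.commute)
    qed
    then show ?thesis using assms(1) unfolding no_common_divisor_def by (metis dvd_triv_right)
  qed
  then have "Const (f i) dvd h i" by (simp add: Const_dvd_iff)
  then obtain q where q: "h i = Const (f i) * q" by (elim dvdE)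
  have "h j = q * Const (f j)" for j
  proof -
    have "Const (f i) * h j = h i * Const (f j)" using assms(2)[of i j] by (metis mult.commute)
    also have "\<dots> = Const (f i) * (q * Const (f j))" unfolding q by (simp only: mult.assoc)
    finally have "Const (f i) * h j = Const (f i) * (q * Const (f j))" .
    then show ?thesis using i by (metis mult_cancel_left Const_eq_0_iff)
  qed
  then show thesis by (rule that)
qed

abbreviation trunc :: "nat \<Rightarrow> ('v, 'a::comm_ring_1) mpoly \<Rightarrow> ('v, 'a) mpoly" where
  "trunc n \<equiv> restrict_keys {m. mdeg m < n}"

lemma trunc_diff: "trunc n (p - q) = trunc n p - trunc n q"
  by (rule poly_mapping_eqI) (simp add: lookup_minus)

lemma trunc_Const_mult: "trunc n (Const c * p) = Const c * trunc n p"
  by (rule poly_mapping_eqI) simp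

lemma trunc_mult_Var: "trunc (Suc n) (p * Var v) = trunc n p * Var v"
proof (rule poly_mapping_eqI)
  fix m
  show "lookup (trunc (Suc n) (p * Var v)) m = lookup (trunc n p * Var v) m"
  proof (cases "0 < lookup m v")
    case True
    then obtain k where "m = single v 1 + k" using mpoly_cases_exponent[of 1 m v] by auto
    then show ?thesis by (simp add: mult.commute[of _ "Var v"] lookup_Var_mult mdeg_add lookup_add)
  qed (simp add: mult.commute[of _ "Var v"] lookup_Var_mult)
qed

lemma exists_trunc_eq: "\<exists>n. trunc n p = p"
proof
  show "trunc (Suc (Max (mdeg ` keys p))) p = p"
  proof (rule poly_mapping_eqI)
    fix m
    have "mdeg m \<le> Max (mdeg ` keys p)" if "lookup p m \<noteq> 0"
      using that by (intro Max_ge) (auto simp: in_keys_iff)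
    then show "lookup (trunc (Suc (Max (mdeg ` keys p))) p) m = lookup p m"
      by (auto simp: less_Suc_eq_le)
  qed
qed

lemma trunc_mono: "trunc n p = p \<Longrightarrow> n \<le> k \<Longrightarrow> trunc k p = p"
  by (auto simp: poly_mapping_eq_iff fun_eq_iff) (metis less_le_trans)

text \<open>
  The cross product of the vectors \<open>(f\<^sub>1,f\<^sub>2,f\<^sub>3)\<close> and \<open>(T\<^sub>1,T\<^sub>2,T\<^sub>3)\<close>; the indices are cyclic because
  \<^typ>\<open>3\<close> is the ring of integers modulo 3.
\<close>

definition cross_Var :: "(3 \<Rightarrow> 's::comm_ring_1) \<Rightarrow> 3 \<Rightarrow> (3, 's) mpoly" where
  "cross_Var f i = Const (f (i + 1)) * Var (i + 2) - Const (f (i + 2)) * Var (i + 1)"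

lemma cross_Var_simps:
  "cross_Var f 1 = Const (f 2) * Var 3 - Const (f 3) * Var 2"
  "cross_Var f 2 = Const (f 3) * Var 1 - Const (f 1) * Var 3"
  "cross_Var f 3 = Const (f 1) * Var 2 - Const (f 2) * Var 1"
proof -
  have "(4::3) = 1" "(5::3) = 2" by simp_all
  then show "cross_Var f 1 = Const (f 2) * Var 3 - Const (f 3) * Var 2"
  "cross_Var f 2 = Const (f 3) * Var 1 - Const (f 1) * Var 3"
  "cross_Var f 3 = Const (f 1) * Var 2 - Const (f 2) * Var 1"
    by (simp_all add: cross_Var_def \<open>(4::3) = 1\<close> \<open>(5::3) = 2\<close>)
qed

text \<open>
  Since \<open>G\<close> is orthogonal to \<open>T\<close>, exactness of the Koszul complex gives \<open>G = h \<times> T\<close>, with \<open>h\<close> of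
  smaller degree.  The vector \<open>V = f \<times> h\<close> is again orthogonal to \<open>f\<close> and, because \<open>G\<close> is
  orthogonal to \<open>f\<close>, also to \<open>T\<close>; so by induction \<open>V = q (f \<times> T)\<close>.  Then \<open>f\<close> is parallel to
  \<open>h - q T\<close>, which may replace \<open>h\<close>.
\<close>

lemma orthogonal_to_both_trunc:
  fixes f :: "3 \<Rightarrow> 's::idom" and G :: "3 \<Rightarrow> (3, 's) mpoly"
  assumes f: "no_common_divisor f" and G: "\<And>i. trunc n (G i) = G i"
    "(\<Sum>i\<in>UNIV. G i * Const (f i)) = 0" "(\<Sum>i\<in>UNIV. G i * Var i) = 0"
  shows "\<exists>q. \<forall>i. G i = q * cross_Var f i"
  using G
proof (induction n arbitrary: G)
  case 0
  then have "G i = 0" for i by (metis (no_types, lifting) lookup_restrict_keys lookup_zero mem_Collect_eq not_less_zero poly_mapping_eqI)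
  then show ?case by (auto intro!: exI[of _ 0])
next
  case (Suc n)
  have "G 1 * Var 1 ^ 1 + G 2 * Var 2 ^ 1 + G 3 * Var 3 ^ 1 = 0"
    using Suc.prems(3) by (simp add: sum_3)
  then obtain k1 k2 k3 where k: "G 1 = k2 * Var 3 ^ 1 - k3 * Var 2 ^ 1"
    "G 2 = k3 * Var 1 ^ 1 - k1 * Var 3 ^ 1" "G 3 = k1 * Var 2 ^ 1 - k2 * Var 1 ^ 1"
    by (rule Koszul_Var_powers)
  define h1 h2 h3 where h_def: "h1 = trunc n k1" "h2 = trunc n k2" "h3 = trunc n k3"
  have tr: "trunc n h1 = h1" "trunc n h2 = h2" "trunc n h3 = h3"
    by (auto simp: h_def poly_mapping_eq_iff fun_eq_iff)
  have h: "G 1 = h2 * Var 3 - h3 * Var 2" "G 2 = h3 * Var 1 - h1 * Var 3" "G 3 = h1 * Var 2 - h2 * Var 1"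
    using k Suc.prems(1)[of 1] Suc.prems(1)[of 2] Suc.prems(1)[of 3]
    by (simp_all add: h_def trunc_diff trunc_mult_Var)
  define V where "V = (\<lambda>i::3. if i = 1 then Const (f 2) * h3 - Const (f 3) * h2
     else if i = 2 then Const (f 3) * h1 - Const (f 1) * h3 else Const (f 1) * h2 - Const (f 2) * h1)"
  have V: "V 1 = Const (f 2) * h3 - Const (f 3) * h2" "V 2 = Const (f 3) * h1 - Const (f 1) * h3"
     "V 3 = Const (f 1) * h2 - Const (f 2) * h1"
    by (simp_all add: V_def)
  have "trunc n (V i) = V i" for i by (simp add: V_def trunc_diff trunc_Const_mult tr)
  moreover have "(\<Sum>i\<in>UNIV. V i * Const (f i)) = 0"
    by (simp add: sum_3 V algebra_simps)
  moreover have "(\<Sum>i\<in>UNIV. V i * Var i) = 0"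
  proof -
    have "(\<Sum>i\<in>UNIV. V i * Var i) = (\<Sum>i\<in>UNIV. G i * Const (f i))"
      by (simp add: sum_3 V h algebra_simps)
    then show ?thesis using Suc.prems(2) by simp
  qed
  ultimately obtain q where "\<forall>i. V i = q * cross_Var f i" using Suc.IH by blast
  then have q: "V 1 = q * cross_Var f 1" "V 2 = q * cross_Var f 2" "V 3 = q * cross_Var f 3" by auto
  define h where "h = (\<lambda>i::3. (if i = 1 then h1 else if i = 2 then h2 else h3) - q * Var i)"
  have hh: "h1 = h 1 + q * Var 1" "h2 = h 2 + q * Var 2" "h3 = h 3 + q * Var 3"
    by (simp_all add: h_def)
  have p1: "h 2 * Const (f 1) = h 1 * Const (f 2)"
    using q(3) V(3) unfolding hh cross_Var_simps by (simp add: algebra_simps)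
  have p2: "h 3 * Const (f 2) = h 2 * Const (f 3)"
    using q(1) V(1) unfolding hh cross_Var_simps by (simp add: algebra_simps)
  have p3: "h 3 * Const (f 1) = h 1 * Const (f 3)"
    using q(2) V(2) unfolding hh cross_Var_simps by (simp add: algebra_simps)
  have "h i * Const (f j) = h j * Const (f i)" for i j
    using exhaust_3[of i] exhaust_3[of j] p1 p2 p3 by auto
  then obtain r where r: "\<And>i. h i = r * Const (f i)"
    using parallel_to_coprime_vector[OF f] by blast
  have "G 1 = r * cross_Var f 1" "G 2 = r * cross_Var f 2" "G 3 = r * cross_Var f 3"
    unfolding h hh r cross_Var_simps by (simp_all add: algebra_simps)
  then show ?case by (metis exhaust_3)
qed

lemma orthogonal_to_both:
  fixes f :: "3 \<Rightarrow> 's::idom" and G :: "3 \<Rightarrow> (3, 's) mpoly"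
  assumes "no_common_divisor f"
    "(\<Sum>i\<in>UNIV. G i * Const (f i)) = 0" "(\<Sum>i\<in>UNIV. G i * Var i) = 0"
  obtains q where "\<And>i. G i = q * cross_Var f i"
proof -
  have "\<forall>i. \<exists>d. trunc d (G i) = G i" using exists_trunc_eq by blast
  from choice[OF this] obtain d where d: "\<And>i. trunc (d i) (G i) = G i" by blast
  have "trunc (\<Sum>i\<in>UNIV. d i) (G i) = G i" for i
    by (rule trunc_mono[OF d], rule member_le_sum) auto
  then show thesis using orthogonal_to_both_trunc[OF assms(1) _ assms(2,3)] that by blast
qed

lemma coefficientwise_two_generators:
  fixes q :: "('v, 's::comm_ring_1) mpoly"
  assumes "\<And>m. \<exists>u v. lookup q m = u * a + v * b"
  obtains U V where "q = U * Const a + V * Const b"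
proof -
  obtain u v where uv: "\<And>m. lookup q m = a * u m + b * v m"
    using assms by (metis mult.commute)
  have fin: "finite {m. (if m \<in> keys q then w m else 0) \<noteq> 0}" for w :: "_ \<Rightarrow> 's"
    by (rule finite_subset[of _ "keys q"]) auto
  obtain U where U: "\<And>m. lookup U m = (if m \<in> keys q then u m else 0)"
    using mpoly_from_coeffs[OF fin[of u]] by blast
  obtain V where V: "\<And>m. lookup V m = (if m \<in> keys q then v m else 0)"
    using mpoly_from_coeffs[OF fin[of v]] by blast
  have "q = Const a * U + Const b * V"
    by (rule poly_mapping_eqI) (use uv in \<open>simp add: lookup_add U V in_keys_iff\<close>)
  then show thesis using that by (metis mult.commute)
qed

lemma cross_Var_nonzero:
  assumes "f j \<noteq> 0" shows "\<exists>i. cross_Var f i \<noteq> 0"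
proof -
  have [simp]: "single u (Suc 0) = single v (Suc 0) \<longleftrightarrow> u = v" for u v :: 3
    by (metis lookup_single_eq lookup_single_not_eq n_not_Suc_n)
  have "lookup (cross_Var f i) (single (i + 2) 1) = f (i + 1)" for i
    by (simp add: cross_Var_def lookup_minus Var_def lookup_single when_def)
  from this[of "j - 1"] show ?thesis using assms by (metis diff_add_cancel lookup_zero)
qed

text \<open>
  Write \<open>a\<^sub>v P = G\<^sub>v \<cdot> T\<close> with \<open>a\<^sub>v = x\<^sub>v\<^sup>n\<close> and \<open>G\<^sub>v\<close> orthogonal to \<open>f\<close>.  The differences
  \<open>a\<^sub>v G\<^sub>u - a\<^sub>u G\<^sub>v\<close> are orthogonal to both \<open>f\<close> and \<open>T\<close>, hence equal to \<open>q\<^sub>u\<^sub>v (f \<times> T)\<close>.  The \<open>q\<^sub>u\<^sub>v\<close>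
  satisfy a cocycle condition which, by the Koszul relations, puts \<open>q\<^sub>1\<^sub>2\<close> into the ideal
  \<open>(a\<^sub>1, a\<^sub>2)\<close>.  After subtracting a multiple of \<open>f \<times> T\<close> from \<open>G\<^sub>1\<close> one may therefore divide by \<open>a\<^sub>1\<close>.
\<close>

theorem linear_relations_irrelevant_torsion_free:
  fixes f :: "3 \<Rightarrow> (3, 'k::idom) mpoly"
  assumes f: "no_common_divisor f"
    and P: "\<And>v. Const (Var v ^ n) * P \<in> linear_relations f"
  shows "P \<in> linear_relations f"
proof -
  define a :: "3 \<Rightarrow> (3, (3, 'k) mpoly) mpoly" where "a v = Const (Var v ^ n)" for v
  have "\<forall>v. \<exists>G. a v * P = (\<Sum>i\<in>UNIV. G i * Var i) \<and> (\<Sum>i\<in>UNIV. G i * Const (f i)) = 0"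
    using P by (auto simp: linear_relations_def a_def)
  from choice[OF this] obtain G where G: "\<And>v. a v * P = (\<Sum>i\<in>UNIV. G v i * Var i)"
    "\<And>v. (\<Sum>i\<in>UNIV. G v i * Const (f i)) = 0" by blast
  have "\<exists>q. \<forall>i. a v * G u i - a u * G v i = q * cross_Var f i" for u v
  proof -
    define D where "D i = a v * G u i - a u * G v i" for i
    have "(\<Sum>i\<in>UNIV. (a v * G u i - a u * G v i) * Const (f i))
        = a v * (\<Sum>i\<in>UNIV. G u i * Const (f i)) - a u * (\<Sum>i\<in>UNIV. G v i * Const (f i))"
      by (simp add: sum_distrib_left sum_subtractf algebra_simps)
    moreover have "(\<Sum>i\<in>UNIV. (a v * G u i - a u * G v i) * Var i)
        = a v * (\<Sum>i\<in>UNIV. G u i * Var i) - a u * (\<Sum>i\<in>UNIV. G v i * Var i)"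
      by (simp add: sum_distrib_left sum_subtractf algebra_simps)
    ultimately have "(\<Sum>i\<in>UNIV. D i * Const (f i)) = 0" "(\<Sum>i\<in>UNIV. D i * Var i) = 0"
      by (simp_all add: D_def G(2) mult.left_commute flip: G(1))
    then obtain q where "\<And>i. D i = q * cross_Var f i" using orthogonal_to_both[OF f] by blast
    then show ?thesis unfolding D_def by blast
  qed
  then have "\<exists>q. \<forall>v i. a v * G u i - a u * G v i = q v * cross_Var f i" for u
    using choice[of "\<lambda>v q. \<forall>i. a v * G u i - a u * G v i = q * cross_Var f i"] by blast
  then have "\<forall>u. \<exists>q. \<forall>v i. a v * G u i - a u * G v i = q v * cross_Var f i" by blast
  from choice[OF this] obtain q where q: "\<And>u v i. a v * G u i - a u * G v i = q u v * cross_Var f i" by blast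
  obtain j where "f j \<noteq> 0"
    using f unfolding no_common_divisor_def by (metis dvd_0_left_iff mult_zero_right one_neq_zero)
  then obtain i where i: "cross_Var f i \<noteq> 0" using cross_Var_nonzero by blast
  have "(q 2 3 * a 1 + (- q 1 3) * a 2 + q 1 2 * a 3) * cross_Var f i
    = a 1 * (q 2 3 * cross_Var f i) - a 2 * (q 1 3 * cross_Var f i) + a 3 * (q 1 2 * cross_Var f i)"
    by (simp add: algebra_simps)
  also have "\<dots> = 0" unfolding q[symmetric] by (simp add: algebra_simps)
  finally have cocycle: "q 2 3 * a 1 + (- q 1 3) * a 2 + q 1 2 * a 3 = 0" using i by simp
  have "\<exists>u v. lookup (q 1 2) m = u * Var 2 ^ n + v * Var 1 ^ n" for m
  proof -
    have "lookup (a 1 * q 2 3 - a 2 * q 1 3 + a 3 * q 1 2) m = 0"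
      using cocycle by (simp add: algebra_simps)
    then have "Var 1 ^ n * lookup (q 2 3) m - Var 2 ^ n * lookup (q 1 3) m
        + Var 3 ^ n * lookup (q 1 2) m = 0"
      by (simp only: a_def lookup_add lookup_minus lookup_Const_mult)
    then have "lookup (q 2 3) m * Var 1 ^ n + (- lookup (q 1 3) m) * Var 2 ^ n
        + lookup (q 1 2) m * Var 3 ^ n = 0"
      by (simp add: algebra_simps)
    then obtain h1 h2 where "lookup (q 1 2) m = h1 * Var 2 ^ n - h2 * Var 1 ^ n"
      by (rule Koszul_Var_powers)
    then show ?thesis by (intro exI[of _ h1] exI[of _ "- h2"]) simp
  qed
  then obtain h1 h2 where h: "q 1 2 = h1 * a 2 + h2 * a 1"
    unfolding a_def by (rule coefficientwise_two_generators)
  have eq: "a 2 * (G 1 i - h1 * cross_Var f i) = a 1 * (G 2 i + h2 * cross_Var f i)" for i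
    using q[of 2 1 i] unfolding h by (simp add: algebra_simps)
  have "a 1 dvd G 1 i - h1 * cross_Var f i" for i
  proof -
    have "Var 1 ^ n dvd lookup (G 1 i - h1 * cross_Var f i) m" for m
    proof (rule Var_power_dvd_Var_power_mult[of 2])
      have "Var 2 ^ n * lookup (G 1 i - h1 * cross_Var f i) m
        = lookup (a 1 * (G 2 i + h2 * cross_Var f i)) m"
        unfolding eq[symmetric] by (simp add: a_def)
      then show "Var 1 ^ n dvd Var 2 ^ n * lookup (G 1 i - h1 * cross_Var f i) m"
        by (simp add: a_def)
    qed simp
    then show ?thesis by (simp add: a_def Const_dvd_iff)
  qed
  then have "\<forall>i. \<exists>k. G 1 i - h1 * cross_Var f i = a 1 * k" by (simp add: dvd_def)
  from choice[OF this] obtain K where K: "\<And>i. G 1 i - h1 * cross_Var f i = a 1 * K i" by blast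
  have K': "G 1 i = a 1 * K i + h1 * cross_Var f i" for i using K[of i] by (simp add: algebra_simps)
  have cf: "(\<Sum>i\<in>UNIV. cross_Var f i * Const (f i)) = 0"
    by (simp add: sum_3 cross_Var_simps algebra_simps)
  have cT: "(\<Sum>i\<in>UNIV. cross_Var f i * Var i) = 0"
    by (simp add: sum_3 cross_Var_simps algebra_simps)
  have a1: "a 1 \<noteq> 0"
  proof
    assume "a 1 = 0"
    then have "single (single (1::3) n) (1::'k) = 0" by (simp only: a_def Const_eq_0_iff Var_power)
    then show False by (metis lookup_single_eq lookup_zero zero_neq_one)
  qed
  have "a 1 * (\<Sum>i\<in>UNIV. K i * Const (f i)) = (\<Sum>i\<in>UNIV. G 1 i * Const (f i))
      - h1 * (\<Sum>i\<in>UNIV. cross_Var f i * Const (f i))"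
    by (simp add: K' sum_distrib_left algebra_simps sum.distrib)
  then have "(\<Sum>i\<in>UNIV. K i * Const (f i)) = 0" using G(2) cf a1 by simp
  moreover have "a 1 * (\<Sum>i\<in>UNIV. K i * Var i) = (\<Sum>i\<in>UNIV. G 1 i * Var i)
      - h1 * (\<Sum>i\<in>UNIV. cross_Var f i * Var i)"
    by (simp add: K' sum_distrib_left algebra_simps sum.distrib)
  then have "a 1 * P = a 1 * (\<Sum>i\<in>UNIV. K i * Var i)" using G(1)[of 1] cT by simp
  then have "P = (\<Sum>i\<in>UNIV. K i * Var i)" by (rule mult_left_cancel[OF a1, THEN iffD1])
  ultimately show ?thesis unfolding linear_relations_def by blast
qed

section \<open>Coordinates of syzygies\<close>

definition binary_form :: "(nat \<Rightarrow> 'a) \<Rightarrow> 'a \<Rightarrow> 'a \<Rightarrow> nat \<Rightarrow> 'a::comm_ring_1" where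
  "binary_form c x y n = (\<Sum>i\<le>n. c i * x ^ i * y ^ (n - i))"

lemma binary_form_add: "binary_form c x y n + binary_form d x y n = binary_form (\<lambda>i. c i + d i) x y n"
  by (simp add: binary_form_def algebra_simps sum.distrib)

lemma binary_form_scale: "r * binary_form c x y n = binary_form (\<lambda>i. r * c i) x y n"
  by (simp add: binary_form_def algebra_simps sum_distrib_left)

lemma binary_form_times_left:
  "x * binary_form c x y n = binary_form (\<lambda>i. if i = 0 then 0 else c (i - 1)) x y (Suc n)"
  unfolding binary_form_def
  by (subst sum.atMost_Suc_shift) (simp add: sum_distrib_left algebra_simps)

lemma binary_form_times_right:
  "y * binary_form c x y n = binary_form (\<lambda>i. if i = Suc n then 0 else c i) x y (Suc n)"
proof -
  have "y * (c i * x ^ i * y ^ (n - i)) = c i * x ^ i * y ^ (Suc n - i)" if "i \<le> n" for i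
    using that by (simp add: Suc_diff_le algebra_simps)
  then show ?thesis
    unfolding binary_form_def by (auto simp: sum_distrib_left intro!: sum.cong)
qed

lemma binary_form_Suc:
  "binary_form c x y (Suc n) = c 0 * y ^ Suc n + x * binary_form (\<lambda>i. c (Suc i)) x y n"
  unfolding binary_form_def
  by (subst sum.atMost_Suc_shift) (simp add: sum_distrib_left algebra_simps)

lemma binary_form_head: "binary_form (\<lambda>l. if l = 0 then w else 0) x y n = w * y ^ n"
proof -
  have "binary_form (\<lambda>l. if l = 0 then w else 0) x y n
    = (\<Sum>l\<in>{0}. (if l = 0 then w else 0) * x ^ l * y ^ (n - l))"
    unfolding binary_form_def by (rule sum.mono_neutral_right) auto
  then show ?thesis by simp
qed

lemma (in comm_ring_hom) hom_binary_form:
  "hom (binary_form c x y n) = binary_form (\<lambda>i. hom (c i)) (hom x) (hom y) n"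
  by (simp add: binary_form_def hom_sum hom_mult hom_power)

text \<open>
  Modulo the linear relations \<open>g\<^sub>i T\<^sub>i\<close> is a combination of \<open>T\<^sub>j\<close> and \<open>T\<^sub>k\<close>; multiplication by
  \<open>g\<^sub>i\<^sup>n\<close> provides one factor \<open>g\<^sub>i\<close> for each variable of a monomial of degree \<open>n\<close>.
\<close>

lemma reduce_to_binary_form:
  fixes f g :: "3 \<Rightarrow> 's::comm_ring_1"
  assumes g: "(\<Sum>i\<in>UNIV. g i * f i) = 0" and ijk: "i \<noteq> j" "i \<noteq> k" "j \<noteq> k"
    and P: "homogeneous n P"
  shows "\<exists>c. Const (g i ^ n) * P - binary_form (\<lambda>l. Const (c l)) (Var j) (Var k) n \<in> linear_relations f"
proof -
  let ?L = "linear_relations f" and ?b = "\<lambda>c n. binary_form (\<lambda>l. Const (c l)) (Var j) (Var k) n"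
  (* M n collects the polynomials that are congruent to a form of degree n in T_j and T_k. *)
  define M where "M n = {Q. \<exists>c. Q - ?b c n \<in> ?L}" for n
  have M_D: "\<exists>c. Q - ?b c n \<in> ?L" if "Q \<in> M n" for Q n
    using that by (simp add: M_def)
  have M_I: "Q \<in> M n" if "Q - ?b c n \<in> ?L" for Q n c
    using that unfolding M_def by (intro CollectI exI)
  have M_add: "Q + R \<in> M n" if QR: "Q \<in> M n" "R \<in> M n" for Q R n
  proof -
    from M_D[OF QR(1)] obtain c where c: "Q - ?b c n \<in> ?L" ..
    from M_D[OF QR(2)] obtain d where d: "R - ?b d n \<in> ?L" ..
    from linear_relations_closed(2)[OF c d]
    have "(Q + R) - binary_form (\<lambda>l. Const (c l + d l)) (Var j) (Var k) n \<in> ?L"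
      by (simp add: Const.hom_add flip: binary_form_add) (simp add: algebra_simps)
    then show ?thesis by (rule M_I)
  qed
  have M_scale: "Const r * Q \<in> M n" if "Q \<in> M n" for Q r n
  proof -
    from M_D[OF that] obtain c where "Q - ?b c n \<in> ?L" ..
    from linear_relations_closed(3)[OF this, of "Const r"]
    have "Const r * Q - binary_form (\<lambda>l. Const (r * c l)) (Var j) (Var k) n \<in> ?L"
      by (simp add: Const.hom_mult right_diff_distrib flip: binary_form_scale)
    then show ?thesis by (rule M_I)
  qed
  have M_j: "Var j * Q \<in> M (Suc n)" if "Q \<in> M n" for Q n
  proof -
    from M_D[OF that] obtain c where "Q - ?b c n \<in> ?L" ..
    from linear_relations_closed(3)[OF this, of "Var j"]
    have "Var j * Q - binary_form (\<lambda>l. Const (if l = 0 then 0 else c (l - 1))) (Var j) (Var k) (Suc n) \<in> ?L"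
      by (simp add: right_diff_distrib binary_form_times_left if_distrib[of Const] cong: if_cong)
    then show ?thesis by (rule M_I)
  qed
  have M_k: "Var k * Q \<in> M (Suc n)" if "Q \<in> M n" for Q n
  proof -
    from M_D[OF that] obtain c where "Q - ?b c n \<in> ?L" ..
    from linear_relations_closed(3)[OF this, of "Var k"]
    have "Var k * Q - binary_form (\<lambda>l. Const (if l = Suc n then 0 else c l)) (Var j) (Var k) (Suc n) \<in> ?L"
      by (simp add: right_diff_distrib binary_form_times_right if_distrib[of Const] cong: if_cong)
    then show ?thesis by (rule M_I)
  qed
  have M_cong: "Q \<in> M n" if "Q - R \<in> ?L" "R \<in> M n" for Q R n
    using that ring_ideal_mod_trans[OF ring_ideal_linear_relations] unfolding M_def by blast
  have UNIV: "(UNIV :: 3 set) = {i, j, k}"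
    using exhaust_3[of i] exhaust_3[of j] exhaust_3[of k] ijk by (auto simp: UNIV_3)
  have rel: "Const (g i) * Var i + (Const (g j) * Var j + Const (g k) * Var k) \<in> ?L"
    using syzygy_linear_relation[OF g] unfolding UNIV using ijk by simp
  have M_Var: "Const (g i) * Var v * Q \<in> M (Suc n)" if Q: "Q \<in> M n" for v Q n
  proof -
    have jk: "Const r * (Var j * Q) \<in> M (Suc n)" "Const r * (Var k * Q) \<in> M (Suc n)" for r
      using M_scale M_j M_k Q by blast+
    have "v \<in> {i, j, k}" using UNIV by blast
    then consider "v = i" | "v = j" | "v = k" by blast
    then show ?thesis
    proof cases
      case 1
      have "Const (g i) * Var i * Q - (Const (- g j) * (Var j * Q) + Const (- g k) * (Var k * Q)) \<in> ?L"
        using linear_relations_closed(4)[OF rel, of Q] by (simp add: Const.hom_uminus algebra_simps)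
      then show ?thesis using 1 M_cong M_add jk by blast
    qed (use jk in \<open>simp_all add: mult.assoc\<close>)
  qed
  have mon: "Const (g i ^ mdeg m) * mon_eval Var m \<in> M (mdeg m)" for m
  proof (induction m rule: exponent_induct)
    case zero
    show ?case by (auto simp: M_def binary_form_def linear_relations_closed intro!: exI[of _ "\<lambda>_. 1"])
  next
    case (Suc m v)
    from M_Var[OF Suc, of v] show ?case
      by (simp add: mdeg_add mon_eval_add Const.hom_mult algebra_simps)
  qed
  have "0 \<in> M n"
    by (auto simp: M_def binary_form_def linear_relations_closed intro!: exI[of _ "\<lambda>_. 0"])
  then have sum_M: "sum h A \<in> M n" if "\<And>m. m \<in> A \<Longrightarrow> h m \<in> M n" for h and A :: "(3 \<Rightarrow>\<^sub>0 nat) set"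
    using that by (induction A rule: infinite_finite_induct) (auto intro: M_add)
  have "Const (g i ^ n) * single m (lookup P m) \<in> M n" if "m \<in> keys P" for m
  proof -
    have "mdeg m = n" using P that by (simp add: homogeneous_def)
    from M_scale[OF mon[of m], of "lookup P m"] this show ?thesis
      by (simp add: single_eq_Const_mult[of m "lookup P m"] mult_ac)
  qed
  then have "(\<Sum>m\<in>keys P. Const (g i ^ n) * single m (lookup P m)) \<in> M n" by (rule sum_M)
  then have "Const (g i ^ n) * P \<in> M n"
    using mpoly_eq_sum_single[of P] by (simp flip: sum_distrib_left)
  then show ?thesis by (auto simp: M_def)
qed

text \<open>
  Up to powers of \<open>g\<^sub>i\<close> the elements \<open>f\<^sub>j, f\<^sub>k\<close> form a regular sequence: if \<open>f\<^sub>j\<close> divides \<open>c f\<^sub>k\<close>, it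
  divides the products of \<open>g\<^sub>i c\<close> with all three generators.
\<close>

lemma dvd_syzygy_power_mult:
  fixes f g :: "3 \<Rightarrow> 's::idom"
  assumes f: "no_common_divisor f"
    and g: "(\<Sum>i\<in>UNIV. g i * f i) = 0" and ijk: "i \<noteq> j" "i \<noteq> k" "j \<noteq> k"
    and "f j dvd c * f k ^ r"
  shows "f j dvd g i ^ r * c"
  using assms(6)
proof (induction r arbitrary: c)
  case (Suc r)
  have UNIV: "(UNIV :: 3 set) = {i, j, k}"
    using exhaust_3[of i] exhaust_3[of j] exhaust_3[of k] ijk by (auto simp: UNIV_3)
  have gi: "g i * f i = - (g j * f j + g k * f k)"
  proof -
    have "g i * f i + (g j * f j + g k * f k) = 0" using g ijk unfolding UNIV by simp
    then show ?thesis by (simp only: eq_neg_iff_add_eq_0)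
  qed
  have dk: "f j dvd c * f k ^ r * f k" using Suc.prems by (simp add: mult_ac)
  have "f j dvd (g i * c * f k ^ r) * f l" for l
  proof -
    have eq: "g i * c * f k ^ r * f i = - (g j * c * f k ^ r) * f j + - g k * (c * f k ^ r * f k)"
    proof -
      have "g i * c * f k ^ r * f i = c * f k ^ r * (g i * f i)" by (simp add: mult_ac)
      also have "\<dots> = c * f k ^ r * - (g j * f j + g k * f k)" by (simp only: gi)
      finally show ?thesis by (simp add: algebra_simps)
    qed
    have "f j dvd g i * c * f k ^ r * f i"
      unfolding eq by (intro dvd_add dvd_mult dvd_refl dk)
    moreover have "f j dvd g i * c * f k ^ r * f k" using dvd_mult[OF dk, of "g i"] by (simp only: mult.assoc)
    moreover have "l \<in> {i, j, k}" using UNIV by blast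
    ultimately show ?thesis by auto
  qed
  then have "f j dvd g i * c * f k ^ r" using f unfolding no_common_divisor_def by blast
  then have "f j dvd g i ^ r * (g i * c)" by (rule Suc.IH)
  moreover have "g i ^ r * (g i * c) = g i ^ Suc r * c" by simp
  ultimately show ?case by metis
qed simp

text \<open>
  This is the argument that a regular sequence of two elements generates an ideal of linear type:
  the coefficient \<open>c\<^sub>0\<close> is divisible by \<open>f\<^sub>j\<close> up to a power of \<open>g\<^sub>i\<close>, and the Koszul relation
  replaces \<open>f\<^sub>j T\<^sub>k\<close> by \<open>f\<^sub>k T\<^sub>j\<close>, so that \<open>T\<^sub>j\<close> can be split off.
\<close>

lemma syzygy_power_kills_binary_form:
  fixes f g :: "3 \<Rightarrow> 's::idom"
  assumes f: "no_common_divisor f"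
    and g: "(\<Sum>i\<in>UNIV. g i * f i) = 0" and ijk: "i \<noteq> j" "i \<noteq> k" "j \<noteq> k" and fj: "f j \<noteq> 0"
    and "binary_form c (f j) (f k) n = 0"
  shows "\<exists>M. Const (g i ^ M) * binary_form (\<lambda>l. Const (c l)) (Var j) (Var k) n \<in> linear_relations f"
  using assms(7)
proof (induction n arbitrary: c)
  case 0
  then show ?case by (simp add: binary_form_def linear_relations_closed)
next
  case (Suc n)
  let ?L = "linear_relations f" and ?b = "\<lambda>c n. binary_form (\<lambda>l. Const (c l)) (Var j) (Var k) n" and ?s = "g i ^ Suc n"
  have "f j dvd c 0 * f k ^ Suc n"
    using Suc.prems unfolding binary_form_Suc
    by (metis add_eq_0_iff dvd_minus_iff dvd_triv_left minus_minus)
  from dvd_syzygy_power_mult[OF f g ijk this] obtain v where v: "?s * c 0 = f j * v" by (elim dvdE)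
  define d where "d l = ?s * c (Suc l) + (if l = 0 then v * f k else 0)" for l
  have "binary_form d (f j) (f k) n = ?s * binary_form (\<lambda>l. c (Suc l)) (f j) (f k) n + v * f k * f k ^ n"
    unfolding d_def by (simp add: binary_form_scale binary_form_head flip: binary_form_add)
  then have "f j * binary_form d (f j) (f k) n = f j * v * f k ^ Suc n
      + f j * (?s * binary_form (\<lambda>l. c (Suc l)) (f j) (f k) n)"
    by (simp add: algebra_simps)
  also have "\<dots> = ?s * binary_form c (f j) (f k) (Suc n)"
    unfolding binary_form_Suc v[symmetric] by (simp add: algebra_simps)
  finally have "binary_form d (f j) (f k) n = 0" using Suc.prems fj by simp
  from Suc.IH[OF this] obtain M
    where M: "Const (g i ^ M) * ?b d n \<in> ?L" by blast
  have D: "?b d n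
      = Const ?s * ?b (\<lambda>l. c (Suc l)) n + Const (v * f k) * Var k ^ n"
    unfolding d_def
    by (simp add: binary_form_scale binary_form_head Const.hom_add Const.hom_mult
        if_distrib[of Const] flip: binary_form_add cong: if_cong)
  have v': "Const ?s * Const (c 0) = Const (f j) * Const v"
    using v by (metis Const.hom_mult)
  have "Const ?s * ?b c (Suc n)
      = (Const ?s * Const (c 0)) * Var k ^ Suc n
        + Var j * (Const ?s * ?b (\<lambda>l. c (Suc l)) n)"
    unfolding binary_form_Suc by (simp add: algebra_simps)
  also have "\<dots> = Var j * ?b d n
      + Const v * Var k ^ n * (Const (f j) * Var k - Const (f k) * Var j)"
    unfolding v' D by (simp add: Const.hom_mult algebra_simps)
  finally have "Const (g i ^ (M + Suc n)) * ?b c (Suc n)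
      = Const (g i ^ M) * (Var j * ?b d n
      + Const v * Var k ^ n * (Const (f j) * Var k - Const (f k) * Var j))"
    by (simp add: power_add Const.hom_mult mult.assoc)
  also have "\<dots> = Var j * (Const (g i ^ M) * ?b d n)
      + Const (g i ^ M) * Const v * Var k ^ n * (Const (f j) * Var k - Const (f k) * Var j)"
    by (simp add: algebra_simps)
  also have "\<dots> \<in> ?L"
    by (intro linear_relations_closed(2,3) M Koszul_linear_relation)
  finally show ?case by blast
qed

lemma syzygy_power_kills:
  fixes f g :: "3 \<Rightarrow> 's::idom"
  assumes f: "no_common_divisor f" and g: "(\<Sum>i\<in>UNIV. g i * f i) = 0"
    and P: "homogeneous n P" "eval_hom (\<lambda>c. c) f P = 0"
  shows "\<exists>M. Const (g i ^ M) * P \<in> linear_relations f"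
proof (cases "\<exists>j. j \<noteq> i \<and> f j \<noteq> 0")
  case True
  then obtain j where j: "i \<noteq> j" "f j \<noteq> 0" by metis
  obtain k where k: "i \<noteq> k" "j \<noteq> k"
  proof -
    have "(1::3) \<noteq> 2" "(1::3) \<noteq> 3" "(2::3) \<noteq> 3" by simp_all
    then show thesis using that exhaust_3[of i] exhaust_3[of j] j(1) by metis
  qed
  interpret ev: comm_ring_hom "eval_hom (\<lambda>c. c) f" by (rule eval_id_hom)
  obtain c where c: "Const (g i ^ n) * P - binary_form (\<lambda>l. Const (c l)) (Var j) (Var k) n \<in> linear_relations f"
    using reduce_to_binary_form[OF g j(1) k P(1)] by blast
  have "binary_form c (f j) (f k) n = 0"
    using eval_linear_relation[OF c] P(2) by (simp add: ev.hom_minus ev.hom_mult ev.hom_binary_form)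
  from syzygy_power_kills_binary_form[OF f g j(1) k j(2) this] obtain M
    where M: "Const (g i ^ M) * binary_form (\<lambda>l. Const (c l)) (Var j) (Var k) n \<in> linear_relations f"
    by blast
  have "Const (g i ^ M) * (Const (g i ^ n) * P - binary_form (\<lambda>l. Const (c l)) (Var j) (Var k) n)
     + Const (g i ^ M) * binary_form (\<lambda>l. Const (c l)) (Var j) (Var k) n \<in> linear_relations f"
    by (intro linear_relations_closed(2) M linear_relations_closed(3) c)
  then have "Const (g i ^ (M + n)) * P \<in> linear_relations f"
    by (simp add: power_add Const.hom_mult algebra_simps)
  then show ?thesis by blast
next
  case False
  have "f i \<noteq> 0"
    using f False unfolding no_common_divisor_def by (metis dvd_0_left_iff mult_zero_right one_neq_zero)
  have "(\<Sum>l\<in>UNIV. g l * f l) = (\<Sum>l\<in>{i}. g l * f l)"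
    by (rule sum.mono_neutral_right) (use False in auto)
  then have "g i = 0" using g \<open>f i \<noteq> 0\<close> by simp
  then show ?thesis by (intro exI[of _ 1]) (simp add: linear_relations_closed)
qed

lemma ring_ideal_power_add:
  assumes I: "ring_ideal I" and "s ^ m \<in> I" "t ^ n \<in> I"
  shows "(s + t) ^ (m + n) \<in> I"
  unfolding binomial_ring
proof (rule ring_ideal_sum[OF I])
  fix k assume k: "k \<in> {..m + n}"
  show "of_nat (m + n choose k) * s ^ k * t ^ (m + n - k) \<in> I"
  proof (cases "m \<le> k")
    case True
    then have "s ^ k = s ^ m * s ^ (k - m)" by (metis le_add_diff_inverse power_add)
    then have "of_nat (m + n choose k) * s ^ k * t ^ (m + n - k)
        = (of_nat (m + n choose k) * s ^ (k - m) * t ^ (m + n - k)) * s ^ m" by (simp add: mult_ac)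
    then show ?thesis using assms ring_idealD(3)[OF I] by metis
  next
    case False
    then have "t ^ (m + n - k) = t ^ n * t ^ (m - k)" by (metis Nat.add_diff_assoc2 add.commute linear power_add)
    then have "of_nat (m + n choose k) * s ^ k * t ^ (m + n - k)
        = (of_nat (m + n choose k) * s ^ k * t ^ (m - k)) * t ^ n" by (simp add: mult_ac)
    then show ?thesis using assms ring_idealD(3)[OF I] by metis
  qed
qed

definition radical :: "'a::comm_ring_1 set \<Rightarrow> 'a set" where
  "radical I = {s. \<exists>n. s ^ n \<in> I}"

lemma ring_ideal_radical:
  assumes I: "ring_ideal I" shows "ring_ideal (radical I)"
  unfolding ring_ideal_def radical_def
proof (intro conjI ballI allI)
  show "0 \<in> {s. \<exists>n. s ^ n \<in> I}" using ring_idealD(1)[OF I] by (auto intro!: exI[of _ 1])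
  show "a + b \<in> {s. \<exists>n. s ^ n \<in> I}" if "a \<in> {s. \<exists>n. s ^ n \<in> I}" "b \<in> {s. \<exists>n. s ^ n \<in> I}" for a b
    using that ring_ideal_power_add[OF I] by blast
  show "r * a \<in> {s. \<exists>n. s ^ n \<in> I}" if "a \<in> {s. \<exists>n. s ^ n \<in> I}" for a r
    using that ring_idealD(3)[OF I] by (auto simp: power_mult_distrib)
qed

lemma radical_power_closed: "s ^ n \<in> radical I \<Longrightarrow> s \<in> radical I"
  unfolding radical_def by (auto simp flip: power_mult)

definition syzygy_coordinates :: "('v::finite \<Rightarrow> 's::comm_ring_1) \<Rightarrow> 's set" where
  "syzygy_coordinates f = {g i | g i. (\<Sum>i\<in>UNIV. g i * f i) = 0}"

text \<open>
  The hypothesis \<open>supp\<close> says that the radical of the ideal of the coordinates of syzygies contains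
  the variables.
\<close>

theorem relations_are_linear:
  fixes f :: "3 \<Rightarrow> (3, 'k::idom) mpoly"
  assumes f: "no_common_divisor f"
    and supp: "\<And>A. ring_ideal A \<Longrightarrow> syzygy_coordinates f \<subseteq> A \<Longrightarrow>
       (\<And>s n. s ^ n \<in> A \<Longrightarrow> s \<in> A) \<Longrightarrow> \<forall>v. Var v \<in> A"
    and P: "homogeneous n P" "eval_hom (\<lambda>c. c) f P = 0"
  shows "P \<in> linear_relations f"
proof -
  define A where "A = {s. Const s * P \<in> linear_relations f}"
  have A: "ring_ideal A"
    unfolding ring_ideal_def A_def
    by (auto simp: linear_relations_closed Const.hom_add Const.hom_mult distrib_right mult.assoc)
  have "syzygy_coordinates f \<subseteq> radical A"
    using syzygy_power_kills[OF f _ P] by (auto simp: syzygy_coordinates_def radical_def A_def)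
  from supp[OF ring_ideal_radical[OF A] this radical_power_closed]
  have "\<forall>v. \<exists>N. Const (Var v ^ N) * P \<in> linear_relations f" by (simp add: radical_def A_def)
  then obtain N where N: "\<And>v. Const (Var v ^ N v) * P \<in> linear_relations f" by metis
  show ?thesis
  proof (rule linear_relations_irrelevant_torsion_free[OF f])
    fix v
    have "N v \<le> (\<Sum>v\<in>UNIV. N v)" by (rule member_le_sum) auto
    then obtain d where d: "(\<Sum>v\<in>UNIV. N v) = d + N v" by (metis add.commute le_Suc_ex)
    show "Const (Var v ^ (\<Sum>v\<in>UNIV. N v)) * P \<in> linear_relations f"
      using linear_relations_closed(3)[OF N[of v], of "Const (Var v ^ d)"]
      by (simp only: d power_add Const.hom_mult mult.assoc)
  qed
qed

section \<open>From the symmetric algebra to linear relations\<close>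

lemma hom_component_lookup [simp]:
  "lookup (hom_component n p) m = (if mdeg m = n then lookup p m else 0)"
  by (simp add: hom_component_def lookup_sum lookup_single when_def in_keys_iff)

lemma homogeneous_hom_component: "homogeneous n (hom_component n p)"
  by (auto simp: homogeneous_def in_keys_iff split: if_splits)

lemma sum_hom_components: "p = (\<Sum>n\<in>mdeg ` keys p. hom_component n p)"
proof (rule poly_mapping_eqI)
  fix m
  have "(\<Sum>n\<in>mdeg ` keys p. lookup (hom_component n p) m) = (if mdeg m \<in> mdeg ` keys p then lookup p m else 0)"
    by simp
  also have "\<dots> = lookup p m" by (auto simp: in_keys_iff)
  finally show "lookup p m = lookup (\<Sum>n\<in>mdeg ` keys p. hom_component n p) m"
    by (simp add: lookup_sum)
qed

lemma type_ring_simps [simp]: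
  "carrier ring_of_type_algebra = UNIV"
  "x \<otimes>\<^bsub>ring_of_type_algebra\<^esub> y = x * y" "x \<oplus>\<^bsub>ring_of_type_algebra\<^esub> y = x + y"
  "\<one>\<^bsub>ring_of_type_algebra\<^esub> = 1" "\<zero>\<^bsub>ring_of_type_algebra\<^esub> = 0"
  by (simp_all add: ring_of_type_algebra_def)

lemma type_ring_uminus [simp]: "\<ominus>\<^bsub>ring_of_type_algebra\<^esub> x = - x" for x :: "'a::comm_ring_1"
proof -
  interpret R: ring "ring_of_type_algebra :: 'a ring" by (rule ring_from_type_algebra)
  show ?thesis using R.minus_equality[of "-x" x] by simp
qed

lemma ideal_type_ring_iff: "ideal I ring_of_type_algebra \<longleftrightarrow> ring_ideal I" for I :: "'a::comm_ring_1 set"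
proof
  assume "ideal I ring_of_type_algebra"
  then interpret I: ideal I "ring_of_type_algebra :: 'a ring" .
  have 0: "0 \<in> I" using additive_subgroup.zero_closed[OF I.additive_subgroup_axioms] by (simp only: type_ring_simps)
  have add: "a + b \<in> I" if "a \<in> I" "b \<in> I" for a b
    using additive_subgroup.a_closed[OF I.additive_subgroup_axioms that] by (simp only: type_ring_simps)
  have mult: "r * a \<in> I" if "a \<in> I" for a r
    using I.I_l_closed[OF that, of r] by (simp only: type_ring_simps UNIV_I)
  show "ring_ideal I" unfolding ring_ideal_def by (intro conjI ballI allI 0 add mult)
next
  assume I: "ring_ideal I"
  interpret R: ring "ring_of_type_algebra :: 'a ring" by (rule ring_from_type_algebra)
  show "ideal I ring_of_type_algebra"
  proof (rule idealI[OF ring_from_type_algebra])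
    show "subgroup I (add_monoid ring_of_type_algebra)"
      by (rule R.add.subgroupI) (use ring_idealD[OF I] in \<open>auto simp flip: a_inv_def\<close>)
  qed (use ring_idealD[OF I] in auto)
qed

lemma genideal_range:
  fixes f :: "'v::finite \<Rightarrow> 's::comm_ring_1"
  shows "genideal ring_of_type_algebra (range f) = {\<Sum>i\<in>UNIV. s i * f i | s. True}"
proof
  interpret R: ring "ring_of_type_algebra :: 's ring" by (rule ring_from_type_algebra)
  let ?J = "{\<Sum>i\<in>UNIV. s i * f i | s. True}"
  have "ring_ideal ?J"
    unfolding ring_ideal_def
  proof (intro conjI ballI allI)
    show "0 \<in> ?J" by (auto intro!: exI[of _ "\<lambda>_. 0"])
    show "a + b \<in> ?J" if ab: "a \<in> ?J" "b \<in> ?J" for a b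
    proof -
      obtain s t where "a = (\<Sum>i\<in>UNIV. s i * f i)" "b = (\<Sum>i\<in>UNIV. t i * f i)" using ab by blast
      then show ?thesis by (auto intro!: exI[of _ "\<lambda>i. s i + t i"] simp: algebra_simps sum.distrib)
    qed
    show "r * a \<in> ?J" if a: "a \<in> ?J" for r a
    proof -
      obtain s where "a = (\<Sum>i\<in>UNIV. s i * f i)" using a by blast
      then show ?thesis by (auto intro!: exI[of _ "\<lambda>i. r * s i"] simp: algebra_simps sum_distrib_left)
    qed
  qed
  moreover have "range f \<subseteq> ?J"
  proof
    fix x assume "x \<in> range f"
    then obtain j where "x = f j" by blast
    then have "x = (\<Sum>i\<in>UNIV. (if i = j then 1 else 0) * f i)" by (simp add: if_distrib[of "\<lambda>c. c * _"] cong: if_cong)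
    then show "x \<in> ?J" by (intro CollectI exI conjI TrueI)
  qed
  ultimately show "genideal ring_of_type_algebra (range f) \<subseteq> ?J"
    by (intro R.genideal_minimal) (simp_all add: ideal_type_ring_iff)
next
  interpret R: ring "ring_of_type_algebra :: 's ring" by (rule ring_from_type_algebra)
  have I: "ring_ideal (genideal ring_of_type_algebra (range f))"
    using R.genideal_ideal[of "range f"] by (simp add: ideal_type_ring_iff)
  have "f i \<in> genideal ring_of_type_algebra (range f)" for i
    using R.genideal_self[of "range f"] by auto
  then show "{\<Sum>i\<in>UNIV. s i * f i | s. True} \<subseteq> genideal ring_of_type_algebra (range f)"
    by (auto intro!: ring_ideal_sum[OF I] ring_idealD(3)[OF I])
qed

lemma sym_free_ring_simps:
  "x \<otimes>\<^bsub>sym_free_ring I\<^esub> y = x * y" "x \<oplus>\<^bsub>sym_free_ring I\<^esub> y = x + y"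
  "\<one>\<^bsub>sym_free_ring I\<^esub> = 1" "\<zero>\<^bsub>sym_free_ring I\<^esub> = 0"
  by (simp_all add: sym_free_ring_def ring_of_type_algebra_def)

lemma sym_free_ring_carrier:
  "p \<in> carrier (sym_free_ring I) \<longleftrightarrow> (\<forall>m\<in>keys p. keys m \<subseteq> I)"
  by (simp add: sym_free_ring_def)

abbreviation sym_polys :: "'s::comm_ring_1 set \<Rightarrow> ('s, 's) mpoly set" where
  "sym_polys I \<equiv> carrier (sym_free_ring I)"

lemma sym_free_ring_closed:
  fixes I :: "'s::comm_ring_1 set"
  shows "0 \<in> sym_polys I" "1 \<in> sym_polys I"
    "p \<in> sym_polys I \<Longrightarrow> q \<in> sym_polys I \<Longrightarrow> p + q \<in> sym_polys I"
    "p \<in> sym_polys I \<Longrightarrow> q \<in> sym_polys I \<Longrightarrow> p - q \<in> sym_polys I"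
    "p \<in> sym_polys I \<Longrightarrow> - p \<in> sym_polys I"
    "p \<in> sym_polys I \<Longrightarrow> q \<in> sym_polys I \<Longrightarrow> p * q \<in> sym_polys I"
    "Const c \<in> sym_polys I"
    "a \<in> I \<Longrightarrow> Var a \<in> sym_polys I"
proof -
  show 0: "0 \<in> sym_polys I" by (simp add: sym_free_ring_carrier)
  show C: "Const c \<in> sym_polys I" for c
    by (auto simp: sym_free_ring_carrier Const_def)
  show "1 \<in> sym_polys I" using C[of 1] by simp
  show add: "p + q \<in> sym_polys I"
    if "p \<in> sym_polys I" "q \<in> sym_polys I" for p q
    using that keys_add[of p q] unfolding sym_free_ring_carrier by blast
  show um: "- p \<in> sym_polys I" if "p \<in> sym_polys I" for p
    using that unfolding sym_free_ring_carrier by (simp add: in_keys_iff)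
  show "p - q \<in> sym_polys I"
    if "p \<in> sym_polys I" "q \<in> sym_polys I" for p q
    using add[OF that(1) um[OF that(2)]] by simp
  show "Var a \<in> sym_polys I" if "a \<in> I"
    using that by (auto simp: sym_free_ring_carrier Var_def)
  show "p * q \<in> sym_polys I"
    if p: "p \<in> sym_polys I" and q: "q \<in> sym_polys I" for p q
    unfolding sym_free_ring_carrier
  proof
    fix m assume "m \<in> keys (p * q)"
    then obtain k l where kl: "m = k + l" "k \<in> keys p" "l \<in> keys q" using keys_mult by blast
    have "keys m \<subseteq> keys k \<union> keys l" unfolding kl by (rule keys_add)
    then show "keys m \<subseteq> I" using p q kl unfolding sym_free_ring_carrier by blast
  qed
qed

lemma sym_free_ring_sum:
  "(\<And>i. i \<in> A \<Longrightarrow> g i \<in> sym_polys I) \<Longrightarrow> sum g A \<in> sym_polys I"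
  by (induction A rule: infinite_finite_induct) (auto intro: sym_free_ring_closed)

lemma sym_free_ring_mon_eval:
  assumes "\<And>v. v \<in> keys m \<Longrightarrow> x v \<in> sym_polys I"
  shows "mon_eval x m \<in> sym_polys I"
proof -
  have pow: "p ^ n \<in> sym_polys I" if "p \<in> sym_polys I" for p n
    using that by (induction n) (auto intro: sym_free_ring_closed)
  have "(\<Prod>v\<in>A. x v ^ lookup m v) \<in> sym_polys I" if "A \<subseteq> keys m" for A
    using that by (induction A rule: infinite_finite_induct) (auto intro: sym_free_ring_closed assms pow)
  then show ?thesis unfolding mon_eval_def by blast
qed

lemma sym_free_ring_eval_hom:
  assumes "\<And>m v. m \<in> keys p \<Longrightarrow> v \<in> keys m \<Longrightarrow> x v \<in> sym_polys I"
  shows "eval_hom Const x p \<in> sym_polys I"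
proof -
  have "eval_hom Const x p = (\<Sum>m\<in>keys p. Const (lookup p m) * mon_eval x m)"
    by (simp add: eval_hom_def mon_eval_def)
  then show ?thesis
    by (auto intro!: sym_free_ring_sum sym_free_ring_closed sym_free_ring_mon_eval assms)
qed

lemma sym_free_ring_induct [consumes 1, case_names Const Var add mult]:
  assumes p: "p \<in> sym_polys I"
    and "\<And>c. Q (Const c)" "\<And>a. a \<in> I \<Longrightarrow> Q (Var a)"
    and add: "\<And>p q. p \<in> sym_polys I \<Longrightarrow> q \<in> sym_polys I \<Longrightarrow> Q p \<Longrightarrow> Q q \<Longrightarrow> Q (p + q)"
    and mult: "\<And>p q. p \<in> sym_polys I \<Longrightarrow> q \<in> sym_polys I \<Longrightarrow> Q p \<Longrightarrow> Q q \<Longrightarrow> Q (p * q)"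
  shows "Q p"
proof -
  define T where "T = {p \<in> sym_polys I. Q p}"
  have T: "Const c \<in> T" "a \<in> I \<Longrightarrow> Var a \<in> T" "p \<in> T \<Longrightarrow> q \<in> T \<Longrightarrow> p + q \<in> T"
    "p \<in> T \<Longrightarrow> q \<in> T \<Longrightarrow> p * q \<in> T" for c a p q
    using assms(2-5) by (auto simp: T_def sym_free_ring_closed)
  have T01: "0 \<in> T" "1 \<in> T" using T(1)[of 0] T(1)[of 1] by simp_all
  have pow: "x ^ n \<in> T" if "x \<in> T" for x n
    using that by (induction n) (auto simp: T01 T)
  have "mon_eval Var m \<in> T" if m: "keys m \<subseteq> I" for m
  proof -
    have "(\<Prod>v\<in>A. Var v ^ lookup m v) \<in> T" if "A \<subseteq> keys m" for A
      using that m by (induction A rule: infinite_finite_induct) (auto intro!: T T01 pow)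
    then show ?thesis unfolding mon_eval_def by blast
  qed
  then have "Const (lookup p m) * mon_eval Var m \<in> T" if "m \<in> keys p" for m
    using that p by (auto simp: sym_free_ring_carrier intro!: T)
  then have "(\<Sum>m\<in>A. Const (lookup p m) * mon_eval Var m) \<in> T" if "A \<subseteq> keys p" for A
    using that by (induction A rule: infinite_finite_induct) (auto intro: T(3) T01)
  then have "(\<Sum>m\<in>keys p. Const (lookup p m) * mon_eval Var m) \<in> T" by blast
  then have "p \<in> T" using mpoly_eq_sum_single[of p] by (simp add: single_eq_Const_mult)
  then show ?thesis by (simp add: T_def)
qed

lemma ring_sym_free_ring: "ring (sym_free_ring I)" for I :: "'s::comm_ring_1 set"
proof -
  interpret R: ring "ring_of_type_algebra :: ('s, 's) mpoly ring" by (rule ring_from_type_algebra)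
  have "subring (sym_polys I) (ring_of_type_algebra :: ('s, 's) mpoly ring)"
    by (rule R.subringI) (auto simp: sym_free_ring_closed)
  from R.subring_is_ring[OF this] show ?thesis by (simp add: sym_free_ring_def)
qed

lemma sym_relations_closed:
  assumes I: "ring_ideal I"
  shows "sym_relations I \<subseteq> sym_polys I"
  using ring_idealD[OF I] by (auto simp: sym_relations_def intro!: sym_free_ring_closed)

lemma constant_poly_hom: "comm_ring_hom (\<lambda>s::'s::comm_ring_1. [:s:])"
  by (rule comm_ring_homI, rule one_pCons[symmetric]) simp_all

lemma sym_to_rees_lift_hom: "comm_ring_hom (sym_to_rees_lift :: ('s::comm_ring_1, 's) mpoly \<Rightarrow> 's poly)"
  unfolding sym_to_rees_lift_def by (rule comm_ring_hom.eval_hom_comm_ring_hom[OF constant_poly_hom])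

lemma sym_to_rees_lift_ring_hom: "ring_hom_ring (sym_free_ring I) ring_of_type_algebra sym_to_rees_lift"
proof -
  interpret L: comm_ring_hom "sym_to_rees_lift :: ('a, 'a) mpoly \<Rightarrow> 'a poly" by (rule sym_to_rees_lift_hom)
  show ?thesis
    by (rule ring_hom_ringI[OF ring_sym_free_ring ring_from_type_algebra])
      (simp_all add: sym_free_ring_simps L.hom_add L.hom_mult)
qed

lemma sym_to_rees_lift_Const [simp]: "sym_to_rees_lift (Const c) = [:c:]"
  unfolding sym_to_rees_lift_def by (rule comm_ring_hom.eval_hom_Const[OF constant_poly_hom])

lemma sym_to_rees_lift_Var [simp]: "sym_to_rees_lift (Var a) = Polynomial.monom a 1"
  unfolding sym_to_rees_lift_def by (rule comm_ring_hom.eval_hom_Var[OF constant_poly_hom])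

abbreviation ideal_power :: "'s::comm_ring_1 set \<Rightarrow> nat \<Rightarrow> 's set" where
  "ideal_power I t \<equiv> I [^]\<^bsub>ideals_set ring_of_type_algebra\<^esub> t"

lemma ideal_power_simps:
  "ideal_power I 0 = UNIV" "ideal_power I (Suc t) = ideal_prod ring_of_type_algebra (ideal_power I t) I"
  by (simp_all add: nat_pow_def ideals_set_def)

lemma ring_ideal_ideal_power:
  fixes I :: "'s::comm_ring_1 set"
  assumes "ring_ideal I" shows "ring_ideal (ideal_power I t)"
proof (induction t)
  case 0
  show ?case unfolding ideal_power_simps by (simp add: ring_ideal_def)
next
  case (Suc t)
  interpret R: ring "ring_of_type_algebra :: 's ring" by (rule ring_from_type_algebra)
  show ?case unfolding ideal_power_simps
    using R.ideal_prod_is_ideal Suc assms by (simp flip: ideal_type_ring_iff)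
qed

lemma mon_eval_in_ideal_power:
  "keys m \<subseteq> I \<Longrightarrow> mon_eval (\<lambda>a. a) m \<in> ideal_power I (mdeg m)"
proof (induction m rule: exponent_induct)
  case zero
  show ?case unfolding mdeg_0 ideal_power_simps by simp
next
  case (Suc m v)
  have "keys (m + single v 1) = insert v (keys m)"
    by (auto simp: in_keys_iff lookup_add lookup_single when_def split: if_splits)
  then have "mon_eval (\<lambda>a. a) m \<in> ideal_power I (mdeg m)" "v \<in> I" using Suc by auto
  from ideal_prod.prod[OF this, of ring_of_type_algebra]
  have "mon_eval (\<lambda>a. a) m * v \<in> ideal_power I (Suc (mdeg m))"
    unfolding ideal_power_simps by (simp only: type_ring_simps)
  then show ?case
    by (simp only: mon_eval_add mon_eval_single mdeg_add mdeg_single power_one_right Suc_eq_plus1)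
qed

lemma monom_mon_eval:
  "[:c:] * mon_eval (\<lambda>v. Polynomial.monom (x v) 1) m = Polynomial.monom (c * mon_eval x m) (mdeg m)"
  for x :: "'v \<Rightarrow> 'a::comm_ring_1"
proof (induction m rule: exponent_induct)
  case zero
  show ?case by (simp add: monom_0)
next
  case (Suc m v)
  have "[:c:] * mon_eval (\<lambda>v. Polynomial.monom (x v) 1) (m + single v 1)
    = ([:c:] * mon_eval (\<lambda>v. Polynomial.monom (x v) 1) m) * Polynomial.monom (x v) 1"
    by (simp only: mon_eval_add mon_eval_single power_one_right mult.assoc)
  then show ?case unfolding Suc by (simp add: mon_eval_add mdeg_add mult_monom mult.assoc)
qed

text \<open>
  The power \<open>I\<^sup>t\<close> is additively spanned by products of \<open>t\<close> elements of \<open>I\<close>, up to a scalar when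
  \<open>t = 0\<close>, and these are the values at monomials of degree \<open>t\<close> in the variables \<open>T\<^sub>a\<close>.
\<close>

lemma sym_to_rees_lift_image:
  fixes I :: "'s::comm_ring_1 set"
  assumes I: "ring_ideal I"
  shows "sym_to_rees_lift ` sym_polys I = {p. \<forall>t. coeff p t \<in> ideal_power I t}"
proof
  note It = ring_idealD[OF ring_ideal_ideal_power[OF I]]
  interpret L: comm_ring_hom "sym_to_rees_lift :: ('s, 's) mpoly \<Rightarrow> 's poly" by (rule sym_to_rees_lift_hom)
  show "sym_to_rees_lift ` sym_polys I \<subseteq> {p. \<forall>t. coeff p t \<in> ideal_power I t}"
  proof clarify
    fix p t assume p: "p \<in> sym_polys I"
    have "sym_to_rees_lift p = (\<Sum>m\<in>keys p. [:lookup p m:] * mon_eval (\<lambda>v. Polynomial.monom v 1) m)"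
      by (simp add: sym_to_rees_lift_def eval_hom_def mon_eval_def)
    then have "coeff (sym_to_rees_lift p) t
      = (\<Sum>m\<in>keys p. coeff (Polynomial.monom (lookup p m * mon_eval (\<lambda>a. a) m) (mdeg m)) t)"
      by (simp only: monom_mon_eval coeff_sum)
    also have "\<dots> \<in> ideal_power I t"
      using p by (auto intro!: ring_ideal_sum[OF ring_ideal_ideal_power[OF I]] It(1,3) mon_eval_in_ideal_power
          simp: sym_free_ring_carrier)
    finally show "coeff (sym_to_rees_lift p) t \<in> ideal_power I t" .
  qed
  have mult_im: "x * y \<in> sym_to_rees_lift ` sym_polys I"
    if "x \<in> sym_to_rees_lift ` sym_polys I" "y \<in> sym_to_rees_lift ` sym_polys I" for x y
    using that by (auto simp flip: L.hom_mult intro!: imageI sym_free_ring_closed)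
  have add_im: "x + y \<in> sym_to_rees_lift ` sym_polys I"
    if "x \<in> sym_to_rees_lift ` sym_polys I" "y \<in> sym_to_rees_lift ` sym_polys I" for x y
    using that by (auto simp flip: L.hom_add intro!: imageI sym_free_ring_closed)
  have zero_im: "0 \<in> sym_to_rees_lift ` sym_polys I"
    using L.hom_zero sym_free_ring_closed(1) by (metis imageI)
  have monom: "Polynomial.monom a t \<in> sym_to_rees_lift ` sym_polys I" if "a \<in> ideal_power I t" for a t
    using that
  proof (induction t arbitrary: a)
    case 0
    then show ?case using sym_free_ring_closed(7)[of a I] by (metis imageI sym_to_rees_lift_Const monom_0)
  next
    case (Suc t)
    from Suc.prems have "a \<in> ideal_prod ring_of_type_algebra (ideal_power I t) I"
      by (simp only: ideal_power_simps)
    then show ?case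
    proof induction
      case (prod i j)
      have "Polynomial.monom j 1 \<in> sym_to_rees_lift ` sym_polys I"
        using sym_free_ring_closed(8)[OF prod(2)] by (metis imageI sym_to_rees_lift_Var)
      from mult_im[OF Suc.IH[OF prod(1)] this] show ?case by (simp add: mult_monom)
    next
      case (sum s1 s2)
      then show ?case using add_im by (simp flip: add_monom)
    qed
  qed
  show "{p. \<forall>t. coeff p t \<in> ideal_power I t} \<subseteq> sym_to_rees_lift ` sym_polys I"
  proof clarify
    fix p :: "'s poly" assume p: "\<forall>t. coeff p t \<in> ideal_power I t"
    have "(\<Sum>t\<in>A. Polynomial.monom (coeff p t) t) \<in> sym_to_rees_lift ` sym_polys I" for A
      by (induction A rule: infinite_finite_induct) (use p in \<open>auto intro: zero_im add_im monom\<close>)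
    then show "p \<in> sym_to_rees_lift ` sym_polys I"
      using poly_as_sum_of_monoms[of p] by metis
  qed
qed

lemma linear_relations_expand:
  assumes "P \<in> linear_relations f"
  obtains M g where "finite M" "\<forall>m. (\<Sum>i\<in>UNIV. g m i * f i) = 0"
    "P = (\<Sum>m\<in>M. mon_eval Var m * (\<Sum>i\<in>UNIV. Const (g m i) * Var i))"
proof -
  obtain G where G: "P = (\<Sum>i\<in>UNIV. G i * Var i)" "(\<Sum>i\<in>UNIV. G i * Const (f i)) = 0"
    using assms unfolding linear_relations_def by blast
  define M where "M = (\<Union>i. keys (G i))"
  have fin: "finite M" by (simp add: M_def)
  have Gi: "G i = (\<Sum>m\<in>M. mon_eval Var m * Const (lookup (G i) m))" for i
  proof -
    have "G i = (\<Sum>m\<in>keys (G i). single m (lookup (G i) m))" by (rule mpoly_eq_sum_single)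
    also have "\<dots> = (\<Sum>m\<in>M. single m (lookup (G i) m))"
      by (rule sum.mono_neutral_left) (auto simp: fin M_def in_keys_iff)
    finally show ?thesis by (simp add: single_eq_Const_mult mult.commute)
  qed
  have "P = (\<Sum>i\<in>UNIV. \<Sum>m\<in>M. mon_eval Var m * (Const (lookup (G i) m) * Var i))"
    unfolding G(1) by (subst Gi) (simp add: sum_distrib_right mult.assoc)
  also have "\<dots> = (\<Sum>m\<in>M. mon_eval Var m * (\<Sum>i\<in>UNIV. Const (lookup (G i) m) * Var i))"
    by (subst sum.swap) (simp add: sum_distrib_left)
  finally have P: "P = (\<Sum>m\<in>M. mon_eval Var m * (\<Sum>i\<in>UNIV. Const (lookup (G i) m) * Var i))" .
  have "(\<Sum>i\<in>UNIV. lookup (G i) m * f i) = 0" for m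
  proof -
    have "(\<Sum>i\<in>UNIV. lookup (G i) m * f i) = lookup (\<Sum>i\<in>UNIV. Const (f i) * G i) m"
      by (simp add: lookup_sum mult.commute[of _ "f _"])
    also have "(\<Sum>i\<in>UNIV. Const (f i) * G i) = 0" using G(2) by (simp add: mult.commute)
    finally show ?thesis by simp
  qed
  then show thesis using that[OF fin _ P] by blast
qed

text \<open>
  By the homomorphism theorem it suffices to find the kernel of the map from the polynomial ring in
  all \<open>T\<^sub>a\<close>, \<open>a \<in> I\<close>.  Modulo the defining relations each \<open>T\<^sub>a\<close> is a combination of the finitely many
  \<open>T\<close> that belong to the generators, so an element of the kernel may be replaced by a polynomial \<open>q\<close> in
  these; the homogeneous components of \<open>q\<close> vanish at the generators.
\<close>

theorem linear_typeI:
  fixes f :: "'v::finite \<Rightarrow> 's::comm_ring_1"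
  assumes linear: "\<And>n P. homogeneous n P \<Longrightarrow> eval_hom (\<lambda>c. c) f P = 0 \<Longrightarrow> P \<in> linear_relations f"
  shows "linear_type (genideal ring_of_type_algebra (range f))"
proof -
  define I where "I = genideal ring_of_type_algebra (range f)"
  interpret R: ring "ring_of_type_algebra :: 's ring" by (rule ring_from_type_algebra)
  interpret F: ring "sym_free_ring I" by (rule ring_sym_free_ring)
  interpret L: comm_ring_hom "sym_to_rees_lift :: ('s, 's) mpoly \<Rightarrow> 's poly" by (rule sym_to_rees_lift_hom)
  interpret H: ring_hom_ring "sym_free_ring I" ring_of_type_algebra sym_to_rees_lift
    by (rule sym_to_rees_lift_ring_hom)
  have I: "ring_ideal I"
    unfolding I_def using R.genideal_ideal[of "range f"] by (simp add: ideal_type_ring_iff)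
  define K where "K = genideal (sym_free_ring I) (sym_relations I)"
  have K: "ideal K (sym_free_ring I)"
    unfolding K_def by (rule F.genideal_ideal[OF sym_relations_closed[OF I]])
  interpret K: ideal K "sym_free_ring I" by (rule K)
  have relK: "x \<in> K" if "x \<in> sym_relations I" for x
    using that F.genideal_self[OF sym_relations_closed[OF I]] unfolding K_def by blast
  have K_zero: "0 \<in> K" using K.zero_closed by (simp add: sym_free_ring_simps)
  have K_add: "x + y \<in> K" if "x \<in> K" "y \<in> K" for x y
    using K.a_closed[OF that] by (simp add: sym_free_ring_simps)
  have K_mult: "r * x \<in> K" if "x \<in> K" "r \<in> sym_polys I" for r x
    using K.I_l_closed[OF that] by (simp add: sym_free_ring_simps)
  have K_uminus: "- x \<in> K" if "x \<in> K" for x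
    using K_mult[OF that sym_free_ring_closed(7)[of "-1"]] by (simp add: Const.hom_uminus)
  have K_diff: "x - y \<in> K" if "x \<in> K" "y \<in> K" for x y
    using K_add[OF that(1) K_uminus[OF that(2)]] by simp
  have K_sum: "sum g A \<in> K" if "\<And>i. i \<in> A \<Longrightarrow> g i \<in> K" for g and A :: "'b set"
    using that by (induction A rule: infinite_finite_induct) (auto intro: K_zero K_add)
  have add_rel: "Var (a + b) - (Var a + Var b) \<in> K" if "a \<in> I" "b \<in> I" for a b
    using that by (intro relK) (auto simp: sym_relations_def)
  have scale_rel: "Var (s * a) - Const s * Var a \<in> K" if "a \<in> I" for s a
    using that by (intro relK) (auto simp: sym_relations_def)
  have fI: "f i \<in> I" for i
    using R.genideal_self[of "range f"] unfolding I_def by auto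
  have comb: "Var (\<Sum>i\<in>A. s i * f i) - (\<Sum>i\<in>A. Const (s i) * Var (f i)) \<in> K" for s and A :: "'v set"
  proof (induction A rule: infinite_finite_induct)
    case (insert i A)
    have "(\<Sum>i\<in>A. s i * f i) \<in> I" "s i * f i \<in> I"
      by (auto intro!: ring_ideal_sum[OF I] ring_idealD(3)[OF I] fI)
    from K_add[OF K_add[OF add_rel[OF this(2,1)] scale_rel[OF fI[of i], of "s i"]] insert.IH] show ?case
      using insert by (simp add: algebra_simps)
  qed (use scale_rel[OF ring_idealD(1)[OF I], of 0] in simp_all)
  have kernel_ideal: "ideal (a_kernel (sym_free_ring I) ring_of_type_algebra sym_to_rees_lift) (sym_free_ring I)"
    by (rule H.kernel_is_ideal)
  have kernel: "x \<in> a_kernel (sym_free_ring I) ring_of_type_algebra sym_to_rees_lift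
     \<longleftrightarrow> x \<in> sym_polys I \<and> sym_to_rees_lift x = 0" for x
    by (simp only: a_kernel_def' mem_Collect_eq type_ring_simps)
  have "K \<subseteq> a_kernel (sym_free_ring I) ring_of_type_algebra sym_to_rees_lift"
    unfolding K_def
  proof (rule F.genideal_minimal[OF kernel_ideal])
    show "sym_relations I \<subseteq> a_kernel (sym_free_ring I) ring_of_type_algebra sym_to_rees_lift"
    proof
      fix x assume x: "x \<in> sym_relations I"
      then have "sym_to_rees_lift x = 0"
        by (auto simp: sym_relations_def L.hom_minus L.hom_add L.hom_mult smult_monom simp flip: add_monom)
      then show "x \<in> a_kernel (sym_free_ring I) ring_of_type_algebra sym_to_rees_lift"
        using x sym_relations_closed[OF I] kernel by blast
    qed
  qed
  moreover have "p \<in> K" if p: "p \<in> sym_polys I" and Lp: "sym_to_rees_lift p = 0" for p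
  proof -
    have "\<forall>a. \<exists>s. a \<in> I \<longrightarrow> a = (\<Sum>i\<in>UNIV. s i * f i)" by (auto simp: I_def genideal_range)
    from choice[OF this] obtain s where s: "\<And>a. a \<in> I \<Longrightarrow> a = (\<Sum>i\<in>UNIV. s a i * f i)" by blast
    define q where "q = eval_hom Const (\<lambda>a. \<Sum>i\<in>UNIV. Const (s a i) * Var i) p"
    define \<Theta> :: "('v, 's) mpoly \<Rightarrow> ('s, 's) mpoly" where "\<Theta> = eval_hom Const (\<lambda>i. Var (f i))"
    interpret \<Theta>: comm_ring_hom \<Theta> unfolding \<Theta>_def by (rule Const.eval_hom_comm_ring_hom)
    have \<Theta>_gen [simp]: "\<Theta> (Const c) = Const c" "\<Theta> (Var i) = Var (f i)" for c i by (simp_all add: \<Theta>_def)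
    define y where "y a = (\<Sum>i\<in>UNIV. Const (s a i) * Var (f i))" for a
    have \<Theta>q: "\<Theta> q = eval_hom Const y p"
      unfolding q_def y_def
      by (subst hom_eval_hom[OF \<Theta>.comm_ring_hom_axioms Const_hom]) (simp add: \<Theta>.hom_sum \<Theta>.hom_mult)
    have y: "y a \<in> sym_polys I" for a
      unfolding y_def by (intro sym_free_ring_sum sym_free_ring_closed fI)
    interpret Y: comm_ring_hom "eval_hom Const y" by (rule Const.eval_hom_comm_ring_hom)
    from p have pq: "p - eval_hom Const y p \<in> K"
    proof (induction rule: sym_free_ring_induct)
      case (Var a)
      then show ?case using comb[of "s a" UNIV] s[OF Var] by (simp add: y_def)
    next
      case (add p q)
      from K_add[OF add.IH] show ?case by (simp add: Y.hom_add algebra_simps)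
    next
      case (mult p q)
      have "p * (q - eval_hom Const y q) + eval_hom Const y q * (p - eval_hom Const y p) \<in> K"
        by (intro K_add K_mult mult sym_free_ring_eval_hom y)
      then show ?case by (simp add: Y.hom_mult algebra_simps)
    qed (simp add: K_zero)
    have "sym_to_rees_lift (p - \<Theta> q) = 0"
      using pq \<Theta>q \<open>K \<subseteq> _\<close> kernel by auto
    then have Lq: "sym_to_rees_lift (\<Theta> q) = 0" using Lp by (simp add: L.hom_minus)
    have "sym_to_rees_lift (\<Theta> q) = eval_hom (\<lambda>c. [:c:]) (\<lambda>i. Polynomial.monom (f i) 1) q"
      unfolding \<Theta>_def by (subst hom_eval_hom[OF sym_to_rees_lift_hom Const_hom]) simp
    also have "\<dots> = (\<Sum>m\<in>keys q. Polynomial.monom (lookup q m * mon_eval f m) (mdeg m))"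
      by (simp add: eval_hom_def flip: mon_eval_def monom_mon_eval)
    finally have Lq': "(\<Sum>m\<in>keys q. Polynomial.monom (lookup q m * mon_eval f m) (mdeg m)) = 0"
      using Lq by simp
    have "eval_hom (\<lambda>c. c) f (hom_component n q) = 0" for n
    proof -
      have "eval_hom (\<lambda>c. c) f (hom_component n q)
        = (\<Sum>m\<in>keys q. lookup (hom_component n q) m * mon_eval f m)"
        by (rule eval_hom_superset) (auto simp: in_keys_iff split: if_splits)
      also have "\<dots> = coeff (\<Sum>m\<in>keys q. Polynomial.monom (lookup q m * mon_eval f m) (mdeg m)) n"
        unfolding coeff_sum by (rule sum.cong) auto
      finally show ?thesis by (simp add: Lq')
    qed
    then have "hom_component n q \<in> linear_relations f" for n
      using linear[OF homogeneous_hom_component] by blast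
    then have "q \<in> linear_relations f"
      using sum_hom_components[of q] ring_ideal_sum[OF ring_ideal_linear_relations] by metis
    then obtain M g where M: "finite M" and g: "\<forall>m. (\<Sum>i\<in>UNIV. g m i * f i) = 0"
      and q: "q = (\<Sum>m\<in>M. mon_eval Var m * (\<Sum>i\<in>UNIV. Const (g m i) * Var i))"
      by (rule linear_relations_expand)
    have "Var 0 \<in> K" using scale_rel[OF ring_idealD(1)[OF I], of 0] by simp
    then have "(\<Sum>i\<in>UNIV. Const (g m i) * Var (f i)) \<in> K" for m
      using K_diff[OF _ comb[of "g m" UNIV], of "Var 0"] by (simp add: g)
    then have "mon_eval (\<lambda>i. Var (f i)) m * (\<Sum>i\<in>UNIV. Const (g m i) * Var (f i)) \<in> K" for m
      by (intro K_mult sym_free_ring_mon_eval sym_free_ring_closed(8) fI)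
    then have "\<Theta> q \<in> K"
      unfolding q by (simp add: \<Theta>.hom_sum \<Theta>.hom_mult \<Theta>.hom_mon_eval K_sum)
    from K_add[OF pq[folded \<Theta>q] this] show "p \<in> K" by simp
  qed
  ultimately have "a_kernel (sym_free_ring I) ring_of_type_algebra sym_to_rees_lift = K"
    using kernel by blast
  moreover have "(sym_to_rees :: ('s, 's) mpoly set \<Rightarrow> 's poly) = (\<lambda>C. the_elem (sym_to_rees_lift ` C))"
    by (simp add: sym_to_rees_def fun_eq_iff)
  moreover have "rees_algebra I
    = ring_of_type_algebra\<lparr>carrier := sym_to_rees_lift ` sym_polys I\<rparr>"
    by (simp add: rees_algebra_def sym_to_rees_lift_image[OF I])
  ultimately show ?thesis
    using H.FactRing_iso_set_aux
    unfolding linear_type_def sym_algebra_def I_def[symmetric] K_def by simp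
qed

section \<open>Factoriality of the ring of ternary polynomials\<close>

lemma ne3 [simp]: "(v::3) + 1 \<noteq> v" "v \<noteq> v + 1" "v + 2 \<noteq> v" "v \<noteq> v + 2" "v + 2 \<noteq> v + 1" "v + 1 \<noteq> v + 2"
  by simp_all

lemma UNIV_3_shift: "(UNIV :: 3 set) = {v, v + 1, v + 2}"
proof -
  have "w \<in> {v, v + 1, v + 2}" for w
    using exhaust_3[of v] exhaust_3[of w] by (elim disjE; hypsubst; simp)
  then show ?thesis by blast
qed

text \<open>
  The variable \<open>v\<close> is the outermost one, so that the derivative with respect to \<open>v\<close> becomes the
  derivative of a univariate polynomial.
\<close>

definition nested :: "3 \<Rightarrow> (3, 'k::comm_ring_1) mpoly \<Rightarrow> 'k poly poly poly" where
  "nested v = eval_hom (\<lambda>c. [:[:[:c:]:]:])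
     (\<lambda>i. if i = v then [:0, 1:] else if i = v + 1 then [:[:0, 1:]:] else [:[:[:0, 1:]:]:])"

definition exponent :: "3 \<Rightarrow> nat \<Rightarrow> nat \<Rightarrow> nat \<Rightarrow> (3 \<Rightarrow>\<^sub>0 nat)" where
  "exponent v i j k = single v i + single (v + 1) j + single (v + 2) k"

lemma lookup_exponent [simp]:
  "lookup (exponent v i j k) v = i" "lookup (exponent v i j k) (v + 1) = j"
  "lookup (exponent v i j k) (v + 2) = k"
  by (simp_all add: exponent_def lookup_add lookup_single)

lemma exponent_eqI: "(\<And>w. w \<in> {v, v + 1, v + 2} \<Longrightarrow> lookup m w = lookup n w) \<Longrightarrow> m = n"
  for v :: 3 and m n :: "3 \<Rightarrow>\<^sub>0 nat"
  using UNIV_3_shift[of v] by (intro poly_mapping_eqI) blast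

lemma exponent_lookup: "exponent v (lookup m v) (lookup m (v + 1)) (lookup m (v + 2)) = m"
  by (rule exponent_eqI[of v]) auto

lemma eq_exponent_iff:
  "m = exponent v i j k \<longleftrightarrow> lookup m v = i \<and> lookup m (v + 1) = j \<and> lookup m (v + 2) = k"
  using exponent_lookup[of v m] by auto

lemma nested_const_hom: "comm_ring_hom (\<lambda>c::'k::comm_ring_1. [:[:[:c:]:]:])"
  by (rule comm_ring_homI) (simp_all flip: one_pCons)

lemma nested_hom: "comm_ring_hom (nested v)"
  unfolding nested_def by (rule comm_ring_hom.eval_hom_comm_ring_hom[OF nested_const_hom])

lemma nested_Const [simp]: "nested v (Const c) = [:[:[:c:]:]:]"
  unfolding nested_def by (rule comm_ring_hom.eval_hom_Const[OF nested_const_hom])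

lemma nested_Var: "nested v (Var i) = (if i = v then [:0, 1:] else if i = v + 1 then [:[:0, 1:]:] else [:[:[:0, 1:]:]:])"
  unfolding nested_def by (rule comm_ring_hom.eval_hom_Var[OF nested_const_hom])

lemma const_poly_power: "[:p:] ^ n = [:p ^ n:]" for p :: "'a::comm_ring_1"
  by (induction n) (simp_all flip: one_pCons)

lemma X_power: "pCons 0 1 ^ n = Polynomial.monom (1::'a::comm_ring_1) n"
  by (simp add: monom_altdef)

lemma nested_0 [simp]: "nested v 0 = 0"
  unfolding nested_def by (rule comm_ring_hom.eval_hom_0[OF nested_const_hom])

lemma nested_single:
  "nested v (single m c) = Polynomial.monom (Polynomial.monom (Polynomial.monom c (lookup m (v + 2)))
     (lookup m (v + 1))) (lookup m v)"
proof -
  interpret N: comm_ring_hom "nested v :: (3, 'a) mpoly \<Rightarrow> _" by (rule nested_hom)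
  have "nested v (single m c) = [:[:[:c:]:]:] * mon_eval (\<lambda>i. nested v (Var i)) m"
    by (simp add: single_eq_Const_mult N.hom_mult N.hom_mon_eval)
  also have "mon_eval (\<lambda>i. nested v (Var i)) m = (\<Prod>i\<in>{v, v + 1, v + 2}. nested v (Var i :: (3, 'a) mpoly) ^ lookup m i)"
    by (rule mon_eval_superset) (use UNIV_3_shift[of v] in auto)
  also have "\<dots> = Polynomial.monom 1 (lookup m v) * ([:Polynomial.monom 1 (lookup m (v + 1)):]
      * [:[:Polynomial.monom 1 (lookup m (v + 2)):]:])"
    by (simp add: nested_Var const_poly_power X_power)
  finally show ?thesis
    by (simp add: smult_monom mult_monom flip: monom_0)
qed

lemma coeff_nested: "coeff (coeff (coeff (nested v p) i) j) k = lookup p (exponent v i j k)"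
proof (induction p rule: mpoly_induct)
  case (single m c)
  have "lookup (single m c) (exponent v i j k) = (if m = exponent v i j k then c else 0)"
    by (simp add: lookup_single when_def)
  then show ?case by (auto simp: nested_single eq_exponent_iff)
next
  case (add p q)
  interpret N: comm_ring_hom "nested v :: (3, 'a) mpoly \<Rightarrow> _" by (rule nested_hom)
  show ?case using add by (simp add: N.hom_add lookup_add)
qed

lemma inj_nested: "inj (nested v)"
proof (rule injI)
  fix p q :: "(3, 'a) mpoly" assume "nested v p = nested v q"
  then have "lookup p (exponent v i j k) = lookup q (exponent v i j k)" for i j k
    using coeff_nested by metis
  then have "lookup p m = lookup q m" for m
    using exponent_lookup[of v m] by metis
  then show "p = q" by (rule poly_mapping_eqI)
qed

lemma surj_nested: "surj (nested v :: (3, 'k::comm_ring_1) mpoly \<Rightarrow> _)"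
proof -
  let ?R = "range (nested v :: (3, 'k) mpoly \<Rightarrow> _)"
  interpret N: comm_ring_hom "nested v :: (3, 'k) mpoly \<Rightarrow> _" by (rule nested_hom)
  have add: "p + q \<in> ?R" if "p \<in> ?R" "q \<in> ?R" for p q
    using that by (auto simp flip: N.hom_add)
  have mult: "p * q \<in> ?R" if "p \<in> ?R" "q \<in> ?R" for p q
    using that by (auto simp flip: N.hom_mult)
  have gen: "[:[:[:c:]:]:] \<in> ?R" "[:0, 1:] \<in> ?R" "[:[:0, 1:]:] \<in> ?R" "[:[:[:0, 1:]:]:] \<in> ?R" for c
  proof -
    have "nested v (Const c) \<in> ?R" "nested v (Var v) \<in> ?R" "nested v (Var (v + 1)) \<in> ?R"
      "nested v (Var (v + 2)) \<in> ?R" by blast+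
    then show "[:[:[:c:]:]:] \<in> ?R" "[:0, 1:] \<in> ?R" "[:[:0, 1:]:] \<in> ?R" "[:[:[:0, 1:]:]:] \<in> ?R"
      by (simp_all add: nested_Var)
  qed
  have 0: "0 \<in> ?R" using N.hom_zero by (metis rangeI)
  have 1: "[:[:p:]:] \<in> ?R" for p
  proof (induction p rule: pCons_induct)
    case (pCons a p)
    from add[OF gen(1)[of a] mult[OF gen(4) pCons.IH]] show ?case by simp
  qed (simp add: 0)
  have 2: "[:p:] \<in> ?R" for p
  proof (induction p rule: pCons_induct)
    case (pCons a p)
    from add[OF 1[of a] mult[OF gen(3) pCons.IH]] show ?case by simp
  qed (simp add: 0)
  have "p \<in> ?R" for p
  proof (induction p rule: pCons_induct)
    case (pCons a p)
    from add[OF 2[of a] mult[OF gen(2) pCons.IH]] show ?case by simp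
  qed (simp add: 0)
  then show ?thesis by blast
qed

lemma nested_dvd_iff: "nested v p dvd nested v q \<longleftrightarrow> p dvd q"
proof -
  interpret N: comm_ring_hom "nested v :: (3, 'a) mpoly \<Rightarrow> _" by (rule nested_hom)
  show ?thesis
  proof
    assume "nested v p dvd nested v q"
    then obtain r where r: "nested v q = nested v p * r" by (elim dvdE)
    obtain s where "r = nested v s" using surj_nested by (metis surjD)
    then have "nested v q = nested v (p * s)" using r by (simp add: N.hom_mult)
    then show "p dvd q" using injD[OF inj_nested] by (metis dvd_triv_left)
  qed (auto simp: N.hom_mult elim!: dvdE)
qed

lemma prime_elem_nested:
  fixes r :: "(3, 'k::idom) mpoly"
  shows "prime_elem (nested v r) \<longleftrightarrow> prime_elem r"
proof -
  interpret N: comm_ring_hom "nested v :: (3, 'k) mpoly \<Rightarrow> _" by (rule nested_hom)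
  have "nested v r = 0 \<longleftrightarrow> r = 0" using injD[OF inj_nested, of v r 0] by auto
  moreover have "nested v r dvd 1 \<longleftrightarrow> r dvd 1" using nested_dvd_iff[of v r 1] by simp
  moreover have "(\<forall>a b. nested v r dvd a * b \<longrightarrow> nested v r dvd a \<or> nested v r dvd b)
    \<longleftrightarrow> (\<forall>a b. nested v r dvd nested v a * nested v b \<longrightarrow> nested v r dvd nested v a \<or> nested v r dvd nested v b)"
    using surj_nested[of v] by (metis surjD)
  ultimately show ?thesis
    unfolding prime_elem_def by (simp add: nested_dvd_iff flip: N.hom_mult)
qed

text \<open>
  Polynomial rings over factorial rings are factorial; this transports prime factorization along the
  isomorphism with iterated univariate polynomials.
\<close>

lemma mpoly_prime_induct [consumes 1, case_names unit prime]:
  fixes p :: "(3, 'k::field) mpoly"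
  assumes p: "p \<noteq> 0" and unit: "\<And>u. u dvd 1 \<Longrightarrow> Q u"
    and prime: "\<And>r p. prime_elem r \<Longrightarrow> Q p \<Longrightarrow> Q (r * p)"
  shows "Q p"
proof -
  interpret N: comm_ring_hom "nested 1 :: (3, 'k) mpoly \<Rightarrow> _" by (rule nested_hom)
  have prod: "\<forall>p. nested 1 p = prod_mset F \<longrightarrow> Q p" if "\<forall>g. g \<in># F \<longrightarrow> prime_elem g" for F
    using that
  proof (induction F)
    case empty
    show ?case
    proof (intro allI impI)
      fix p :: "(3, 'k) mpoly" assume "nested 1 p = prod_mset {#}"
      then have "p = 1" using injD[OF inj_nested, of 1 p 1] by simp
      then show "Q p" using unit[of 1] by simp
    qed
  next
    case (add g F)
    show ?case
    proof (intro allI impI)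
      fix p :: "(3, 'k) mpoly" assume p: "nested 1 p = prod_mset (add_mset g F)"
      obtain r q where rq: "nested 1 r = g" "nested 1 q = prod_mset F" using surj_nested by (metis surjD)
      then have "nested 1 p = nested 1 (r * q)" using p by (simp add: N.hom_mult)
      then have "p = r * q" using injD[OF inj_nested] by blast
      moreover have "prime_elem r" using add.prems rq(1) prime_elem_nested[of 1 r] by simp
      moreover have "Q q" using add.IH add.prems rq(2) by simp
      ultimately show "Q p" using prime by simp
    qed
  qed
  show ?thesis
  proof (cases "p dvd 1")
    case False
    have "nested 1 p \<noteq> 0" using p injD[OF inj_nested, of 1 p 0] by auto
    moreover have "\<not> nested 1 p dvd 1" using False nested_dvd_iff[of 1 p 1] by simp
    ultimately obtain F where "mset_factors F (nested 1 p)" using mset_factors_exist by blast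
    then have F: "\<forall>g. g \<in># F \<longrightarrow> prime_elem g" "nested 1 p = prod_mset F"
      by (auto simp: mset_factors_def)
    show ?thesis by (rule prod[OF F(1), rule_format, OF F(2)])
  qed (rule unit)
qed

section \<open>Derivatives and homogeneous components\<close>

lemma lookup_partial_deriv:
  fixes p :: "('v, 'a::comm_ring_1) mpoly"
  shows "lookup (partial_deriv v p) m = of_nat (Suc (lookup m v)) * lookup p (m + single v 1)"
proof -
  have "lookup (partial_deriv v p) m
    = (\<Sum>n\<in>keys p. if n - single v 1 = m then of_nat (lookup n v) * lookup p n else 0)"
    by (simp add: partial_deriv_def lookup_sum lookup_single when_def)
  also have "\<dots> = (\<Sum>n\<in>keys p. if n = m + single v 1 then of_nat (lookup n v) * lookup p n else 0)"
  proof (rule sum.cong[OF refl])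
    fix n
    show "(if n - single v 1 = m then of_nat (lookup n v) * lookup p n else 0)
      = (if n = m + single v 1 then of_nat (lookup n v) * lookup p n else 0)"
    proof (cases "lookup n v = 0")
      case False
      then obtain l where "n = single v 1 + l" using mpoly_cases_exponent[of 1 n v] by auto
      then show ?thesis by (auto simp: add.commute)
    qed simp
  qed
  also have "\<dots> = of_nat (Suc (lookup m v)) * lookup p (m + single v 1)"
    by (simp add: lookup_add in_keys_iff)
  finally show ?thesis .
qed

lemma nested_partial_deriv: "nested v (partial_deriv v p) = pderiv (nested v p)"
proof (intro poly_eqI)
  fix i j k
  have "exponent v i j k + single v 1 = exponent v (Suc i) j k"
    by (rule exponent_eqI[of v]) (auto simp: lookup_add lookup_single)
  then show "coeff (coeff (coeff (nested v (partial_deriv v p)) i) j) k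
    = coeff (coeff (coeff (pderiv (nested v p)) i) j) k"
    by (simp add: coeff_nested lookup_partial_deriv coeff_pderiv of_nat_poly)
qed

lemma partial_deriv_mult:
  fixes p q :: "(3, 'k::idom) mpoly"
  shows "partial_deriv v (p * q) = p * partial_deriv v q + q * partial_deriv v p"
proof -
  interpret N: comm_ring_hom "nested v :: (3, 'k) mpoly \<Rightarrow> _" by (rule nested_hom)
  show ?thesis
    by (rule injD[OF inj_nested[of v]]) (simp add: nested_partial_deriv N.hom_mult N.hom_add pderiv_mult)
qed

lemma homogeneous_partial_deriv:
  "homogeneous d f \<Longrightarrow> homogeneous (d - 1) (partial_deriv v f)"
  for f :: "('v, 'a::comm_ring_1) mpoly"
  unfolding homogeneous_def
proof
  fix m assume d: "\<forall>m\<in>keys f. mdeg m = d" and "m \<in> keys (partial_deriv v f)"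
  then have "m + single v 1 \<in> keys f" by (auto simp: in_keys_iff lookup_partial_deriv)
  then have "mdeg (m + single v 1) = d" using d by blast
  then show "mdeg m = d - 1" by (simp add: mdeg_add)
qed

lemma Euler_identity:
  fixes f :: "('v::finite, 'a::comm_ring_1) mpoly"
  assumes "homogeneous d f"
  shows "(\<Sum>i\<in>UNIV. Var i * partial_deriv i f) = of_nat d * f"
proof (rule poly_mapping_eqI)
  fix m
  have "lookup (Var i * partial_deriv i f) m = of_nat (lookup m i) * lookup f m" for i
  proof (cases "0 < lookup m i")
    case True
    then obtain l where "m = single i 1 + l" using mpoly_cases_exponent[of 1 m i] by auto
    then show ?thesis by (simp add: lookup_Var_mult lookup_partial_deriv lookup_add add.commute)
  qed (simp add: lookup_Var_mult)
  then have "lookup (\<Sum>i\<in>UNIV. Var i * partial_deriv i f) m = of_nat (mdeg m) * lookup f m"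
    by (simp add: lookup_sum mdeg_UNIV sum_distrib_right)
  also have "\<dots> = of_nat d * lookup f m"
    using assms by (cases "m \<in> keys f") (auto simp: homogeneous_def in_keys_iff)
  also have "\<dots> = lookup (of_nat d * f) m"
    by (metis Const.hom_of_nat lookup_Const_mult)
  finally show "lookup (\<Sum>i\<in>UNIV. Var i * partial_deriv i f) m = lookup (of_nat d * f) m" .
qed

lemma hom_component_add: "hom_component n (p + q) = hom_component n p + hom_component n q"
  by (rule poly_mapping_eqI) (simp add: lookup_add)

lemma hom_component_zero [simp]: "hom_component n 0 = 0"
  by (rule poly_mapping_eqI) simp

lemma hom_component_sum: "hom_component n (sum g A) = (\<Sum>i\<in>A. hom_component n (g i))"
  by (induction A rule: infinite_finite_induct) (simp_all add: hom_component_add)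

lemma hom_component_homogeneous:
  "homogeneous e p \<Longrightarrow> hom_component n p = (if n = e then p else 0)"
  by (rule poly_mapping_eqI) (auto simp: homogeneous_def in_keys_iff)

lemma homogeneous_mult:
  fixes p q :: "('v, 'a::comm_ring_1) mpoly"
  assumes "homogeneous a p" "homogeneous b q" shows "homogeneous (a + b) (p * q)"
  unfolding homogeneous_def
proof
  fix m assume "m \<in> keys (p * q)"
  then obtain k l where "m = k + l" "k \<in> keys p" "l \<in> keys q" using keys_mult by blast
  then show "mdeg m = a + b" using assms by (simp add: homogeneous_def mdeg_add)
qed

lemma hom_component_mult_homogeneous:
  fixes p q :: "('v, 'a::comm_ring_1) mpoly"
  assumes q: "homogeneous e q"
  shows "hom_component n (p * q) = (if e \<le> n then hom_component (n - e) p * q else 0)"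
proof -
  let ?A = "mdeg ` keys p"
  have "hom_component n (p * q) = hom_component n (\<Sum>j\<in>?A. hom_component j p * q)"
    using sum_hom_components[of p] by (simp flip: sum_distrib_right)
  also have "\<dots> = (\<Sum>j\<in>?A. if n = j + e then hom_component j p * q else 0)"
    unfolding hom_component_sum
    using hom_component_homogeneous[OF homogeneous_mult[OF homogeneous_hom_component q]]
    by (intro sum.cong refl) blast
  also have "\<dots> = (\<Sum>j\<in>?A. if j = n - e then (if e \<le> n then hom_component j p * q else 0) else 0)"
    by (intro sum.cong refl) auto
  also have "\<dots> = (if e \<le> n then hom_component (n - e) p * q else 0)"
  proof (cases "n - e \<in> ?A")
    case False
    then have "lookup p k = 0" if "mdeg k = n - e" for k
      using that by (metis image_eqI in_keys_iff)
    then have "hom_component (n - e) p = 0"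
      by (intro poly_mapping_eqI) simp
    then show ?thesis using False by simp
  qed simp
  finally show ?thesis .
qed

section \<open>Squarefree forms\<close>

lemma not_squarefree_0: "\<not> squarefree (0 :: 'a::comm_semiring_1)"
proof
  assume "squarefree (0 :: 'a)"
  then have "(0::'a) ^ 2 dvd 0 \<longrightarrow> (0::'a) dvd 1" unfolding squarefree_def by blast
  then show False by simp
qed

lemma unit_Const: "c \<noteq> 0 \<Longrightarrow> Const c dvd (1 :: ('v, 'k::field) mpoly)"
  by (metis Const.hom_mult Const.hom_one dvd_triv_left right_inverse)

lemma prime_dvd_pderiv_imp_const:
  fixes p :: "'a::{idom, ring_char_0} poly"
  assumes "p dvd pderiv p" shows "pderiv p = 0"
proof (rule ccontr)
  assume nz: "pderiv p \<noteq> 0"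
  then have "degree p \<le> degree (pderiv p)" using assms by (simp add: dvd_imp_degree_le)
  then have "degree p = 0" by (simp add: degree_pderiv)
  then show False using nz by (simp add: pderiv_eq_0_iff)
qed

text \<open>
  If \<open>f = r h\<close>, then \<open>r\<close> divides \<open>h \<cdot> \<partial>\<^sub>v r\<close> by the product rule.
\<close>

lemma prime_square_dvd:
  fixes f :: "(3, 'k::idom) mpoly"
  assumes r: "prime_elem r" and f: "r dvd f" "r dvd partial_deriv v f" and nd: "\<not> r dvd partial_deriv v r"
  shows "r ^ 2 dvd f"
proof -
  obtain h where h: "f = r * h" using f(1) by (elim dvdE)
  have "r dvd h * partial_deriv v r"
    using f(2) unfolding h partial_deriv_mult by (metis dvd_add_right_iff dvd_triv_left)
  then have "r dvd h" using r nd by (simp add: prime_elem_dvd_mult_iff)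
  then show ?thesis unfolding h power2_eq_square by (rule mult_dvd_mono[OF dvd_refl])
qed

lemma dvd_of_dvd_partial_derivs:
  fixes f :: "(3, 'k::field_char_0) mpoly"
  assumes f: "homogeneous d f" "0 < d" and r: "\<And>i. r dvd partial_deriv i f"
  shows "r dvd f"
proof -
  have "r dvd of_nat d * f"
    unfolding Euler_identity[OF f(1), symmetric] by (intro dvd_sum dvd_mult r)
  then have "r dvd Const (inverse (of_nat d)) * (Const (of_nat d) * f)"
    by (simp add: Const.hom_of_nat)
  moreover have "Const (inverse (of_nat d)) * (Const (of_nat d) * f) = f"
    using f(2) by (simp flip: mult.assoc Const.hom_mult)
  ultimately show ?thesis by simp
qed

text \<open>
  By Euler's identity such a prime \<open>r\<close> would divide \<open>f\<close>, and as its square does not, \<open>r\<close> would divide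
  each of its own derivatives.  These have smaller degree in the variable concerned, so in
  characteristic zero \<open>r\<close> would be a constant.
\<close>

lemma prime_not_dvd_partial_derivs:
  fixes f :: "(3, 'k::field_char_0) mpoly"
  assumes f: "homogeneous d f" "0 < d" "squarefree f" and r: "prime_elem r"
  shows "\<exists>i. \<not> r dvd partial_deriv i f"
proof (rule ccontr)
  assume "\<not> ?thesis"
  then have rf: "r dvd partial_deriv i f" for i by blast
  have "\<not> r ^ 2 dvd f" using f(3) r by (auto simp: squarefree_def prime_elem_def)
  then have "r dvd partial_deriv i r" for i
    using prime_square_dvd[OF r dvd_of_dvd_partial_derivs[OF f(1,2) rf] rf] by blast
  then have "nested i r dvd pderiv (nested i r)" for i
    by (simp add: nested_dvd_iff flip: nested_partial_deriv)
  then have "pderiv (nested i r) = 0" for i by (rule prime_dvd_pderiv_imp_const)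
  then have "nested i (partial_deriv i r) = nested i 0" for i
    by (simp add: nested_partial_deriv)
  then have deriv0: "partial_deriv i r = 0" for i using injD[OF inj_nested] by blast
  have "lookup r m = 0" if m: "m \<noteq> 0" for m
  proof -
    obtain i where "0 < lookup m i" using m by (metis gr_zeroI lookup_zero poly_mapping_eqI)
    then obtain l where l: "m = single i 1 + l" using mpoly_cases_exponent[of 1 m i] by auto
    have "of_nat (Suc (lookup l i)) * lookup r m = 0"
      using lookup_partial_deriv[of i r l] deriv0[of i] l by (simp add: add.commute)
    then show ?thesis by (metis mult_eq_0_iff nat.distinct(1) of_nat_eq_0_iff)
  qed
  then have "r = Const (lookup r 0)"
    by (intro poly_mapping_eqI) (auto simp: Const_def lookup_single when_def)
  moreover from this have "lookup r 0 \<noteq> 0" using r by (metis Const.hom_zero prime_elem_def)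
  ultimately have "r dvd 1" using unit_Const by metis
  then show False using r by (simp add: prime_elem_def)
qed

lemma no_common_divisor_partial_derivs:
  fixes f :: "(3, 'k::field_char_0) mpoly"
  assumes f: "homogeneous d f" "0 < d" "squarefree f"
  shows "no_common_divisor (\<lambda>i. partial_deriv i f)"
  unfolding no_common_divisor_def
proof (intro allI impI)
  fix e s assume dvd: "\<forall>i. e dvd s * partial_deriv i f"
  show "e dvd s"
  proof (cases "e = 0")
    case False
    then show ?thesis using dvd
    proof (induction e arbitrary: s rule: mpoly_prime_induct)
      case (unit u)
      then show ?case using dvd_trans one_dvd by blast
    next
      case (prime r e)
      obtain i where "\<not> r dvd partial_deriv i f"
        using prime_not_dvd_partial_derivs[OF f prime.hyps] by blast
      moreover have "r dvd s * partial_deriv i f" using prime.prems dvd_mult_left by blast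
      ultimately have "r dvd s" using prime_elem_dvd_multD[OF prime.hyps] by metis
      then obtain t where t: "s = r * t" by (elim dvdE)
      have "r \<noteq> 0" using prime.hyps by (simp add: prime_elem_def)
      have "\<forall>i. e dvd t * partial_deriv i f"
      proof
        fix i
        have "r * e dvd r * (t * partial_deriv i f)"
          using spec[OF prime.prems, of i] unfolding t by (simp only: mult.assoc)
        then show "e dvd t * partial_deriv i f" using \<open>r \<noteq> 0\<close> by (metis dvd_times_left_cancel_iff)
      qed
      from prime.IH[OF this] show ?case unfolding t by (rule mult_dvd_mono[OF dvd_refl])
    qed
  next
    case True
    have "\<not> 0 dvd f" using f(3) not_squarefree_0 by auto
    then obtain i where "partial_deriv i f \<noteq> 0"
      using dvd_of_dvd_partial_derivs[OF f(1,2), of 0] by auto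
    then show ?thesis using dvd True by (metis dvd_0_left_iff mult_eq_0_iff)
  qed
qed

section \<open>Elimination of a variable\<close>

text \<open>
  Pseudo-division shows that a nonzero element \<open>g\<close> of minimal degree in the ideal \<open>(p, q)\<close> divides
  \<open>p\<close> and \<open>q\<close> up to constants of the coefficient ring.  If \<open>g\<close> is not itself such a constant, it has
  a prime factor of positive degree, and this cannot divide the constants.
\<close>

lemma common_prime_or_Bezout:
  fixes p q :: "'a::ufd poly"
  assumes "p \<noteq> 0"
  shows "(\<exists>r. prime_elem r \<and> degree r > 0 \<and> r dvd p \<and> r dvd q) \<or> (\<exists>a b c. c \<noteq> 0 \<and> a * p + b * q = [:c:])"
proof -
  define J where "J = {a * p + b * q | a b. True}"
  have J_diff: "smult c x - g * y \<in> J" if xg: "x \<in> J" "g \<in> J" for x g y c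
  proof -
    obtain a b a' b' where "x = a * p + b * q" "g = a' * p + b' * q" using xg unfolding J_def by blast
    then have "smult c x - g * y = (smult c a - a' * y) * p + (smult c b - b' * y) * q"
      by (simp add: algebra_simps smult_add_right)
    then show ?thesis unfolding J_def by blast
  qed
  have pJ: "p \<in> J" "q \<in> J" unfolding J_def by (force intro: exI[of _ 1] exI[of _ 0])+
  obtain g where g: "g \<in> J" "g \<noteq> 0" and min: "\<And>x. x \<in> J \<Longrightarrow> x \<noteq> 0 \<Longrightarrow> degree g \<le> degree x"
    using ex_has_least_nat[of "\<lambda>x. x \<in> J \<and> x \<noteq> 0" p degree] pJ(1) assms by blast
  have g_dvd: "\<exists>c. c \<noteq> 0 \<and> g dvd smult c x" if "x \<in> J" for x
  proof -
    obtain c y where c: "c \<noteq> 0" "smult c x = g * y + pseudo_mod x g"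
      using pseudo_mod(1)[OF g(2), of x] by blast
    then have "pseudo_mod x g = smult c x - g * y" by simp
    then have "pseudo_mod x g \<in> J" using J_diff[OF that g(1)] by metis
    then have "pseudo_mod x g = 0" using min pseudo_mod(2)[OF g(2), of x] by force
    then show ?thesis using c by (metis add.right_neutral dvd_triv_left)
  qed
  show ?thesis
  proof (cases "degree g = 0")
    case True
    then obtain c where "g = [:c:]" by (metis degree_eq_zeroE)
    moreover obtain a b where "g = a * p + b * q" using g(1) unfolding J_def by blast
    ultimately have "c \<noteq> 0 \<and> a * p + b * q = [:c:]" using g(2) by auto
    then show ?thesis by (intro disjI2 exI)
  next
    case False
    then have "\<not> g dvd 1" using g(2) by (metis degree_1 dvd_imp_degree_le le_zero_eq one_neq_zero)
    then obtain F where F: "mset_factors F g" using mset_factors_exist g(2) by blast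
    have "\<exists>r. r \<in># F \<and> degree r > 0"
    proof (rule ccontr)
      assume "\<not> ?thesis"
      then have "degree (prod_mset F) = 0"
      proof (induction F)
        case (add r F)
        have "degree r = 0" "degree (prod_mset F) = 0" using add by auto
        then show ?case using degree_mult_le[of r "prod_mset F"] by simp
      qed simp
      then show False using F False by (simp add: mset_factors_def)
    qed
    then obtain r where r: "r \<in># F" "degree r > 0" by blast
    then have pr: "prime_elem r" and rg: "r dvd g" using F by (auto simp: mset_factors_def dvd_prod_mset)
    have rJ: "r dvd x" if xJ: "x \<in> J" for x
    proof -
      obtain c where c: "c \<noteq> 0" "g dvd smult c x" using g_dvd[OF xJ] by blast
      then have "r dvd [:c:] * x" using rg by (auto intro: dvd_trans)
      moreover have "\<not> r dvd [:c:]"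
        using r(2) c(1) by (metis degree_pCons_0 dvd_imp_degree_le less_le_not_le pCons_eq_0_iff)
      ultimately show ?thesis using prime_elem_dvd_multD[OF pr] by metis
    qed
    show ?thesis by (intro disjI1 exI[of _ r] conjI pr r(2) rJ pJ)
  qed
qed

text \<open>
  A common prime factor of \<open>f\<close> and \<open>\<partial>\<^sub>v f\<close> of positive degree in \<open>v\<close> would have its square
  dividing \<open>f\<close>.  So some combination of \<open>f\<close> and \<open>\<partial>\<^sub>v f\<close> is nonzero and free of \<open>v\<close>; by Euler's
  identity it is a combination of the derivatives, and one takes a homogeneous component.
\<close>

theorem elimination:
  fixes f :: "(3, 'k::field_char_0) mpoly"
  assumes f: "homogeneous d f" "0 < d" "squarefree f"
  shows "\<exists>n c. (\<exists>i\<le>n. c i \<noteq> 0) \<and>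
    (\<exists>s. binary_form (\<lambda>i. Const (c i)) (Var (v + 1)) (Var (v + 2)) n = (\<Sum>i\<in>UNIV. s i * partial_deriv i f))"
proof -
  interpret N: comm_ring_hom "nested v :: (3, 'k) mpoly \<Rightarrow> _" by (rule nested_hom)
  have "f \<noteq> 0" using f(3) not_squarefree_0 by blast
  then have nz: "nested v f \<noteq> 0" using injD[OF inj_nested, of v f 0] by auto
  have "\<not> (\<exists>r. prime_elem r \<and> degree r > 0 \<and> r dvd nested v f \<and> r dvd pderiv (nested v f))"
  proof (intro notI, elim exE conjE)
    fix r' assume r': "prime_elem r'" "degree r' > 0" "r' dvd nested v f" "r' dvd pderiv (nested v f)"
    obtain r where r: "r' = nested v r" using surj_nested by (metis surjD)
    have pr: "prime_elem r" using r'(1) by (simp only: r prime_elem_nested)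
    have "r dvd f" "r dvd partial_deriv v f"
      using r'(3,4) by (simp_all add: r nested_dvd_iff flip: nested_partial_deriv)
    moreover have "\<not> r dvd partial_deriv v r"
    proof
      assume "r dvd partial_deriv v r"
      then have "r' dvd pderiv r'" by (simp add: r nested_dvd_iff flip: nested_partial_deriv)
      then have "pderiv r' = 0" by (rule prime_dvd_pderiv_imp_const)
      then show False using r'(2) by (simp add: pderiv_eq_0_iff)
    qed
    ultimately have "r ^ 2 dvd f" by (rule prime_square_dvd[OF pr])
    then show False using f(3) pr by (auto simp: squarefree_def prime_elem_def)
  qed
  then obtain a' b' c where c: "c \<noteq> 0" "a' * nested v f + b' * pderiv (nested v f) = [:c:]"
    using common_prime_or_Bezout[OF nz, of "pderiv (nested v f)"] by blast
  obtain a b where ab: "a' = nested v a" "b' = nested v b" using surj_nested by (metis surjD)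
  define g where "g = a * f + b * partial_deriv v f"
  have ng: "nested v g = [:c:]" using c(2) by (simp add: g_def ab N.hom_add N.hom_mult nested_partial_deriv)
  have g0: "lookup g m = 0" if "lookup m v \<noteq> 0" for m
  proof -
    have "lookup g m = coeff (coeff (coeff (nested v g) (lookup m v)) (lookup m (v + 1))) (lookup m (v + 2))"
      by (simp add: coeff_nested exponent_lookup)
    then show ?thesis using that by (simp add: ng coeff_pCons split: nat.splits)
  qed
  have "g \<noteq> 0" using ng c(1) by auto
  then obtain m0 where m0: "lookup g m0 \<noteq> 0" by (metis lookup_zero poly_mapping_eqI)
  define n where "n = mdeg m0"
  define h where "h = hom_component n g"
  define w where "w i = exponent v 0 i (n - i)" for i
  have f_eq: "f = Const (inverse (of_nat d)) * (\<Sum>i\<in>UNIV. Var i * partial_deriv i f)"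
    unfolding Euler_identity[OF f(1)] using f(2)
    by (simp flip: mult.assoc Const.hom_mult Const.hom_of_nat)
  have "a * f = (\<Sum>i\<in>UNIV. a * Const (inverse (of_nat d)) * Var i * partial_deriv i f)"
    using arg_cong[OF f_eq, of "\<lambda>x. a * x"] by (simp only: sum_distrib_left mult.assoc)
  then have "g = (\<Sum>i\<in>UNIV. (a * Const (inverse (of_nat d)) * Var i + (if i = v then b else 0)) * partial_deriv i f)"
    unfolding g_def
    by (simp add: distrib_right sum.distrib if_distrib[of "\<lambda>x. x * _"] cong: if_cong)
  then obtain s where s: "g = (\<Sum>i\<in>UNIV. s i * partial_deriv i f)" by (rule that)
  have h1: "h = (\<Sum>i\<in>UNIV. (if d - 1 \<le> n then hom_component (n - (d - 1)) (s i) else 0) * partial_deriv i f)"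
    unfolding h_def s hom_component_sum
    by (intro sum.cong refl) (simp add: hom_component_mult_homogeneous[OF homogeneous_partial_deriv[OF f(1)]])
  have h2: "h = binary_form (\<lambda>i. Const (lookup g (w i))) (Var (v + 1)) (Var (v + 2)) n"
  proof -
    have wi: "mdeg (w i) = n" if "i \<le> n" for i
      using that by (simp add: w_def exponent_def mdeg_add)
    have "inj_on w {..n}"
      by (rule inj_onI) (metis w_def lookup_exponent(2))
    have "keys h \<subseteq> w ` {..n}"
    proof
      fix m assume m: "m \<in> keys h"
      then have mn: "mdeg m = n" "lookup m v = 0" using g0[of m] by (auto simp: h_def in_keys_iff split: if_splits)
      have "mdeg m = lookup m v + lookup m (v + 1) + lookup m (v + 2)"
        unfolding mdeg_UNIV UNIV_3_shift[of v] by simp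
      then have "m = w (lookup m (v + 1))" "lookup m (v + 1) \<le> n"
        using mn by (auto simp: w_def eq_exponent_iff)
      then show "m \<in> w ` {..n}" by blast
    qed
    then have "h = (\<Sum>m\<in>w ` {..n}. single m (lookup h m))"
      using mpoly_eq_sum_single[of h]
      by (subst mpoly_eq_sum_single, intro sum.mono_neutral_left) (auto simp: in_keys_iff)
    also have "\<dots> = (\<Sum>i\<le>n. single (w i) (lookup h (w i)))"
      by (simp add: sum.reindex[OF \<open>inj_on w {..n}\<close>])
    also have "\<dots> = (\<Sum>i\<le>n. Const (lookup g (w i)) * Var (v + 1) ^ i * Var (v + 2) ^ (n - i))"
    proof (rule sum.cong[OF refl])
      fix i assume "i \<in> {..n}"
      then have "lookup h (w i) = lookup g (w i)" by (simp add: h_def wi)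
      then show "single (w i) (lookup h (w i)) = Const (lookup g (w i)) * Var (v + 1) ^ i * Var (v + 2) ^ (n - i)"
        by (simp add: Const_def Var_power mult_single w_def exponent_def)
    qed
    finally show ?thesis unfolding binary_form_def .
  qed
  have h3: "\<exists>i\<le>n. lookup g (w i) \<noteq> 0"
  proof -
    have mv: "lookup m0 v = 0" using g0 m0 by blast
    have "n = lookup m0 v + lookup m0 (v + 1) + lookup m0 (v + 2)"
      unfolding n_def mdeg_UNIV UNIV_3_shift[of v] by simp
    then have "w (lookup m0 (v + 1)) = m0" "lookup m0 (v + 1) \<le> n"
      using mv exponent_lookup[of v m0] by (auto simp: w_def)
    then show ?thesis using m0 by metis
  qed
  show ?thesis
    by (rule exI[of _ n], rule exI[of _ "\<lambda>i. lookup g (w i)"], rule conjI[OF h3], rule exI,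
        rule trans[OF h2[symmetric] h1])
qed

section \<open>Local generation by two elements\<close>

lemma prime_power_dvd_left:
  fixes Y :: "'a::idom"
  assumes Y: "prime_elem Y" "\<not> Y dvd h" and "Y ^ e * z = b * h"
  shows "\<exists>b'. z = b' * h"
  using assms(3)
proof (induction e arbitrary: b)
  case (Suc e)
  have "Y dvd b * h" using Suc.prems by (metis dvd_mult_left dvd_triv_left power_Suc)
  then have "Y dvd b" using prime_elem_dvd_multD[OF Y(1)] Y(2) by metis
  then obtain b' where b: "b = Y * b'" by (elim dvdE)
  have "Y * (Y ^ e * z) = Y * (b' * h)" using Suc.prems unfolding b by (simp only: power_Suc mult.assoc)
  moreover have "Y \<noteq> 0" using Y(1) by (simp add: prime_elem_def)
  ultimately have "Y ^ e * z = b' * h" by (metis mult_left_cancel)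
  then show ?case by (rule Suc.IH)
qed auto

text \<open>
  The kernel \<open>(W, Y)\<close> of \<open>\<epsilon>\<close> is the prime ideal of a point, and \<open>F\<^sub>u\<close> has a nonzero linear part
  there.  Modulo \<open>F\<^sub>u\<close> one may replace \<open>U W\<close> by \<open>-V Y\<close>, so \<open>Y\<close> is a uniformizer of the curve
  \<open>F\<^sub>u = 0\<close>.  Up to the unit \<open>U\<close>, powers of \<open>Y\<close> can be taken out of the two remaining
  generators until one of the quotients does not vanish at the point; then that generator divides the
  other one, which is the desired syzygy.  The element \<open>r\<close>, of finite order along the curve, makes the process stop.
\<close>

theorem local_syzygy:
  fixes W Y :: "'a::idom" and \<epsilon> :: "'a \<Rightarrow> 'b::idom" and F :: "3 \<Rightarrow> 'a"
  assumes \<epsilon>: "comm_ring_hom \<epsilon>" and ker: "\<And>a. \<epsilon> a = 0 \<longleftrightarrow> (\<exists>b c. a = W * b + Y * c)"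
    and Y: "prime_elem Y" "\<not> Y dvd W"
    and Fu: "F u = U * W + V * Y" and U: "\<epsilon> U \<noteq> 0"
    and r: "(\<Sum>i\<in>UNIV. s i * F i) = Y ^ e * r0" "\<epsilon> r0 \<noteq> 0"
  shows "\<exists>g j. (\<Sum>i\<in>UNIV. g i * F i) = 0 \<and> \<epsilon> (g j) \<noteq> 0"
proof (rule ccontr)
  assume "\<not> ?thesis"
  then have none: "\<epsilon> (g j) = 0" if "(\<Sum>i\<in>UNIV. g i * F i) = 0" for g j using that by blast
  interpret \<epsilon>: comm_ring_hom \<epsilon> by (rule \<epsilon>)
  have \<epsilon>W: "\<epsilon> W = 0" unfolding ker by (intro exI[of _ 1] exI[of _ 0]) simp
  have \<epsilon>Y: "\<epsilon> Y = 0" unfolding ker by (intro exI[of _ 0] exI[of _ 1]) simp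
  (* The orders of all generators along the curve are at least n, for every n. *)
  have step: "\<forall>i. \<exists>a b. U ^ n * F i = Y ^ n * a + b * F u" for n
  proof (induction n)
    case 0
    show ?case by (intro allI exI[of _ "F _"] exI[of _ 0]) simp
  next
    case (Suc n)
    show ?case
    proof
      fix i
      show "\<exists>a b. U ^ Suc n * F i = Y ^ Suc n * a + b * F u"
      proof (cases "i = u")
        case True
        then show ?thesis by (intro exI[of _ 0] exI[of _ "U ^ Suc n"]) simp
      next
        case False
        obtain j where j: "j \<noteq> i" "j \<noteq> u"
        proof -
          have "(1::3) \<noteq> 2" "(1::3) \<noteq> 3" "(2::3) \<noteq> 3" by simp_all
          then show thesis using that exhaust_3[of i] exhaust_3[of u] False by metis
        qed
        have UNIV: "(UNIV :: 3 set) = {i, j, u}"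
          using exhaust_3[of i] exhaust_3[of j] exhaust_3[of u] j False by (auto simp: UNIV_3)
        from Suc.IH obtain ai bi where i: "U ^ n * F i = Y ^ n * ai + bi * F u" by metis
        from Suc.IH obtain aj bj where j': "U ^ n * F j = Y ^ n * aj + bj * F u" by metis
        (* If ai did not vanish at the point, then F i would divide F j there, modulo F u. *)
        define g where "g l = (if l = j then U ^ n * ai else if l = i then - (U ^ n * aj) else aj * bi - ai * bj)" for l
        have "(\<Sum>l\<in>UNIV. g l * F l) = ai * (U ^ n * F j) - aj * (U ^ n * F i) + (aj * bi - ai * bj) * F u"
          using j False by (simp add: UNIV g_def algebra_simps)
        also have "\<dots> = 0" unfolding i j' by (simp add: algebra_simps)
        finally have "\<epsilon> (g j) = 0" by (rule none)
        then have "\<epsilon> ai = 0" using U by (simp add: g_def \<epsilon>.hom_mult \<epsilon>.hom_power)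
        then obtain p q where pq: "ai = W * p + Y * q" unfolding ker by blast
        have UW: "U * W = F u - V * Y" by (simp add: Fu)
        have "U * ai = (U * W) * p + Y * (U * q)" unfolding pq by (simp add: algebra_simps)
        then have Ua: "U * ai = Y * (U * q - V * p) + p * F u" unfolding UW by (simp add: algebra_simps)
        have "U ^ Suc n * F i = U * (U ^ n * F i)" by (simp add: mult.assoc)
        also have "\<dots> = Y ^ n * (U * ai) + U * bi * F u" unfolding i by (simp add: algebra_simps)
        also have "\<dots> = Y ^ Suc n * (U * q - V * p) + (Y ^ n * p + U * bi) * F u"
          unfolding Ua by (simp add: algebra_simps)
        finally show ?thesis by blast
      qed
    qed
  qed
  from choice[OF step[of "Suc e"]] obtain a where
    "\<forall>i. \<exists>b. U ^ Suc e * F i = Y ^ Suc e * a i + b * F u" by blast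
  from choice[OF this] obtain b where ab: "\<And>i. U ^ Suc e * F i = Y ^ Suc e * a i + b i * F u" by blast
  (* Multiply r by a power of U; one more power of Y than r contains leads to a contradiction. *)
  define A B where "A = (\<Sum>i\<in>UNIV. s i * a i)" and "B = (\<Sum>i\<in>UNIV. s i * b i)"
  have "U ^ Suc e * (Y ^ e * r0) = (\<Sum>i\<in>UNIV. s i * (U ^ Suc e * F i))"
    unfolding r(1)[symmetric] by (simp add: sum_distrib_left mult_ac)
  also have "\<dots> = Y ^ Suc e * A + B * F u"
    unfolding ab A_def B_def by (simp add: sum_distrib_left sum_distrib_right sum.distrib algebra_simps)
  finally have "Y ^ e * (U ^ Suc e * r0 - Y * A) = B * F u" by (simp add: algebra_simps)
  moreover have "\<not> Y dvd F u"
  proof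
    assume "Y dvd F u"
    then have "Y dvd U * W" unfolding Fu by (metis dvd_add_left_iff dvd_triv_right)
    then have "Y dvd U" using prime_elem_dvd_multD[OF Y(1)] Y(2) by metis
    then have "\<epsilon> U = 0" using \<epsilon>Y by (auto simp: \<epsilon>.hom_mult elim!: dvdE)
    then show False using U by simp
  qed
  ultimately obtain B' where "U ^ Suc e * r0 - Y * A = B' * F u"
    using prime_power_dvd_left[OF Y(1)] by blast
  then have "\<epsilon> (U ^ Suc e * r0 - Y * A) = \<epsilon> (B' * F u)" by simp
  then have "\<epsilon> U ^ Suc e * \<epsilon> r0 = 0"
    by (simp add: Fu \<epsilon>.hom_minus \<epsilon>.hom_add \<epsilon>.hom_mult \<epsilon>.hom_power \<epsilon>W \<epsilon>Y)
  then show False using U r(2) by simp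
qed

section \<open>The line over a coordinate point\<close>

text \<open>
  The kernel of this map is the homogeneous prime ideal \<open>(x, y)\<close> of the point \<open>[0:0:1]\<close>; an element
  outside of it has a monomial that is a power of \<open>z\<close>.
\<close>

definition mod_xy :: "(3, 'k::comm_ring_1) mpoly \<Rightarrow> 'k poly" where
  "mod_xy = eval_hom (\<lambda>c. [:c:]) (\<lambda>i. if i = 3 then [:0, 1:] else 0)"

lemma mod_xy_hom: "comm_ring_hom mod_xy"
  unfolding mod_xy_def by (rule comm_ring_hom.eval_hom_comm_ring_hom[OF constant_poly_hom])

lemma mon_eval_3: "mon_eval x m = x 1 ^ lookup m 1 * x 2 ^ lookup m 2 * x 3 ^ lookup m (3::3)"
proof -
  have "mon_eval x m = (\<Prod>i\<in>UNIV. x i ^ lookup m i)" by (rule mon_eval_superset) auto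
  also have "\<dots> = x 1 ^ lookup m 1 * (x 2 ^ lookup m 2 * x 3 ^ lookup m 3)"
    unfolding UNIV_3 by simp
  finally show ?thesis by (simp only: mult.assoc)
qed

lemma exponent_3_eqI:
  "lookup m 1 = lookup n 1 \<Longrightarrow> lookup m 2 = lookup n 2 \<Longrightarrow> lookup m 3 = lookup n 3 \<Longrightarrow> m = n"
  for m n :: "3 \<Rightarrow>\<^sub>0 nat"
  by (rule poly_mapping_eqI) (metis exhaust_3)

lemma coeff_mod_xy: "coeff (mod_xy p) k = lookup p (single 3 k)"
proof (induction p rule: mpoly_induct)
  case (single m c)
  have "mod_xy (single m c) = [:c:] * mon_eval (\<lambda>i. if i = 3 then [:0, 1:] else 0) m"
    unfolding mod_xy_def by (rule eval_hom_single) simp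
  also have "\<dots> = (if lookup m 1 = 0 \<and> lookup m 2 = 0 then Polynomial.monom c (lookup m 3) else 0)"
    by (auto simp: mon_eval_3 power_0_left X_power smult_monom)
  finally have "mod_xy (single m c) = (if lookup m 1 = 0 \<and> lookup m 2 = 0 then Polynomial.monom c (lookup m 3) else 0)" .
  moreover have "m = single 3 k \<longleftrightarrow> lookup m 1 = 0 \<and> lookup m 2 = 0 \<and> lookup m 3 = k"
    by (auto intro!: exponent_3_eqI simp: lookup_single)
  ultimately show ?case by (auto simp: lookup_single when_def)
next
  case (add p q)
  interpret E: comm_ring_hom "mod_xy :: (3, 'a) mpoly \<Rightarrow> _" by (rule mod_xy_hom)
  show ?case using add by (simp add: E.hom_add lookup_add)
qed

lemma mod_xy_Var: "mod_xy (Var i) = (if i = 3 then [:0, 1:] else 0)"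
  unfolding mod_xy_def by (rule comm_ring_hom.eval_hom_Var[OF constant_poly_hom])

lemma mod_xy_Const: "mod_xy (Const c) = [:c:]"
  unfolding mod_xy_def by (rule comm_ring_hom.eval_hom_Const[OF constant_poly_hom])

lemma mod_xy_eq_0_iff:
  assumes vl: "{v, l} = {1, 2 :: 3}"
  shows "mod_xy a = 0 \<longleftrightarrow> (\<exists>b c. a = Var v * b + Var l * c)"
proof
  assume "mod_xy a = 0"
  then have a0: "lookup a (single 3 k) = 0" for k by (simp flip: coeff_mod_xy)
  have "lookup a m = 0" if m: "lookup m v < 1" "lookup m l < 1" for m
  proof -
    have "lookup m 1 = 0" "lookup m 2 = 0" using m vl by (auto simp: doubleton_eq_iff)
    then have "m = single 3 (lookup m 3)" by (intro exponent_3_eqI) (simp_all add: lookup_single)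
    then show ?thesis using a0 by metis
  qed
  then obtain b c where "a = Var v ^ 1 * b + Var l ^ 1 * c" by (rule in_ideal_two_Var_powers)
  then show "\<exists>b c. a = Var v * b + Var l * c" by auto
next
  interpret E: comm_ring_hom "mod_xy :: (3, 'a) mpoly \<Rightarrow> _" by (rule mod_xy_hom)
  have "v \<noteq> 3" "l \<noteq> 3" using vl by (auto simp: doubleton_eq_iff)
  then show "\<exists>b c. a = Var v * b + Var l * c \<Longrightarrow> mod_xy a = 0"
    by (auto simp: E.hom_add E.hom_mult mod_xy_Var)
qed

lemma prime_elem_Var: "prime_elem (Var v :: (3, 'k::idom) mpoly)"
proof -
  have X: "[:0, 1:] dvd p \<longleftrightarrow> poly p 0 = 0" for p :: "'k poly poly poly"
    using dvd_iff_poly_eq_0[of 0 p] by simp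
  have "prime_elem ([:0, 1:] :: 'k poly poly poly)"
    unfolding prime_elem_def X by simp
  then have "prime_elem (nested v (Var v :: (3, 'k) mpoly))" by (simp only: nested_Var if_True simp_thms)
  then show ?thesis by (simp only: prime_elem_nested)
qed

lemma Var_not_dvd_Var: "v \<noteq> l \<Longrightarrow> \<not> Var l dvd (Var v :: ('v, 'k::comm_ring_1) mpoly)"
proof
  assume "v \<noteq> l" "Var l dvd (Var v :: ('v, 'k) mpoly)"
  then have "lookup (Var v :: ('v, 'k) mpoly) (single v 1) = 0"
    using Var_power_dvd_iff[of l 1 "Var v :: ('v, 'k) mpoly"] by (simp add: lookup_single)
  then show False by (simp add: Var_def)
qed

lemma eval_at_hom: "comm_ring_hom (\<lambda>f. eval_at f p)"
  unfolding eval_at_def by (rule eval_id_hom)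

lemma eval_at_Const [simp]: "eval_at (Const c) p = c"
  by (simp add: eval_at_def)

lemma eval_at_Var [simp]: "eval_at (Var i) p = p $ i"
  by (simp add: eval_at_def)

lemma eval_at_e3:
  assumes "homogeneous k q" shows "eval_at q (axis 3 1) = lookup q (single 3 k)"
proof -
  have "eval_at q (axis 3 1) = (\<Sum>m\<in>keys q. lookup q m * mon_eval (\<lambda>i. axis 3 1 $ i) m)"
    by (simp add: eval_at_def eval_hom_def mon_eval_def)
  also have "\<dots> = (\<Sum>m\<in>keys q. if m = single 3 k then lookup q m else 0)"
  proof (rule sum.cong[OF refl])
    fix m assume "m \<in> keys q"
    then have "mdeg m = k" using assms by (simp add: homogeneous_def)
    then have m: "lookup m 1 + lookup m 2 + lookup m 3 = k" by (simp add: mdeg_UNIV sum_3)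
    have "mon_eval (\<lambda>i. axis 3 (1::'a) $ i) m = (if lookup m 1 = 0 \<and> lookup m 2 = 0 then 1 else 0)"
      by (simp add: mon_eval_3 axis_def power_0_left)
    moreover have "m = single 3 k \<longleftrightarrow> lookup m 1 = 0 \<and> lookup m 2 = 0"
    proof
      assume "m = single 3 k"
      then show "lookup m 1 = 0 \<and> lookup m 2 = 0" by (simp add: lookup_single)
    qed (use m in \<open>auto intro!: exponent_3_eqI simp: lookup_single\<close>)
    ultimately show "lookup q m * mon_eval (\<lambda>i. axis 3 1 $ i) m = (if m = single 3 k then lookup q m else 0)"
      by simp
  qed
  also have "\<dots> = lookup q (single 3 k)" by (simp add: in_keys_iff)
  finally show ?thesis .
qed

section \<open>Linear substitutions\<close>

lemma lin_subst_hom: "comm_ring_hom (lin_subst A)"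
  unfolding lin_subst_def by (rule Const.eval_hom_comm_ring_hom)

lemma lin_subst_Const [simp]: "lin_subst A (Const c) = Const c"
  by (simp add: lin_subst_def)

lemma lin_subst_Var: "lin_subst A (Var i) = (\<Sum>j\<in>UNIV. Const (A $ i $ j) * Var j)"
  by (simp add: lin_subst_def)

lemma lin_subst_comp: "lin_subst B (lin_subst A p) = lin_subst (A ** B) p"
proof (rule mpoly_hom_eqI[of "\<lambda>p. lin_subst B (lin_subst A p)" "lin_subst (A ** B)"])
  interpret B: comm_ring_hom "lin_subst B" by (rule lin_subst_hom)
  fix i
  have "lin_subst B (lin_subst A (Var i)) = (\<Sum>j\<in>UNIV. \<Sum>k\<in>UNIV. Const (A $ i $ j) * (Const (B $ j $ k) * Var k))"
    by (simp add: lin_subst_Var B.hom_sum B.hom_mult sum_distrib_left)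
  also have "\<dots> = (\<Sum>k\<in>UNIV. Const (\<Sum>j\<in>UNIV. A $ i $ j * B $ j $ k) * Var k)"
    by (subst sum.swap) (simp add: Const.hom_sum Const.hom_mult sum_distrib_right mult.assoc)
  finally show "lin_subst B (lin_subst A (Var i)) = lin_subst (A ** B) (Var i)"
    by (simp add: lin_subst_Var matrix_matrix_mult_def)
qed (auto intro: lin_subst_hom comm_ring_hom_comp)

lemma lin_subst_id: "lin_subst (Finite_Cartesian_Product.mat 1) p = p"
proof (rule mpoly_hom_eqI[of "lin_subst (Finite_Cartesian_Product.mat 1)" "\<lambda>p. p"])
  fix i
  show "lin_subst (Finite_Cartesian_Product.mat 1) (Var i) = Var i"
    by (simp add: lin_subst_Var Finite_Cartesian_Product.mat_def if_distrib[of Const] if_distrib[of "\<lambda>c. c * _"] cong: if_cong)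
qed (auto intro: lin_subst_hom comm_ring_hom_id)

lemma eval_at_lin_subst: "eval_at (lin_subst A q) p = eval_at q (A *v p)"
proof (rule mpoly_hom_eqI[of "\<lambda>q. eval_at (lin_subst A q) p" "\<lambda>q. eval_at q (A *v p)"])
  interpret E: comm_ring_hom "\<lambda>q. eval_at q p" by (rule eval_at_hom)
  fix i
  show "eval_at (lin_subst A (Var i)) p = eval_at (Var i) (A *v p)"
    by (simp add: lin_subst_Var E.hom_sum E.hom_mult matrix_vector_mult_def)
qed (auto intro: comm_ring_hom_comp[OF eval_at_hom lin_subst_hom] eval_at_hom)

lemma partial_deriv_add: "partial_deriv i (p + q) = partial_deriv i p + partial_deriv i q"
  for p q :: "('v, 'a::comm_ring_1) mpoly"
  by (rule poly_mapping_eqI) (simp add: lookup_partial_deriv lookup_add algebra_simps)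

lemma partial_deriv_sum: "partial_deriv i (sum g A) = (\<Sum>j\<in>A. partial_deriv i (g j))"
  for g :: "'b \<Rightarrow> ('v, 'a::comm_ring_1) mpoly"
proof (induction A rule: infinite_finite_induct)
  have "partial_deriv i (0 :: ('v, 'a) mpoly) = 0" by (simp add: partial_deriv_def)
  then show "\<And>A. infinite A \<Longrightarrow> partial_deriv i (sum g A) = (\<Sum>j\<in>A. partial_deriv i (g j))"
    "partial_deriv i (sum g {}) = (\<Sum>j\<in>{}. partial_deriv i (g j))" by simp_all
qed (simp add: partial_deriv_add)

lemma partial_deriv_Const_mult: "partial_deriv i (Const c * p) = Const c * partial_deriv i p"
  for p :: "('v, 'a::comm_ring_1) mpoly"
  by (rule poly_mapping_eqI) (simp add: lookup_partial_deriv mult.left_commute)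

lemma partial_deriv_1 [simp]: "partial_deriv i (1 :: ('v, 'a::comm_ring_1) mpoly) = 0"
proof -
  have "m + single i 1 \<noteq> 0" for m :: "'v \<Rightarrow>\<^sub>0 nat"
    by (metis add_is_0 lookup_add lookup_single_eq lookup_zero one_neq_zero)
  then show ?thesis
    by (intro poly_mapping_eqI) (auto simp: lookup_partial_deriv lookup_one when_def)
qed

lemma partial_deriv_Var: "partial_deriv i (Var j :: ('v, 'a::comm_ring_1) mpoly) = (if i = j then 1 else 0)"
proof -
  have "partial_deriv i (Var j :: ('v, 'a) mpoly) = single (single j 1 - single i 1) (of_nat (lookup (single j 1) i))"
    by (simp add: partial_deriv_def Var_def)
  then show ?thesis by (auto simp: lookup_single)
qed

text \<open>
  Both sides are derivations along the substitution, and they agree on constants and variables.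
\<close>

theorem chain_rule_lin_subst:
  fixes p :: "(3, 'k::field) mpoly"
  shows "partial_deriv i (lin_subst A p) = (\<Sum>j\<in>UNIV. Const (A $ j $ i) * lin_subst A (partial_deriv j p))"
proof -
  interpret A: comm_ring_hom "lin_subst A" by (rule lin_subst_hom)
  define R where "R p \<longleftrightarrow> partial_deriv i (lin_subst A p) = (\<Sum>j\<in>UNIV. Const (A $ j $ i) * lin_subst A (partial_deriv j p))" for p
  have add: "R (p + q)" if "R p" "R q" for p q
    using that by (simp add: R_def A.hom_add partial_deriv_add sum.distrib distrib_left)
  have mult: "R (p * q)" if pq: "R p" "R q" for p q
  proof -
    have "(\<Sum>j\<in>UNIV. Const (A $ j $ i) * lin_subst A (partial_deriv j (p * q)))
      = lin_subst A p * (\<Sum>j\<in>UNIV. Const (A $ j $ i) * lin_subst A (partial_deriv j q))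
       + lin_subst A q * (\<Sum>j\<in>UNIV. Const (A $ j $ i) * lin_subst A (partial_deriv j p))"
      by (simp add: partial_deriv_mult A.hom_add A.hom_mult sum_distrib_left algebra_simps flip: sum.distrib)
    also have "\<dots> = lin_subst A p * partial_deriv i (lin_subst A q) + lin_subst A q * partial_deriv i (lin_subst A p)"
      using pq unfolding R_def by simp
    also have "\<dots> = partial_deriv i (lin_subst A (p * q))" by (simp add: A.hom_mult partial_deriv_mult)
    finally show ?thesis unfolding R_def ..
  qed
  have const: "R (Const c)" for c
  proof -
    have "partial_deriv l (Const c :: (3, 'k) mpoly) = 0" for l
      using partial_deriv_Const_mult[of l c 1] by simp
    then show ?thesis by (simp add: R_def)
  qed
  have var: "R (Var l)" for l
  proof -
    have "partial_deriv i (lin_subst A (Var l)) = Const (A $ l $ i)"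
      by (simp add: lin_subst_Var partial_deriv_sum partial_deriv_Const_mult partial_deriv_Var
          if_distrib[of "\<lambda>c. _ * c"] cong: if_cong)
    moreover have "(\<Sum>j\<in>UNIV. Const (A $ j $ i) * lin_subst A (partial_deriv j (Var l))) = Const (A $ l $ i)"
      by (simp add: partial_deriv_Var if_distrib[of "lin_subst A"] if_distrib[of "\<lambda>c. _ * c"] cong: if_cong)
    ultimately show ?thesis by (simp add: R_def)
  qed
  have "R (mon_eval Var m)" for m
  proof (induction m rule: exponent_induct)
    case zero
    show ?case using const[of 1] by simp
  next
    case (Suc m v)
    show ?case using mult[OF Suc var[of v]] by (simp add: mon_eval_add)
  qed
  then have single: "R (single m c)" for m c
    unfolding single_eq_Const_mult by (intro mult const)
  have "R p" by (induction p rule: mpoly_induct) (auto intro: single add)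
  then show ?thesis by (simp add: R_def)
qed

lemma homogeneous_add: "homogeneous d p \<Longrightarrow> homogeneous d q \<Longrightarrow> homogeneous d (p + q)"
  unfolding homogeneous_def using keys_add[of p q] by blast

lemma homogeneous_sum: "(\<And>i. i \<in> A \<Longrightarrow> homogeneous d (g i)) \<Longrightarrow> homogeneous d (sum g A)"
  by (induction A rule: infinite_finite_induct) (auto intro: homogeneous_add simp: homogeneous_def[of d 0])

lemma homogeneous_Const: "homogeneous 0 (Const c)"
  by (simp add: homogeneous_def Const_def)

lemma homogeneous_Var: "homogeneous 1 (Var v)"
  by (simp add: homogeneous_def Var_def)

lemma homogeneous_lin_subst:
  assumes "homogeneous d p" shows "homogeneous d (lin_subst A p)"
proof -
  interpret A: comm_ring_hom "lin_subst A" by (rule lin_subst_hom)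
  have "homogeneous (mdeg m) (lin_subst A (mon_eval Var m))" for m
  proof (induction m rule: exponent_induct)
    case zero
    show ?case unfolding mon_eval_0 mdeg_0 Const.hom_one[symmetric] lin_subst_Const by (rule homogeneous_Const)
  next
    case (Suc m v)
    have "homogeneous (0 + 1) (lin_subst A (Var v))"
      unfolding lin_subst_Var by (intro homogeneous_sum homogeneous_mult homogeneous_Const homogeneous_Var)
    from homogeneous_mult[OF Suc this] show ?case by (simp add: mon_eval_add A.hom_mult mdeg_add)
  qed
  then have "homogeneous (0 + mdeg m) (lin_subst A (single m c))" for m c
    unfolding single_eq_Const_mult A.hom_mult lin_subst_Const by (intro homogeneous_mult homogeneous_Const)
  then have "homogeneous d (lin_subst A (single m (lookup p m)))" if "m \<in> keys p" for m
    using that assms by (metis add_0 homogeneous_def)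
  then have "homogeneous d (\<Sum>m\<in>keys p. lin_subst A (single m (lookup p m)))" by (rule homogeneous_sum)
  then show ?thesis using mpoly_eq_sum_single[of p] by (simp flip: A.hom_sum)
qed

lemma squarefree_lin_subst:
  fixes f :: "(3, 'k::field) mpoly"
  assumes f: "squarefree f" and AB: "A ** B = Finite_Cartesian_Product.mat 1" "B ** A = Finite_Cartesian_Product.mat 1"
  shows "squarefree (lin_subst A f)"
  unfolding squarefree_def
proof (intro allI impI)
  interpret A: comm_ring_hom "lin_subst A" by (rule lin_subst_hom)
  interpret B: comm_ring_hom "lin_subst B" by (rule lin_subst_hom)
  fix u assume "u ^ 2 dvd lin_subst A f"
  then have "lin_subst B (u ^ 2) dvd lin_subst B (lin_subst A f)" by (rule B.hom_dvd)
  then have "lin_subst B u ^ 2 dvd f" by (simp add: lin_subst_comp AB lin_subst_id B.hom_power)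
  then have "lin_subst B u dvd 1" using f by (simp add: squarefree_def)
  then have "lin_subst A (lin_subst B u) dvd 1" by simp
  then show "u dvd 1" by (simp add: lin_subst_comp AB lin_subst_id)
qed

section \<open>Syzygies at singular points of multiplicity two\<close>

lemma binary_form_swap: "binary_form c x y n = binary_form (\<lambda>i. c (n - i)) y x n"
  unfolding binary_form_def
  by (rule sum.reindex_bij_witness[of _ "\<lambda>i. n - i" "\<lambda>i. n - i"]) (auto simp: mult_ac)

lemma binary_form_factor_power:
  assumes "\<exists>i\<le>n. c i \<noteq> 0"
  shows "\<exists>e c' m. c' 0 \<noteq> 0 \<and> binary_form (\<lambda>i. Const (c i)) x y n = x ^ e * binary_form (\<lambda>i. Const (c' i)) x y m"
  using assms
proof (induction n arbitrary: c)
  case 0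
  then show ?case by (intro exI[of _ 0] exI[of _ c]) simp
next
  case (Suc n)
  show ?case
  proof (cases "c 0 = 0")
    case True
    then obtain i where i: "i \<le> Suc n" "c i \<noteq> 0" "i \<noteq> 0" using Suc.prems by metis
    then have "\<exists>i\<le>n. c (Suc i) \<noteq> 0" by (intro exI[of _ "i - 1"]) auto
    from Suc.IH[OF this] obtain e c' m where
      "c' 0 \<noteq> 0" "binary_form (\<lambda>i. Const (c (Suc i))) x y n = x ^ e * binary_form (\<lambda>i. Const (c' i)) x y m"
      by blast
    then show ?thesis using True
      by (intro exI[of _ "Suc e"] exI[of _ c'] exI[of _ m]) (simp add: binary_form_Suc mult.assoc)
  next
    case False
    then show ?thesis by (intro exI[of _ 0] exI[of _ c] exI[of _ "Suc n"]) simp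
  qed
qed

lemma mod_xy_binary_form:
  fixes c :: "nat \<Rightarrow> 'k::field"
  assumes "l \<noteq> 3" "c 0 \<noteq> 0"
  shows "mod_xy (binary_form (\<lambda>i. Const (c i)) (Var l) (Var 3) m) \<noteq> 0"
proof -
  interpret E: comm_ring_hom "mod_xy :: (3, 'k) mpoly \<Rightarrow> _" by (rule mod_xy_hom)
  have "mod_xy (binary_form (\<lambda>i. Const (c i)) (Var l) (Var 3) m)
    = binary_form (\<lambda>i. [:c i:]) 0 [:0, 1:] m"
    using assms(1) by (simp add: E.hom_binary_form mod_xy_Const mod_xy_Var)
  also have "\<dots> = (\<Sum>i\<in>{0}. [:c i:] * 0 ^ i * [:0, 1:] ^ (m - i))"
    unfolding binary_form_def by (rule sum.mono_neutral_right) (auto simp: power_0_left)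
  also have "\<dots> = Polynomial.monom (c 0) m" by (simp add: X_power smult_monom)
  finally show ?thesis using assms(2) by simp
qed

text \<open>
  The monomial \<open>m = x\<^sub>v x\<^sub>w z\<^sup>d\<^sup>-\<^sup>2\<close> of \<open>f\<close> gives \<open>\<partial>\<^sub>w f\<close> a nonzero linear term in \<open>x\<^sub>v\<close> at
  the point.  So \<open>local_syzygy\<close> applies with the other variable \<open>x\<^sub>l\<close> as uniformizer, where the element of finite
  order is the form without \<open>x\<^sub>v\<close> obtained by elimination.
\<close>

lemma syzygy_at_e3:
  fixes f :: "(3, 'k::field_char_0) mpoly"
  assumes f: "homogeneous d f" "2 \<le> d" "squarefree f"
    and sing: "\<And>i. eval_at (partial_deriv i f) (axis 3 1) = 0"
    and m: "m \<in> keys f" "lookup m 1 + lookup m 2 = 2"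
  shows "\<exists>k g j. (\<Sum>i\<in>UNIV. g i * partial_deriv i f) = 0 \<and> (\<forall>i. homogeneous k (g i)) \<and>
    eval_at (g j) (axis 3 1) \<noteq> 0"
proof -
  interpret E: comm_ring_hom "mod_xy :: (3, 'k) mpoly \<Rightarrow> _" by (rule mod_xy_hom)
  have md: "lookup m 3 = d - 2"
  proof -
    have "mdeg m = d" using f(1) m(1) by (simp add: homogeneous_def)
    then show ?thesis using m(2) by (simp add: mdeg_UNIV sum_3)
  qed
  have h12: "(1::3) \<noteq> 2" "(1::3) \<noteq> 3" "(2::3) \<noteq> 3" by simp_all
  have "\<exists>v w. v \<in> {1, 2} \<and> w \<in> {1, 2} \<and> m = single v 1 + single w 1 + single (3::3) (d - 2)"
  proof -
    consider "lookup m 1 = 0" "lookup m 2 = 2" | "lookup m 1 = 1" "lookup m 2 = 1" | "lookup m 1 = 2" "lookup m 2 = 0"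
      using m(2) by linarith
    then show ?thesis
    proof cases
      case 1
      then show ?thesis using md h12
        by (intro exI[of _ 2] exI[of _ 2] conjI exponent_3_eqI) (auto simp: lookup_add lookup_single)
    next
      case 2
      then show ?thesis using md h12
        by (intro exI[of _ 1] exI[of _ 2] conjI exponent_3_eqI) (auto simp: lookup_add lookup_single)
    next
      case 3
      then show ?thesis using md h12
        by (intro exI[of _ 1] exI[of _ 1] conjI exponent_3_eqI) (auto simp: lookup_add lookup_single)
    qed
  qed
  then obtain v w where vw: "v \<in> {1, 2}" "w \<in> {1, 2}" "m = single v 1 + single w 1 + single 3 (d - 2)" by blast
  define l where "l = (if v = 1 then 2 else 1 :: 3)"
  have vl: "{v, l} = {1, 2}" "v \<noteq> l" "v \<noteq> 3" "l \<noteq> 3" using vw(1) by (auto simp: l_def)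
  have hom: "homogeneous (d - 1) (partial_deriv w f)" by (rule homogeneous_partial_deriv[OF f(1)])
  have "lookup (partial_deriv w f) (single 3 k) = 0" for k
  proof (cases "k = d - 1")
    case True
    then show ?thesis using eval_at_e3[OF hom] sing by simp
  next
    case False
    then show ?thesis using hom unfolding homogeneous_def by (metis in_keys_iff mdeg_single)
  qed
  then have "mod_xy (partial_deriv w f) = 0" by (intro poly_eqI) (simp add: coeff_mod_xy)
  then obtain U V where UV: "partial_deriv w f = Var v * U + Var l * V"
    unfolding mod_xy_eq_0_iff[OF vl(1)] by blast
  let ?n = "single 3 (d - 2)"
  have "lookup (Var v * U + Var l * V) (single v 1 + ?n) = lookup U ?n"
    using vl by (simp add: lookup_add lookup_Var_mult lookup_single)
  moreover have "lookup (partial_deriv w f) (single v 1 + ?n) \<noteq> 0"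
  proof -
    have "single v 1 + ?n + single w 1 = m" unfolding vw(3) by (simp add: ac_simps)
    then show ?thesis using m(1) by (simp add: lookup_partial_deriv in_keys_iff del: of_nat_Suc)
  qed
  ultimately have "lookup U ?n \<noteq> 0" unfolding UV by simp
  then have U: "mod_xy U \<noteq> 0" by (metis coeff_0 coeff_mod_xy)
  obtain n c s where nc: "\<exists>i\<le>n. c i \<noteq> 0"
    "binary_form (\<lambda>i. Const (c i)) (Var (v + 1)) (Var (v + 2)) n = (\<Sum>i\<in>UNIV. s i * partial_deriv i f)"
    using elimination[OF f(1) _ f(3), of v] f(2) by auto
  (* The cyclic order of the variables puts x_l first or last according to v. *)
  have "\<exists>c'. (\<exists>i\<le>n. c' i \<noteq> 0) \<and> binary_form (\<lambda>i. Const (c i)) (Var (v + 1)) (Var (v + 2)) n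
      = binary_form (\<lambda>i. Const (c' i)) (Var l) (Var 3 :: (3, 'k) mpoly) n"
  proof (cases "v = 1")
    case True
    then show ?thesis using nc(1) by (intro exI[of _ c]) (simp add: l_def)
  next
    case False
    then have v: "v = 2" using vw(1) by simp
    have "(4::3) = 1" by simp
    then have "binary_form (\<lambda>i. Const (c i)) (Var (v + 1)) (Var (v + 2)) n
      = binary_form (\<lambda>i. Const (c (n - i))) (Var l) (Var 3 :: (3, 'k) mpoly) n"
      unfolding binary_form_swap[of "\<lambda>i. Const (c i)"] by (simp add: v l_def \<open>(4::3) = 1\<close>)
    moreover obtain i where "i \<le> n" "c i \<noteq> 0" using nc(1) by blast
    then have "\<exists>i\<le>n. c (n - i) \<noteq> 0" by (intro exI[of _ "n - i"]) simp
    ultimately show ?thesis by (intro exI[of _ "\<lambda>i. c (n - i)"] conjI)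
  qed
  then obtain c' where c': "\<exists>i\<le>n. c' i \<noteq> 0"
    "(\<Sum>i\<in>UNIV. s i * partial_deriv i f) = binary_form (\<lambda>i. Const (c' i)) (Var l) (Var 3) n"
    using nc(2) by metis
  obtain e c'' q where q: "c'' 0 \<noteq> 0" "(\<Sum>i\<in>UNIV. s i * partial_deriv i f)
      = Var l ^ e * binary_form (\<lambda>i. Const (c'' i)) (Var l) (Var 3) q"
    using binary_form_factor_power[OF c'(1), of "Var l" "Var 3"] unfolding c'(2) by blast
  have "\<exists>g j. (\<Sum>i\<in>UNIV. g i * partial_deriv i f) = 0 \<and> mod_xy (g j) \<noteq> 0"
  proof (rule local_syzygy[where u = w and U = U and V = V])
    show "comm_ring_hom (mod_xy :: (3, 'k) mpoly \<Rightarrow> _)" by (rule mod_xy_hom)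
    show "(mod_xy a = 0) = (\<exists>b c. a = Var v * b + Var l * c)" for a :: "(3, 'k) mpoly"
      by (rule mod_xy_eq_0_iff[OF vl(1)])
    show "prime_elem (Var l :: (3, 'k) mpoly)" by (rule prime_elem_Var)
    show "\<not> Var l dvd (Var v :: (3, 'k) mpoly)" by (rule Var_not_dvd_Var[OF vl(2)])
    show "partial_deriv w f = U * Var v + V * Var l" unfolding UV by (simp only: mult.commute)
    show "mod_xy (binary_form (\<lambda>i. Const (c'' i)) (Var l) (Var 3) q) \<noteq> 0"
      by (rule mod_xy_binary_form[where c = c'', OF vl(4) q(1)])
  qed (fact U q(2))+
  then obtain g j where g: "(\<Sum>i\<in>UNIV. g i * partial_deriv i f) = 0" "mod_xy (g j) \<noteq> 0" by blast
  then obtain k where k: "lookup (g j) (single 3 k) \<noteq> 0" by (metis coeff_0 coeff_mod_xy poly_eqI)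
  have "(\<Sum>i\<in>UNIV. hom_component k (g i) * partial_deriv i f)
    = hom_component (k + (d - 1)) (\<Sum>i\<in>UNIV. g i * partial_deriv i f)"
    by (simp add: hom_component_sum hom_component_mult_homogeneous[OF homogeneous_partial_deriv[OF f(1)]])
  also have "\<dots> = 0" unfolding g(1) by simp
  finally have "(\<Sum>i\<in>UNIV. hom_component k (g i) * partial_deriv i f) = 0" .
  moreover have "eval_at (hom_component k (g j)) (axis 3 1) \<noteq> 0"
    unfolding eval_at_e3[OF homogeneous_hom_component] using k by simp
  ultimately show ?thesis
    by (intro exI[of _ k] exI[of _ "\<lambda>i. hom_component k (g i)"] exI[of _ j] conjI allI
        homogeneous_hom_component)
qed

lemma exponent_of_quadratic_part:
  fixes f :: "(3, 'k::field) mpoly"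
  assumes F2: "hom_component 2 (dehomogenize f) \<noteq> 0"
  shows "\<exists>m\<in>keys f. lookup m 1 + lookup m 2 = 2"
proof -
  define \<delta> where "\<delta> (m :: 3 \<Rightarrow>\<^sub>0 nat) = single (1::2) (lookup m 1) + single 2 (lookup m (2::3))" for m
  have mon: "mon_eval (\<lambda>i::3. if i = 1 then Var 1 else if i = 2 then Var 2 else 1) m = single (\<delta> m) (1::'k)" for m
  proof -
    have "mon_eval (\<lambda>i::3. if i = 1 then Var 1 else if i = 2 then Var 2 else 1) m
      = (Var 1 ^ lookup m 1 * Var 2 ^ lookup m 2 :: (2, 'k) mpoly)"
      by (simp add: mon_eval_3)
    then show ?thesis by (simp add: Var_power mult_single \<delta>_def)
  qed
  have "dehomogenize f = (\<Sum>m\<in>keys f. Const (lookup f m) * single (\<delta> m) 1)"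
    unfolding dehomogenize_def eval_hom_def mon_eval_def[symmetric] mon ..
  then have deh: "dehomogenize f = (\<Sum>m\<in>keys f. single (\<delta> m) (lookup f m))"
    by (simp add: Const_def mult_single)
  obtain n where "lookup (hom_component 2 (dehomogenize f)) n \<noteq> 0"
    using F2 by (metis lookup_zero poly_mapping_eqI)
  then have n: "n \<in> keys (dehomogenize f)" "mdeg n = 2" by (auto simp: in_keys_iff split: if_splits)
  have "keys (dehomogenize f) \<subseteq> (\<Union>m\<in>keys f. keys (single (\<delta> m) (lookup f m)))"
    unfolding deh by (rule keys_sum)
  then obtain m where m: "m \<in> keys f" "n = \<delta> m" using n(1) by (auto split: if_splits)
  then have "lookup m 1 + lookup m 2 = 2" using n(2) by (simp add: \<delta>_def mdeg_add)
  then show ?thesis using m(1) by blast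
qed

lemma generator_in_syzygy_coordinates: "f i \<in> syzygy_coordinates f" for f :: "3 \<Rightarrow> 's::comm_ring_1"
proof -
  let ?g = "\<lambda>l. if l = i + 1 then f i else if l = i then - f (i + 1) else 0"
  have "(\<Sum>l\<in>UNIV. ?g l * f l) = 0"
    unfolding UNIV_3_shift[of i] by simp
  then have "?g (i + 1) \<in> syzygy_coordinates f"
    unfolding syzygy_coordinates_def by (intro CollectI exI[of _ ?g] exI[of _ "i + 1"] conjI refl)
  then show ?thesis by simp
qed

text \<open>
  At a smooth point a partial derivative serves, being a coordinate of a Koszul syzygy.  A singular
  point is moved to \<open>[0:0:1]\<close>; its being a node or a cusp enters only through the quadratic part of
  the local equation being nonzero.  The syzygy found there is transported back by the chain rule.
\<close>

theorem homogeneous_syzygy_coordinate_at_point: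
  fixes f :: "(3, 'k::field_char_0) mpoly"
  assumes f: "homogeneous d f" "2 \<le> d" "squarefree f" and nc: "nodal f \<or> cuspidal f" and p: "p \<noteq> 0"
  shows "\<exists>k s. s \<in> syzygy_coordinates (\<lambda>i. partial_deriv i f) \<and> homogeneous k s \<and> eval_at s p \<noteq> 0"
proof (cases "\<exists>i. eval_at (partial_deriv i f) p \<noteq> 0")
  case True
  then obtain i where i: "eval_at (partial_deriv i f) p \<noteq> 0" ..
  then show ?thesis
    using generator_in_syzygy_coordinates[of "\<lambda>i. partial_deriv i f" i] homogeneous_partial_deriv[OF f(1)]
    by blast
next
  case False
  then have sing: "eval_at (partial_deriv i f) p = 0" for i by blast
  interpret Ev: comm_ring_hom "\<lambda>q. eval_at q p" by (rule eval_at_hom)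
  have "of_nat d * eval_at f p = eval_at (\<Sum>i\<in>UNIV. Var i * partial_deriv i f) p"
    unfolding Euler_identity[OF f(1)] by (simp add: Ev.hom_mult Ev.hom_of_nat)
  also have "\<dots> = 0" by (simp add: Ev.hom_sum Ev.hom_mult sing)
  finally have "eval_at f p = 0" using f(2) by simp
  then have "singular_point f p" using sing p by (simp add: singular_point_def)
  then obtain F where F: "local_equation f p F" "hom_component 2 F \<noteq> 0"
    using nc unfolding nodal_def cuspidal_def is_node_def is_cusp_def by blast
  then obtain A where A: "invertible A" "A *v axis 3 1 = p" "F = dehomogenize (lin_subst A f)"
    unfolding local_equation_def by blast
  obtain B where AB: "A ** B = Finite_Cartesian_Product.mat 1" "B ** A = Finite_Cartesian_Product.mat 1"
    using A(1) unfolding invertible_def by blast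
  have Bp: "B *v p = axis 3 1"
    unfolding A(2)[symmetric] by (simp add: matrix_vector_mul_assoc AB)
  interpret B: comm_ring_hom "lin_subst B" by (rule lin_subst_hom)
  let ?f = "lin_subst A f"
  obtain m where m: "m \<in> keys ?f" "lookup m 1 + lookup m 2 = 2"
    using exponent_of_quadratic_part F(2) A(3) by blast
  have sing': "eval_at (partial_deriv i ?f) (axis 3 1) = 0" for i
  proof -
    interpret Ev3: comm_ring_hom "\<lambda>q. eval_at q (axis 3 1)" by (rule eval_at_hom)
    show ?thesis
      by (simp add: chain_rule_lin_subst Ev3.hom_sum Ev3.hom_mult eval_at_lin_subst A(2) sing)
  qed
  obtain k g j where g: "(\<Sum>i\<in>UNIV. g i * partial_deriv i ?f) = 0" "\<And>i. homogeneous k (g i)"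
    "eval_at (g j) (axis 3 1) \<noteq> 0"
    using syzygy_at_e3[OF homogeneous_lin_subst[OF f(1)] f(2) squarefree_lin_subst[OF f(3) AB] sing' m] by blast
  define h where "h l = lin_subst B (\<Sum>i\<in>UNIV. Const (A $ l $ i) * g i)" for l
  have "(\<Sum>l\<in>UNIV. h l * partial_deriv l f) = lin_subst B (\<Sum>i\<in>UNIV. g i * partial_deriv i ?f)"
  proof -
    have "lin_subst B (\<Sum>i\<in>UNIV. g i * partial_deriv i ?f)
      = (\<Sum>i\<in>UNIV. \<Sum>l\<in>UNIV. lin_subst B (g i) * (Const (A $ l $ i) * partial_deriv l f))"
      by (simp add: chain_rule_lin_subst B.hom_sum B.hom_mult lin_subst_comp AB lin_subst_id sum_distrib_left)
    also have "\<dots> = (\<Sum>l\<in>UNIV. \<Sum>i\<in>UNIV. lin_subst B (g i) * (Const (A $ l $ i) * partial_deriv l f))"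
      by (rule sum.swap)
    also have "\<dots> = (\<Sum>l\<in>UNIV. h l * partial_deriv l f)"
      by (simp add: h_def B.hom_sum B.hom_mult sum_distrib_left sum_distrib_right mult_ac)
    finally show ?thesis ..
  qed
  then have "(\<Sum>l\<in>UNIV. h l * partial_deriv l f) = 0" unfolding g(1) by simp
  then have hE: "h l \<in> syzygy_coordinates (\<lambda>i. partial_deriv i f)" for l
    unfolding syzygy_coordinates_def by blast
  have "homogeneous (0 + k) (\<Sum>i\<in>UNIV. Const (A $ l $ i) * g i)" for l
    by (intro homogeneous_sum homogeneous_mult homogeneous_Const g(2))
  then have hk: "homogeneous k (h l)" for l
    unfolding h_def by (intro homogeneous_lin_subst) simp
  define \<gamma> where "\<gamma> = (\<chi> i. eval_at (g i) (axis 3 1))"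
  have hp: "eval_at (h l) p = (A *v \<gamma>) $ l" for l
  proof -
    interpret Ev3: comm_ring_hom "\<lambda>q. eval_at q (axis 3 1)" by (rule eval_at_hom)
    have "eval_at (h l) p = eval_at (\<Sum>i\<in>UNIV. Const (A $ l $ i) * g i) (axis 3 1)"
      by (simp only: h_def eval_at_lin_subst Bp)
    then show ?thesis
      by (simp add: Ev3.hom_sum Ev3.hom_mult \<gamma>_def matrix_vector_mult_def)
  qed
  have "A *v \<gamma> \<noteq> 0"
  proof
    assume "A *v \<gamma> = 0"
    then have "B *v (A *v \<gamma>) = 0" by simp
    then have "\<gamma> = 0" by (simp add: matrix_vector_mul_assoc AB)
    then have "\<gamma> $ j = 0" by simp
    then show False using g(3) by (simp add: \<gamma>_def)
  qed
  then obtain l where "(A *v \<gamma>) $ l \<noteq> 0" by (auto simp: Finite_Cartesian_Product.vec_eq_iff)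
  then show ?thesis using hE hk hp by metis
qed

section \<open>Ideals without zeros in the plane\<close>

text \<open>
  Either the form is divisible by \<open>y\<close>, or its dehomogenization has positive degree and hence a root
  \<open>\<rho>\<close>, so that it is divisible by \<open>x - \<rho> y\<close>.
\<close>

lemma binary_form_linear_factor:
  fixes c :: "nat \<Rightarrow> 'k::alg_closed_field"
  assumes "\<exists>i\<le>Suc n. c i \<noteq> 0"
  shows "\<exists>\<alpha> \<beta> c'. (\<alpha> \<noteq> 0 \<or> \<beta> \<noteq> 0) \<and> (\<exists>i\<le>n. c' i \<noteq> 0) \<and>
    (\<forall>x y. binary_form (\<lambda>i. Const (c i)) x y (Suc n) =
       (Const \<alpha> * x + Const \<beta> * y) * (binary_form (\<lambda>i. Const (c' i)) x y n :: ('v, 'k) mpoly))"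
proof (cases "c (Suc n) = 0")
  case True
  have "\<exists>i\<le>n. c i \<noteq> 0" using assms True by (metis le_Suc_eq)
  moreover have "binary_form (\<lambda>i. Const (c i)) x y (Suc n) = y * (binary_form (\<lambda>i. Const (c i)) x y n :: ('v, 'k) mpoly)" for x y
    unfolding binary_form_times_right by (rule arg_cong[of _ _ "\<lambda>c. binary_form c x y (Suc n)"]) (auto simp: True)
  ultimately show ?thesis by (intro exI[of _ 0] exI[of _ 1] exI[of _ c]) simp
next
  case False
  obtain \<rho> where \<rho>: "(\<Sum>k\<le>Suc n. c k * \<rho> ^ k) = 0" using alg_closed[of "Suc n" c] False by auto
  define P where "P = (\<Sum>k\<le>Suc n. Polynomial.monom (c k) k)"
  have coeff_P: "coeff P i = (if i \<le> Suc n then c i else 0)" for i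
    by (simp add: P_def coeff_sum)
  have "poly P \<rho> = 0" using \<rho> by (simp only: P_def poly_sum poly_monom)
  then obtain Q where PQ: "P = [:- \<rho>, 1:] * Q" unfolding poly_eq_0_iff_dvd by (elim dvdE)
  have coeff_PQ: "coeff P i = (if i = 0 then 0 else coeff Q (i - 1)) - \<rho> * coeff Q i" for i
    unfolding PQ by (cases i) (simp_all add: coeff_pCons)
  have "P \<noteq> 0" using coeff_P[of "Suc n"] False by auto
  then have "Q \<noteq> 0" using PQ by auto
  have "degree P \<le> Suc n" by (rule degree_le) (simp add: coeff_P)
  moreover have "degree P = Suc (degree Q)" unfolding PQ using \<open>Q \<noteq> 0\<close> by (subst degree_mult_eq) auto
  ultimately have dQ: "degree Q \<le> n" by simp
  then have Q0: "coeff Q (Suc n) = 0" by (intro coeff_eq_0) simp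
  have "binary_form (\<lambda>i. Const (c i)) x y (Suc n)
    = (Const 1 * x + Const (- \<rho>) * y) * (binary_form (\<lambda>i. Const (coeff Q i)) x y n :: ('v, 'k) mpoly)" for x y
  proof -
    let ?B = "binary_form (\<lambda>i. Const (coeff Q i)) x y n :: ('v, 'k) mpoly"
    have "(Const 1 * x + Const (- \<rho>) * y) * ?B = x * ?B + Const (- \<rho>) * (y * ?B)"
      by (simp add: algebra_simps)
    also have "\<dots> = binary_form (\<lambda>i. (if i = 0 then 0 else Const (coeff Q (i - 1)))
        + Const (- \<rho>) * (if i = Suc n then 0 else Const (coeff Q i))) x y (Suc n)"
      by (simp only: binary_form_times_left binary_form_times_right binary_form_scale binary_form_add)
    also have "\<dots> = binary_form (\<lambda>i. Const (c i)) x y (Suc n)"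
      unfolding binary_form_def
    proof (intro sum.cong refl arg_cong2[of _ _ _ _ "(*)"])
      fix i assume "i \<in> {..Suc n}"
      then have "c i = (if i = 0 then 0 else coeff Q (i - 1)) - \<rho> * (if i = Suc n then 0 else coeff Q i)"
        using coeff_P[of i] coeff_PQ[of i] Q0 by auto
      then show "(if i = 0 then 0 else Const (coeff Q (i - 1)))
        + Const (- \<rho>) * (if i = Suc n then 0 else Const (coeff Q i)) = Const (c i)"
        by (simp add: Const.hom_minus Const.hom_mult Const.hom_uminus)
    qed
    finally show ?thesis ..
  qed
  moreover have "\<exists>i\<le>n. coeff Q i \<noteq> 0"
    using \<open>Q \<noteq> 0\<close> dQ by (intro exI[of _ "degree Q"]) simp
  ultimately show ?thesis by (intro exI[of _ 1] exI[of _ "- \<rho>"] exI[of _ "coeff Q"]) simp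
qed

definition adjoin :: "'a::comm_ring_1 set \<Rightarrow> 'a \<Rightarrow> 'a set" where
  "adjoin I a = {u + r * a | u r. u \<in> I}"

lemma adjoinI: "ring_ideal I \<Longrightarrow> u \<in> I \<Longrightarrow> u \<in> adjoin I a" "ring_ideal I \<Longrightarrow> a \<in> adjoin I a"
proof -
  assume I: "ring_ideal I"
  show "u \<in> I \<Longrightarrow> u \<in> adjoin I a"
    unfolding adjoin_def by (intro CollectI exI[of _ u] exI[of _ 0]) simp
  show "a \<in> adjoin I a"
    unfolding adjoin_def using ring_idealD(1)[OF I] by (intro CollectI exI[of _ 0] exI[of _ 1]) simp
qed

lemma ring_ideal_adjoin:
  assumes I: "ring_ideal I" shows "ring_ideal (adjoin I a)"
  unfolding ring_ideal_def
proof (intro conjI ballI allI)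
  show "0 \<in> adjoin I a" by (intro adjoinI I ring_idealD(1))
next
  fix x y assume "x \<in> adjoin I a" "y \<in> adjoin I a"
  then obtain u r v s where "u \<in> I" "v \<in> I" "x = u + r * a" "y = v + s * a" unfolding adjoin_def by blast
  then show "x + y \<in> adjoin I a"
    unfolding adjoin_def by (intro CollectI exI[of _ "u + v"] exI[of _ "r + s"])
      (simp add: ring_idealD(2)[OF I] algebra_simps)
next
  fix x t assume "x \<in> adjoin I a"
  then obtain u r where "u \<in> I" "x = u + r * a" unfolding adjoin_def by blast
  then show "t * x \<in> adjoin I a"
    unfolding adjoin_def by (intro CollectI exI[of _ "t * u"] exI[of _ "t * r"])
      (simp add: ring_idealD(3)[OF I] algebra_simps)
qed

lemma adjoin_mono: "I \<subseteq> J \<Longrightarrow> adjoin I a \<subseteq> adjoin J a"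
  unfolding adjoin_def by blast

lemma power_mem_of_adjoin_factors:
  assumes I: "ring_ideal I" and ab: "a * b \<in> I" and "x ^ m \<in> adjoin I a" "x ^ n \<in> adjoin I b"
  shows "x ^ (m + n) \<in> I"
proof -
  obtain u r v s where uv: "u \<in> I" "v \<in> I" "x ^ m = u + r * a" "x ^ n = v + s * b"
    using assms(3,4) unfolding adjoin_def by blast
  have "x ^ (m + n) = (v + s * b) * u + (r * a) * v + (r * s) * (a * b)"
    unfolding power_add uv by (simp add: algebra_simps)
  also have "\<dots> \<in> I" by (intro ring_idealD(2,3)[OF I] uv ab)
  finally show ?thesis .
qed

definition irrelevant_power :: "('v, 'a::comm_ring_1) mpoly set \<Rightarrow> bool" where
  "irrelevant_power I \<longleftrightarrow> (\<forall>v. \<exists>N. Var v ^ N \<in> I)"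

lemma irrelevant_power_mono: "I \<subseteq> J \<Longrightarrow> irrelevant_power I \<Longrightarrow> irrelevant_power J"
  unfolding irrelevant_power_def by blast

text \<open>
  Geometrically: the zero set of \<open>I\<close> is the union of its intersections with the lines into which
  the binary form decomposes.
\<close>

lemma irrelevant_power_binary_form:
  fixes c :: "nat \<Rightarrow> 'k::alg_closed_field" and x y :: "('v, 'k) mpoly"
  assumes "ring_ideal I" "\<exists>i\<le>n. c i \<noteq> 0" "binary_form (\<lambda>i. Const (c i)) x y n \<in> I"
    and "\<And>\<alpha> \<beta>. \<alpha> \<noteq> 0 \<or> \<beta> \<noteq> 0 \<Longrightarrow> irrelevant_power (adjoin I (Const \<alpha> * x + Const \<beta> * y))"
  shows "irrelevant_power I"
  using assms
proof (induction n arbitrary: c I)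
  case 0
  have "Const (c 0) \<in> I" using 0 by (simp add: binary_form_def)
  then have "Const (inverse (c 0)) * Const (c 0) \<in> I" by (rule ring_idealD(3)[OF 0(1)])
  moreover have "Const (inverse (c 0)) * Const (c 0) = (1 :: ('v, 'k) mpoly)"
    using 0(2) by (simp flip: Const.hom_mult)
  ultimately show ?case unfolding irrelevant_power_def by (metis power_0)
next
  case (Suc n)
  note I = Suc.prems(1)
  obtain \<alpha> \<beta> c' where l: "\<alpha> \<noteq> 0 \<or> \<beta> \<noteq> 0" "\<exists>i\<le>n. c' i \<noteq> 0"
    "\<And>x y :: ('v, 'k) mpoly. binary_form (\<lambda>i. Const (c i)) x y (Suc n) =
       (Const \<alpha> * x + Const \<beta> * y) * binary_form (\<lambda>i. Const (c' i)) x y n"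
    using binary_form_linear_factor[OF Suc.prems(2), where 'v = 'v] by blast
  let ?a = "Const \<alpha> * x + Const \<beta> * y" and ?b = "binary_form (\<lambda>i. Const (c' i)) x y n"
  have ab: "?a * ?b \<in> I" using Suc.prems(3) unfolding l(3) .
  have a: "irrelevant_power (adjoin I ?a)" using Suc.prems(4) l(1) by blast
  have "irrelevant_power (adjoin (adjoin I ?b) (Const \<gamma> * x + Const \<delta> * y))" if "\<gamma> \<noteq> 0 \<or> \<delta> \<noteq> 0" for \<gamma> \<delta>
    using irrelevant_power_mono[OF adjoin_mono Suc.prems(4)[OF that]] adjoinI(1)[OF I] by blast
  from Suc.IH[OF ring_ideal_adjoin[OF I] l(2) adjoinI(2)[OF I] this]
  have b: "irrelevant_power (adjoin I ?b)" .
  show ?case unfolding irrelevant_power_def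
  proof
    fix v
    obtain m n where "Var v ^ m \<in> adjoin I ?a" "Var v ^ n \<in> adjoin I ?b"
      using a b unfolding irrelevant_power_def by blast
    from power_mem_of_adjoin_factors[OF I ab this] show "\<exists>N. Var v ^ N \<in> I" by blast
  qed
qed

lemma ring_ideal_mult_cong:
  assumes I: "ring_ideal I" and "a - b \<in> I" "c - d \<in> I" shows "a * c - b * d \<in> I"
proof -
  have "a * c - b * d = c * (a - b) + b * (c - d)" by (simp add: algebra_simps)
  also have "\<dots> \<in> I" by (intro ring_idealD(2,3)[OF I] assms)
  finally show ?thesis .
qed

lemma eval_hom_cong_ideal:
  fixes p :: "('v, 'a::comm_ring_1) mpoly"
  assumes I: "ring_ideal I" and xy: "\<And>v. x v - y v \<in> I"
  shows "eval_hom Const x p - eval_hom Const y p \<in> I"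
proof -
  interpret X1: comm_ring_hom "eval_hom Const x" by (rule Const.eval_hom_comm_ring_hom)
  interpret Y1: comm_ring_hom "eval_hom Const y" by (rule Const.eval_hom_comm_ring_hom)
  have mon: "mon_eval x m - mon_eval y m \<in> I" for m
  proof (induction m rule: exponent_induct)
    case zero
    show ?case by (simp add: ring_idealD(1)[OF I])
  next
    case (Suc m v)
    show ?case using ring_ideal_mult_cong[OF I Suc xy[of v]] by (simp add: mon_eval_add)
  qed
  show ?thesis
  proof (induction p rule: mpoly_induct)
    case (single m c)
    show ?case using ring_idealD(3)[OF I mon[of m], of "Const c"]
      by (simp add: eval_hom_single right_diff_distrib)
  next
    case (add p q)
    show ?case using ring_idealD(2)[OF I add] by (simp add: X1.hom_add Y1.hom_add algebra_simps)
  qed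
qed

lemma mon_eval_scaled:
  fixes p :: "'v \<Rightarrow> 'a::comm_ring_1"
  shows "mon_eval (\<lambda>i. Const (p i) * w) m = Const (mon_eval p m) * w ^ mdeg m"
proof (induction m rule: exponent_induct)
  case (Suc m v)
  show ?case
    unfolding mon_eval_add mon_eval_single Suc mdeg_add mdeg_single power_add power_one_right Const.hom_mult
    by (simp only: mult_ac)
qed simp

text \<open>
  Restricting a form of degree \<open>k\<close> to the line through \<open>p\<close>, with parameter \<open>w\<close>.
\<close>

lemma eval_hom_line:
  assumes "homogeneous k s"
  shows "eval_hom Const (\<lambda>i. Const (p $ i) * w) s = Const (eval_at s p) * w ^ k"
proof -
  have "eval_hom Const (\<lambda>i. Const (p $ i) * w) s
    = (\<Sum>m\<in>keys s. Const (lookup s m) * (Const (mon_eval (\<lambda>i. p $ i) m) * w ^ mdeg m))"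
    unfolding eval_hom_def mon_eval_def[symmetric] mon_eval_scaled ..
  also have "\<dots> = (\<Sum>m\<in>keys s. Const (lookup s m * mon_eval (\<lambda>i. p $ i) m) * w ^ k)"
    using assms by (intro sum.cong refl) (simp add: homogeneous_def Const.hom_mult mult.assoc)
  also have "\<dots> = Const (eval_at s p) * w ^ k"
    unfolding eval_at_def eval_hom_def mon_eval_def[symmetric] Const.hom_sum sum_distrib_right ..
  finally show ?thesis .
qed

text \<open>
  Modulo \<open>I\<close> the form \<open>s\<close> becomes \<open>s(p) w\<^sup>k\<close>, so \<open>w\<^sup>k \<in> I\<close>, and all variables are multiples of \<open>w\<close>.
\<close>

lemma irrelevant_power_at_point:
  fixes I :: "(3, 'k::field) mpoly set"
  assumes I: "ring_ideal I" and s: "s \<in> I" "homogeneous k s" "eval_at s p \<noteq> 0"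
    and p: "\<And>i. Var i - Const (p $ i) * w \<in> I"
  shows "irrelevant_power I"
proof -
  have "eval_hom Const Var s - eval_hom Const (\<lambda>i. Const (p $ i) * w) s \<in> I"
    by (rule eval_hom_cong_ideal[OF I p])
  then have "s - Const (eval_at s p) * w ^ k \<in> I" by (simp add: eval_hom_line[OF s(2)])
  from ring_idealD(5)[OF I s(1) this] have "Const (eval_at s p) * w ^ k \<in> I" by simp
  from ring_idealD(3)[OF I this, of "Const (inverse (eval_at s p))"]
  have w: "w ^ k \<in> I" using s(3) by (simp flip: mult.assoc Const.hom_mult)
  have "Var i ^ k \<in> I" for i
  proof -
    have "Var i ^ n - (Const (p $ i) * w) ^ n \<in> I" for n
      by (induction n) (simp_all add: ring_idealD(1)[OF I] ring_ideal_mult_cong[OF I p])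
    moreover have "(Const (p $ i) * w) ^ k \<in> I"
      unfolding power_mult_distrib by (rule ring_idealD(3)[OF I w])
    ultimately show ?thesis using ring_idealD(2)[OF I] by (metis diff_add_cancel)
  qed
  then show ?thesis unfolding irrelevant_power_def by blast
qed

lemma linear_form_solve:
  fixes I :: "('v, 'k::field) mpoly set"
  assumes I: "ring_ideal I" and "Const \<alpha> * x + Const \<beta> * y \<in> I" "\<alpha> \<noteq> 0"
  shows "x - Const (- \<beta> / \<alpha>) * y \<in> I"
proof -
  have "Const (inverse \<alpha>) * (Const \<alpha> * x + Const \<beta> * y) = x - Const (- \<beta> / \<alpha>) * y"
  proof -
    have "Const (inverse \<alpha>) * (Const \<alpha> * x + Const \<beta> * y)
      = Const (inverse \<alpha> * \<alpha>) * x + Const (inverse \<alpha> * \<beta>) * y"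
      by (simp add: Const.hom_mult algebra_simps)
    also have "inverse \<alpha> * \<alpha> = 1" using assms(3) by simp
    also have "inverse \<alpha> * \<beta> = - (- \<beta> / \<alpha>)" by (simp add: field_simps)
    finally show ?thesis by (simp only: Const.hom_uminus Const.hom_one) simp
  qed
  then show ?thesis using ring_idealD(3)[OF I assms(2), of "Const (inverse \<alpha>)"] by simp
qed

text \<open>
  Splitting the three binary forms into linear factors reduces the claim to ideals that contain one
  linear form in each pair of variables.  These forms leave at most one point of the plane, and at it
  some element of \<open>A\<close> does not vanish.
\<close>

theorem irrelevant_power_if_no_zero:
  fixes A :: "(3, 'k::alg_closed_field) mpoly set"
  assumes A: "ring_ideal A"
    and forms: "\<And>v. \<exists>n c. (\<exists>i\<le>n. c i \<noteq> 0) \<and> binary_form (\<lambda>i. Const (c i)) (Var (v + 1)) (Var (v + 2)) n \<in> A"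
    and points: "\<And>p. p \<noteq> 0 \<Longrightarrow> \<exists>k s. s \<in> A \<and> homogeneous k s \<and> eval_at s p \<noteq> 0"
  shows "irrelevant_power A"
proof -
  have "irrelevant_power I"
    if I: "ring_ideal I" "A \<subseteq> I"
      and l1: "\<alpha> \<noteq> 0 \<or> \<beta> \<noteq> 0" "Const \<alpha> * Var 2 + Const \<beta> * Var 3 \<in> I"
      and l2: "\<gamma> \<noteq> 0 \<or> \<delta> \<noteq> 0" "Const \<gamma> * Var 3 + Const \<delta> * Var 1 \<in> I"
      and l3: "\<epsilon> \<noteq> 0 \<or> \<zeta> \<noteq> 0" "Const \<epsilon> * Var 1 + Const \<zeta> * Var 2 \<in> I"
    for I :: "(3, 'k) mpoly set" and \<alpha> \<beta> \<gamma> \<delta> \<epsilon> \<zeta>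
  proof -
    have point: "irrelevant_power I"
      if "p \<noteq> 0" "Var 1 - Const (p $ 1) * w \<in> I" "Var 2 - Const (p $ 2) * w \<in> I" "Var 3 - Const (p $ 3) * w \<in> I"
      for p :: "'k ^ 3" and w
    proof -
      obtain k s where s: "s \<in> A" "homogeneous k s" "eval_at s p \<noteq> 0" using points \<open>p \<noteq> 0\<close> by blast
      have "Var i - Const (p $ i) * w \<in> I" for i using exhaust_3[of i] that by auto
      then show ?thesis using irrelevant_power_at_point[OF I(1) _ s(2,3)] s(1) I(2) by blast
    qed
    note I0 = ring_idealD(1)[OF I(1)]
    have z_case: "irrelevant_power I" if z: "Var 3 \<in> I"
    proof (cases "\<epsilon> = 0")
      case False
      then have "Var 1 - Const (- \<zeta> / \<epsilon>) * Var 2 \<in> I" using linear_form_solve[OF I(1)] l3(2) by blast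
      moreover have "vector [- \<zeta> / \<epsilon>, 1, 0] \<noteq> (0 :: 'k ^ 3)"
        by (metis vector_3(2) zero_index zero_neq_one)
      ultimately show ?thesis
        using z I0 by (intro point[of "vector [- \<zeta> / \<epsilon>, 1, 0]" "Var 2"]) (simp_all add: vector_3)
    next
      case True
      then have "Var 2 - Const (- 0 / \<zeta>) * Var 3 \<in> I"
        using l3 by (intro linear_form_solve[OF I(1)]) auto
      then have "Var 2 \<in> I" by simp
      moreover have "vector [1, 0, 0] \<noteq> (0 :: 'k ^ 3)"
        by (metis vector_3(1) zero_index zero_neq_one)
      ultimately show ?thesis
        using z I0 by (intro point[of "vector [1, 0, 0]" "Var 1"]) (simp_all add: vector_3)
    qed
    show ?thesis
    proof (cases "\<alpha> = 0 \<or> \<delta> = 0")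
      case True
      then have "Var 3 - Const (- 0 / (if \<alpha> = 0 then \<beta> else \<gamma>)) * Var 1 \<in> I"
        using l1 l2 by (intro linear_form_solve[OF I(1)]) (auto split: if_splits)
      then have "Var 3 \<in> I" by simp
      then show ?thesis by (rule z_case)
    next
      case False
      have "Var 2 - Const (- \<beta> / \<alpha>) * Var 3 \<in> I"
        using linear_form_solve[OF I(1) l1(2)] False by blast
      moreover have "Const \<delta> * Var 1 + Const \<gamma> * Var 3 \<in> I" using l2(2) by (simp add: add.commute)
      then have "Var 1 - Const (- \<gamma> / \<delta>) * Var 3 \<in> I" using linear_form_solve[OF I(1)] False by blast
      moreover have "vector [- \<gamma> / \<delta>, - \<beta> / \<alpha>, 1] \<noteq> (0 :: 'k ^ 3)"
        by (metis vector_3(3) zero_index zero_neq_one)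
      ultimately show ?thesis
        using I0 by (intro point[of "vector [- \<gamma> / \<delta>, - \<beta> / \<alpha>, 1]" "Var 3"]) (simp_all add: vector_3)
    qed
  qed
  note lines = this
  have n4: "(4::3) = 1" "(5::3) = 2" by simp_all
  obtain n1 c1 where f1: "\<exists>i\<le>n1. c1 i \<noteq> 0" "binary_form (\<lambda>i. Const (c1 i)) (Var 2) (Var 3) n1 \<in> A"
    using forms[of 1] by auto
  obtain n2 c2 where f2: "\<exists>i\<le>n2. c2 i \<noteq> 0" "binary_form (\<lambda>i. Const (c2 i)) (Var 3) (Var 1) n2 \<in> A"
    using forms[of 2] by (auto simp: n4)
  obtain n3 c3 where f3: "\<exists>i\<le>n3. c3 i \<noteq> 0" "binary_form (\<lambda>i. Const (c3 i)) (Var 1) (Var 2) n3 \<in> A"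
    using forms[of 3] by (auto simp: n4)
  show ?thesis
  proof (rule irrelevant_power_binary_form[OF A f1])
    fix \<alpha> \<beta> :: 'k assume ab: "\<alpha> \<noteq> 0 \<or> \<beta> \<noteq> 0"
    define I1 where "I1 = adjoin A (Const \<alpha> * Var 2 + Const \<beta> * Var 3)"
    have I1: "ring_ideal I1" "A \<subseteq> I1" "Const \<alpha> * Var 2 + Const \<beta> * Var 3 \<in> I1"
      unfolding I1_def using A by (auto intro: ring_ideal_adjoin adjoinI)
    have "binary_form (\<lambda>i. Const (c2 i)) (Var 3) (Var 1) n2 \<in> I1" using f2(2) I1(2) by blast
    then have "irrelevant_power I1"
    proof (rule irrelevant_power_binary_form[OF I1(1) f2(1)])
      fix \<gamma> \<delta> :: 'k assume cd: "\<gamma> \<noteq> 0 \<or> \<delta> \<noteq> 0"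
      define I2 where "I2 = adjoin I1 (Const \<gamma> * Var 3 + Const \<delta> * Var 1)"
      have I2: "ring_ideal I2" "I1 \<subseteq> I2" "Const \<gamma> * Var 3 + Const \<delta> * Var 1 \<in> I2"
        unfolding I2_def using I1(1) by (auto intro: ring_ideal_adjoin adjoinI)
      have "binary_form (\<lambda>i. Const (c3 i)) (Var 1) (Var 2) n3 \<in> I2" using f3(2) I1(2) I2(2) by blast
      then have "irrelevant_power I2"
      proof (rule irrelevant_power_binary_form[OF I2(1) f3(1)])
        fix \<epsilon> \<zeta> :: 'k assume ef: "\<epsilon> \<noteq> 0 \<or> \<zeta> \<noteq> 0"
        define I3 where "I3 = adjoin I2 (Const \<epsilon> * Var 1 + Const \<zeta> * Var 2)"
        have I3: "ring_ideal I3" "I2 \<subseteq> I3" "Const \<epsilon> * Var 1 + Const \<zeta> * Var 2 \<in> I3"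
          unfolding I3_def using I2(1) by (auto intro: ring_ideal_adjoin adjoinI)
        have sub: "A \<subseteq> I3" "Const \<alpha> * Var 2 + Const \<beta> * Var 3 \<in> I3" "Const \<gamma> * Var 3 + Const \<delta> * Var 1 \<in> I3"
          using I1 I2 I3 by blast+
        have "irrelevant_power I3" by (rule lines[OF I3(1) sub(1) ab sub(2) cd sub(3) ef I3(3)])
        then show "irrelevant_power (adjoin I2 (Const \<epsilon> * Var 1 + Const \<zeta> * Var 2))" by (simp only: I3_def)
      qed
      then show "irrelevant_power (adjoin I1 (Const \<gamma> * Var 3 + Const \<delta> * Var 1))" by (simp only: I2_def)
    qed
    then show "irrelevant_power (adjoin A (Const \<alpha> * Var 2 + Const \<beta> * Var 3))" by (simp only: I1_def)
  qed
qed

section \<open>Nodal and cuspidal curves\<close>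

lemma gradient_ideal_range: "gradient_ideal f = genideal ring_of_type_algebra (range (\<lambda>i. partial_deriv i f))"
proof -
  have "range (\<lambda>i. partial_deriv i f) = {partial_deriv 1 f, partial_deriv 2 f, partial_deriv 3 f}"
    by (simp add: UNIV_3)
  then show ?thesis by (simp add: gradient_ideal_def)
qed

theorem theorem2p6:
  fixes f :: "(3, 'k::{alg_closed_field, field_char_0}) mpoly" and d :: nat
  assumes "2 \<le> d" and "homogeneous d f" and "squarefree f"
    and "nodal f \<or> cuspidal f"
  shows "linear_type (gradient_ideal f)"
  unfolding gradient_ideal_range
proof (rule linear_typeI)
  let ?D = "\<lambda>i. partial_deriv i f"
  have d: "0 < d" using assms(1) by simp
  fix n P assume P: "homogeneous n P" "eval_hom (\<lambda>c. c) ?D P = 0"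
  show "P \<in> linear_relations ?D"
  proof (rule relations_are_linear[OF no_common_divisor_partial_derivs[OF assms(2) d assms(3)] _ P])
    fix A :: "(3, 'k) mpoly set"
    assume A: "ring_ideal A" "syzygy_coordinates ?D \<subseteq> A" and root: "\<And>s n. s ^ n \<in> A \<Longrightarrow> s \<in> A"
    have D: "?D i \<in> A" for i using generator_in_syzygy_coordinates[of ?D i] A(2) by blast
    have "irrelevant_power A"
    proof (rule irrelevant_power_if_no_zero[OF A(1)])
      fix v :: 3
      obtain n c s where c: "\<exists>i\<le>n. c i \<noteq> 0"
        "binary_form (\<lambda>i. Const (c i)) (Var (v + 1)) (Var (v + 2)) n = (\<Sum>i\<in>UNIV. s i * ?D i)"
        using elimination[OF assms(2) d assms(3), of v] by blast
      have "(\<Sum>i\<in>UNIV. s i * ?D i) \<in> A" by (intro ring_ideal_sum[OF A(1)] ring_idealD(3)[OF A(1)] D)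
      then show "\<exists>n c. (\<exists>i\<le>n. c i \<noteq> 0) \<and> binary_form (\<lambda>i. Const (c i)) (Var (v + 1)) (Var (v + 2)) n \<in> A"
        using c by metis
    next
      fix p :: "'k ^ 3" assume "p \<noteq> 0"
      then show "\<exists>k s. s \<in> A \<and> homogeneous k s \<and> eval_at s p \<noteq> 0"
        using homogeneous_syzygy_coordinate_at_point[OF assms(2,1,3,4)] A(2) by blast
    qed
    then show "\<forall>v. Var v \<in> A" using root unfolding irrelevant_power_def by blast
  qed
qed

end
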